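(* Let $q$ satisfy $x^\mu\tilde q(x)\in L_1(0,b)$ for some $0\le\mu<1/2$. Let $u_0$ be the regular solution of $$-u_0''+\left(\frac{\ell(\ell+1)}{x^2}+q(x)\right)u_0=0,\qquad x\in(0,b],$$ normalized by $u_0(x)\sim x^{\ell+1}$ as $x\to0$, and suppose that $u_0(x)\ne0$ for all $x\in(0,b]$. Then the coefficients $\beta_n$ satisfy $$\beta_0(x)=(2\ell+3)\left(\frac{u_0(x)}{x^{\ell+1}}-1\right)$$ and, for $n\ge1$, $$\beta_n(x)=-\frac{4n+2\ell+3}{4n+2\ell-1}\left[\beta_{n-1}(x)+\frac{2(4n+2\ell+1)u_0(x)\theta_n(x)}{x^{2n+\ell+1}}\right],$$ where $$\eta_n(x)=\int_0^x\bigl(tu_0'(t)+(2n+\ell)u_0(t)\bigr)t^{2n+\ell-1}\beta_{n-1}(t)\,dt,\qquad \theta_n(x)=\int_0^x\frac1{u_0^2(t)}\bigl(\eta_n(t)-t^{2n+\ell}\beta_{n-1}(t)u_0(t)\bigr)\,dt.$$ If moreover $q\in W_1^3[0,b]$, then the coefficients $\gamma_n$ satisfy $$\gamma_0(x)=(2\ell+3)\left(\frac{u_0'(x)}{x^{\ell+1}}-\frac{\ell+1}x-\frac{Q(x)}2\right)$$ and, for $n\ge1$, $$\gamma_n(x)=-\frac{4n+2\ell+3}{4n+2\ell-1}\left[\gamma_{n-1}(x)+(4n+2\ell+1)\left(\frac{2u_0'(x)\theta_n(x)}{x^{2n+\ell+1}}+\frac{2\eta_n(x)}{u_0(x)x^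{2n+\ell+1}}-\frac{\beta_{n-1}(x)}x\right)\right].$$
   Context: Standing setting: $b>0$, $\ell\ge-\frac12$ is real, $q$ is a complex-valued function on $(0,b]$; $\tilde q(x)=q(x)$ if $\ell>-1/2$ and $\tilde q(x)=(1-\log(x/b))q(x)$ if $\ell=-1/2$. $W_1^k[0,b]$ denotes the functions on $[0,b]$ possessing $k$ derivatives, the last one belonging to $L_1(0,b)$. $Q(x)=\int_0^xq(t)\,dt$. $j_\nu(z)=\sqrt{\pi/(2z)}\,J_{\nu+1/2}(z)$, $b_\ell(z)=zj_\ell(z)$, and $u(\omega,x)$ is the solution of $-u''+\left(\frac{\ell(\ell+1)}{x^2}+q(x)\right)u=\omega^2u$ on $(0,b]$ satisfying $u(\omega,x)\sim\frac{\sqrt\pi}{2^{\ell+1}\Gamma(\ell+3/2)}(\omega x)^{\ell+1}$ as $x\to0$ (the same branch of $\omega^{\ell+1}$ is used in all expressions). Put $d_\ell(\omega)=\frac{2^{\ell+1}\Gamma(\ell+3/2)}{\sqrt\pi\,\omega^{\ell+1}}$. For each $x\in(0,b]$, $\tilde R(x,\cdot)$ is the (known to exist) continuous even function on $[-x,x]$ with $$d_\ell(\omega)u(\omega,x)=d_\ell(\omega)b_\ell(\omega x)+\int_{-x}^x\tilde R(x,t)e^{i\omega t}\,dt,$$ and, for $q\in AC[0,b]$, $\tilde R^{(2)}(x,\cdot)$ is the (known to exist) even function supported on $[-x,x]$ with $$d_\ell(\omega)u'(\omega,x)=d_\ell(\omega)\Bigl(\omega b_\ell'(\omega x)+\frac{Q(x)}2b_\ell(\omega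 x)\Bigr)+\int_{-x}^x\tilde R^{(2)}(x,t)e^{i\omega t}\,dt.$$ $P_n^{(\alpha,\beta)}$ are the classical Jacobi polynomials, $h_n=\frac{2^{2\ell+3}}{2n+2\ell+3}\frac{\Gamma^2(n+\ell+2)}{n!\,\Gamma(n+2\ell+3)}$, $$\tilde\beta_n(x)=\frac1{h_{2n}}\int_{-x}^x\tilde R(x,t)P_{2n}^{(\ell+1,\ell+1)}\left(\tfrac tx\right)dt,\qquad\tilde\gamma_n(x)=\frac1{h_{2n}}\int_{-x}^x\tilde R^{(2)}(x,t)P_{2n}^{(\ell+1,\ell+1)}\left(\tfrac tx\right)dt,$$ $$\beta_n(x)=(-1)^n\frac{2\sqrt\pi\,\Gamma(\ell+2n+2)}{x^{\ell+1}\Gamma(\ell+3/2)(2n)!}\tilde\beta_n(x),\qquad\gamma_n(x)=(-1)^n\frac{2\sqrt\pi\,\Gamma(\ell+2n+2)}{x^{\ell+1}\Gamma(\ell+3/2)(2n)!}\tilde\gamma_n(x).$$ With these coefficients, $u(\omega,x)=\omega xj_\ell(\omega x)+\sum_{n\ge0}\beta_n(x)j_{\ell+2n+1}(\omega x)$ and, for $q\in W_1^3[0,b]$, $u'(\omega,x)=\omega^2xj_{\ell-1}(\omega x)+\bigl(\frac{xQ(x)}2-\ell\bigr)\omega j_\ell(\omega x)+\sum_{n\ge0}\gamma_n(x)j_{\ell+2n+1}(\omega x)$. *)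

theory Defs
  imports "HOL-Analysis.Analysis" "HOL-Library.Landau_Symbols"
begin

section \<open>Absolute continuity and the classes \<open>W\<^sub>1\<^sup>k[0,b]\<close>\<close>

text \<open>
  \<open>f\<close> is absolutely continuous on every compact subinterval of the interval \<open>S\<close>, with
  a.e. derivative \<open>g\<close>, in the form of an indefinite Lebesgue integral. For
  \<open>S = {0..b}\<close> this is absolute continuity on \<open>[0,b]\<close>, and \<open>g\<close> is in \<open>L\<^sub>1(0,b)\<close>.
\<close>
definition has_ac_derivative ::
    "(real \<Rightarrow> complex) \<Rightarrow> (real \<Rightarrow> complex) \<Rightarrow> real set \<Rightarrow> bool" where
  "has_ac_derivative f g S \<longleftrightarrow>
     (\<forall>c d. c \<le> d \<and> {c..d} \<subseteq> S \<longrightarrow>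
        g absolutely_integrable_on {c..d} \<and>
        f d - f c = (LINT t:{c..d}|lebesgue. g t))"

text \<open>
  From the second step on, \<open>g\<close> is itself continuous on \<open>[0,b]\<close> and hence the classical
  derivative of \<open>f\<close> there; only the last derivative is an a.e. one.
\<close>
primrec W1 :: "nat \<Rightarrow> real \<Rightarrow> (real \<Rightarrow> complex) set" where
  "W1 0 b = {f. f absolutely_integrable_on {0..b}}"
| "W1 (Suc k) b = {f. \<exists>g\<in>W1 k b. has_ac_derivative f g {0..b}}"

section \<open>Special functions\<close>

text \<open>
  Principal branches, cut along the nonpositive reals. Since \<open>rGamma\<close> is entire, the series
  is also correct when \<open>\<nu>\<close> is a negative integer.
\<close>
definition bessel_J :: "real \<Rightarrow> complex \<Rightarrow> complex" where
  "bessel_J \<nu> z = (z / 2) powr of_real \<nu> *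
     (\<Sum>k. (-1) ^ k / fact k * rGamma (of_real (\<nu> + real k + 1)) * (z / 2) ^ (2 * k))"

definition spherical_j :: "real \<Rightarrow> complex \<Rightarrow> complex" where
  "spherical_j \<nu> z = csqrt (of_real pi / (2 * z)) * bessel_J (\<nu> + 1 / 2) z"

definition bessel_b :: "real \<Rightarrow> complex \<Rightarrow> complex" where
  "bessel_b \<nu> z = z * spherical_j \<nu> z"

text \<open>\<open>P\<^sub>n\<^sup>(\<^sup>\<alpha>\<^sup>,\<^sup>\<beta>\<^sup>)\<close>, normalised by the value \<open>(n + \<alpha>) gchoose n\<close> at \<open>1\<close>.\<close>
definition jacobi_P :: "nat \<Rightarrow> real \<Rightarrow> real \<Rightarrow> real \<Rightarrow> real" where
  "jacobi_P n \<alpha> \<beta> x =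
     (\<Sum>s\<le>n. ((real n + \<alpha>) gchoose (n - s)) * ((real n + \<beta>) gchoose s) *
        ((x - 1) / 2) ^ s * ((x + 1) / 2) ^ (n - s))"

definition jacobi_h :: "real \<Rightarrow> nat \<Rightarrow> real" where
  "jacobi_h l n = 2 powr (2 * l + 3) / (2 * real n + 2 * l + 3) *
     (Gamma (real n + l + 2))\<^sup>2 / (fact n * Gamma (real n + 2 * l + 3))"

section \<open>The perturbed Bessel equation\<close>

definition q_tilde :: "real \<Rightarrow> real \<Rightarrow> (real \<Rightarrow> complex) \<Rightarrow> real \<Rightarrow> complex" where
  "q_tilde b l q x = (if l > -1/2 then q x else of_real (1 - ln (x / b)) * q x)"

definition Q_int :: "(real \<Rightarrow> complex) \<Rightarrow> real \<Rightarrow> complex" where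
  "Q_int q x = (LINT t:{0<..x}|lebesgue. q t)"

text \<open>
  \<open>u\<close> is a Caratheodory solution of \<open>-u'' + (l(l+1)/x\<^sup>2 + q) u = E u\<close> on \<open>(0,b]\<close>
  and \<open>u'\<close> is its derivative (one-sided at \<open>b\<close>).
\<close>
definition bessel_solution ::
    "real \<Rightarrow> real \<Rightarrow> (real \<Rightarrow> complex) \<Rightarrow> complex \<Rightarrow> (real \<Rightarrow> complex) \<Rightarrow> (real \<Rightarrow> complex) \<Rightarrow> bool"
  where
  "bessel_solution b l q E u u' \<longleftrightarrow>
     (\<forall>x\<in>{0<..b}. (u has_vector_derivative u' x) (at x within {0<..b})) \<and>
     (\<exists>w. has_ac_derivative u' w {0<..b} \<and>
        (AE x\<in>{0<..b} in lebesgue.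
           - w x + (of_real (l * (l + 1) / x\<^sup>2) + q x) * u x = E * u x))"

text \<open>
  The spectral parameter \<open>\<omega>\<close> ranges over the plane cut along the nonpositive reals, with the
  principal branch of \<open>\<omega> powr (l + 1)\<close> throughout; for \<open>x > 0\<close> the powers and Bessel
  functions of \<open>\<omega> * x\<close> are then on the same branch and holomorphic.
\<close>
definition regular_solutions ::
    "real \<Rightarrow> real \<Rightarrow> (real \<Rightarrow> complex) \<Rightarrow>
     (complex \<Rightarrow> real \<Rightarrow> complex) \<Rightarrow> (complex \<Rightarrow> real \<Rightarrow> complex) \<Rightarrow> bool" where
  "regular_solutions b l q u u' \<longleftrightarrow>
     (\<forall>\<omega>. \<omega> \<notin> \<real>\<^sub>\<le>\<^sub>0 \<longrightarrow>
        bessel_solution b l q (\<omega>\<^sup>2) (u \<omega>) (u' \<omega>) \<and>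
        u \<omega> \<sim>[at_right 0]
          (\<lambda>x. of_real (sqrt pi / (2 powr (l + 1) * Gamma (l + 3/2))) *
                (\<omega> * of_real x) powr of_real (l + 1)))"

definition d_coeff :: "real \<Rightarrow> complex \<Rightarrow> complex" where
  "d_coeff l \<omega> =
     of_real (2 powr (l + 1) * Gamma (l + 3/2) / sqrt pi) / \<omega> powr of_real (l + 1)"

section \<open>Transmutation kernels and their Fourier-Jacobi coefficients\<close>

definition is_R_kernel ::
    "real \<Rightarrow> real \<Rightarrow> (complex \<Rightarrow> real \<Rightarrow> complex) \<Rightarrow> (real \<Rightarrow> real \<Rightarrow> complex) \<Rightarrow> bool" where
  "is_R_kernel b l u R \<longleftrightarrow>
     (\<forall>x\<in>{0<..b}.
        continuous_on {-x..x} (R x) \<and>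
        (\<forall>t\<in>{-x..x}. R x (- t) = R x t) \<and>
        (\<forall>\<omega>. \<omega> \<notin> \<real>\<^sub>\<le>\<^sub>0 \<longrightarrow>
           d_coeff l \<omega> * u \<omega> x =
             d_coeff l \<omega> * bessel_b l (\<omega> * of_real x) +
             (LINT t:{-x..x}|lebesgue. R x t * exp (\<i> * \<omega> * of_real t))))"

definition is_R2_kernel ::
    "real \<Rightarrow> real \<Rightarrow> (real \<Rightarrow> complex) \<Rightarrow> (complex \<Rightarrow> real \<Rightarrow> complex) \<Rightarrow>
     (real \<Rightarrow> real \<Rightarrow> complex) \<Rightarrow> bool" where
  "is_R2_kernel b l q u' R2 \<longleftrightarrow>
     (\<forall>x\<in>{0<..b}.
        R2 x absolutely_integrable_on {-x..x} \<and>
        (\<forall>t. R2 x (- t) = R2 x t) \<and>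
        (\<forall>t. t \<notin> {-x..x} \<longrightarrow> R2 x t = 0) \<and>
        (\<forall>\<omega>. \<omega> \<notin> \<real>\<^sub>\<le>\<^sub>0 \<longrightarrow>
           d_coeff l \<omega> * u' \<omega> x =
             d_coeff l \<omega> * (\<omega> * deriv (bessel_b l) (\<omega> * of_real x) +
               Q_int q x / 2 * bessel_b l (\<omega> * of_real x)) +
             (LINT t:{-x..x}|lebesgue. R2 x t * exp (\<i> * \<omega> * of_real t))))"

text \<open>With \<open>K\<close> the first (second) kernel these are \<open>\<beta>\<^sub>n\<close> with a tilde (\<open>\<gamma>\<^sub>n\<close> with a tilde).\<close>
definition jacobi_coeff :: "real \<Rightarrow> (real \<Rightarrow> real \<Rightarrow> complex) \<Rightarrow> nat \<Rightarrow> real \<Rightarrow> complex" where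
  "jacobi_coeff l K n x =
     of_real (1 / jacobi_h l (2 * n)) *
     (LINT t:{-x..x}|lebesgue. K x t * of_real (jacobi_P (2 * n) (l + 1) (l + 1) (t / x)))"

text \<open>With \<open>K\<close> the first (second) kernel these are \<open>\<beta>\<^sub>n\<close> (\<open>\<gamma>\<^sub>n\<close>).\<close>
definition nsbf_coeff :: "real \<Rightarrow> (real \<Rightarrow> real \<Rightarrow> complex) \<Rightarrow> nat \<Rightarrow> real \<Rightarrow> complex" where
  "nsbf_coeff l K n x =
     of_real ((-1) ^ n * (2 * sqrt pi * Gamma (l + 2 * real n + 2)) /
       (x powr (l + 1) * Gamma (l + 3/2) * fact (2 * n))) *
     jacobi_coeff l K n x"

text \<open>In the four definitions below \<open>B\<close> stands for \<open>\<beta>\<close>; they are meant for \<open>n \<ge> 1\<close>.\<close>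
definition eta_integrand ::
    "real \<Rightarrow> (real \<Rightarrow> complex) \<Rightarrow> (real \<Rightarrow> complex) \<Rightarrow> (nat \<Rightarrow> real \<Rightarrow> complex) \<Rightarrow>
     nat \<Rightarrow> real \<Rightarrow> complex" where
  "eta_integrand l u0 u0' B n t =
     (of_real t * u0' t + of_real (2 * real n + l) * u0 t) *
     of_real (t powr (2 * real n + l - 1)) * B (n - 1) t"

definition eta ::
    "real \<Rightarrow> (real \<Rightarrow> complex) \<Rightarrow> (real \<Rightarrow> complex) \<Rightarrow> (nat \<Rightarrow> real \<Rightarrow> complex) \<Rightarrow>
     nat \<Rightarrow> real \<Rightarrow> complex" where
  "eta l u0 u0' B n x = (LINT t:{0<..x}|lebesgue. eta_integrand l u0 u0' B n t)"

definition theta_integrand ::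
    "real \<Rightarrow> (real \<Rightarrow> complex) \<Rightarrow> (real \<Rightarrow> complex) \<Rightarrow> (nat \<Rightarrow> real \<Rightarrow> complex) \<Rightarrow>
     nat \<Rightarrow> real \<Rightarrow> complex" where
  "theta_integrand l u0 u0' B n t =
     1 / (u0 t)\<^sup>2 *
     (eta l u0 u0' B n t - of_real (t powr (2 * real n + l)) * B (n - 1) t * u0 t)"

definition theta ::
    "real \<Rightarrow> (real \<Rightarrow> complex) \<Rightarrow> (real \<Rightarrow> complex) \<Rightarrow> (nat \<Rightarrow> real \<Rightarrow> complex) \<Rightarrow>
     nat \<Rightarrow> real \<Rightarrow> complex" where
  "theta l u0 u0' B n x = (LINT t:{0<..x}|lebesgue. theta_integrand l u0 u0' B n t)"

end

theory Submission
  imports Defs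
begin

text \<open>
  The idea is to compare Taylor coefficients in \<open>\<omega>\<^sup>2\<close> at \<open>\<omega> = 0\<close>, for fixed \<open>x\<close>. The
  coefficients \<open>\<beta>\<^sub>n\<close> and \<open>\<gamma>\<^sub>n\<close> are combinations of finitely many moments of the kernels, hence of
  finitely many Taylor coefficients of \<open>u\<close> and \<open>u'\<close>.

  \<^item> Write \<open>d\<^sub>l(\<omega>) u = u\<^sub>0 g\<close>, so that \<open>g \<rightarrow> 1\<close> at \<open>0\<close>. The Wronskian of \<open>u\<^sub>0\<close> and \<open>u\<close> is free of the potential, and integrating it
  twice gives \<open>g = 1 - \<omega>\<^sup>2 \<integral> u\<^sub>0\<^sup>-\<^sup>2 \<integral> u\<^sub>0\<^sup>2 g\<close>. Iteration yields \<open>d\<^sub>l(\<omega>) u(\<omega>,x) = \<Sum> \<omega>\<^sup>2\<^sup>k \<phi>\<^sub>k(x)\<close> with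
  \<open>\<phi>\<^sub>k = u\<^sub>0 r\<^sub>k\<close> and \<open>r\<^sub>k\<close> iterated integrals of \<open>u\<^sub>0\<close> (lemmas \<open>spectral_series_sums\<close>, \<open>taylor_solution\<close>).

  \<^item> The representation by the kernel gives the same coefficients as those of the Bessel function plus
  the even moments of the kernel (\<open>fourier_moment_sums\<close>, \<open>d_coeff_bessel_b\<close>). Inserting the explicit
  coefficients of the Jacobi polynomials, all Gamma factors collapse (\<open>nsbf_normalization\<close>) and
  \<open>\<beta>\<^sub>n / (4n+2l+3) + (-1)\<^sup>n = \<Sum>\<^sub>k\<^sub>\<le>\<^sub>n g\<^sub>n\<^sub>k x\<^sup>-\<^sup>l\<^sup>-\<^sup>1\<^sup>-\<^sup>2\<^sup>k \<phi>\<^sub>k\<close> with \<open>g\<^sub>n\<^sub>k = 4\<^sup>k (l+3/2)\<^sub>n\<^sub>+\<^sub>k / (n-k)!\<close>;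
  here \<open>(-1)\<^sup>n\<close> is the contribution of the Bessel function (\<open>sum_nsbf_weight_bessel\<close>).

  \<^item> Call the left-hand side \<open>A\<^sub>n\<close>. Two neighbouring ones add up to a multiple of
  \<open>x\<^sup>-\<^sup>2\<^sup>n\<^sup>-\<^sup>l\<^sup>-\<^sup>1 u\<^sub>0 \<rho>\<close>, where \<open>\<rho>\<close> is a combination of \<open>x\<^sup>2\<^sup>n\<^sup>-\<^sup>2\<^sup>k r\<^sub>k\<close> with
  \<open>(u\<^sub>0\<^sup>2 \<rho>')' = 4 u\<^sub>0 x\<^sup>2\<^sup>n\<^sup>+\<^sup>l A'\<^bsub>n-1\<^esub>\<close> (\<open>Ahat_Suc_add\<close>, \<open>rho_deriv\<close>, \<open>V_deriv\<close>). Integrating this by parts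
  produces \<open>\<eta>\<^sub>n\<close>, and a second integration produces \<open>\<theta>\<^sub>n\<close> (\<open>eta_eq\<close>, \<open>theta_eq\<close>). The formula for \<open>\<gamma>\<^sub>n\<close>
  follows in the same way from the coefficients \<open>\<phi>'\<^sub>k\<close> of \<open>u'\<close>.
\<close>

section \<open>Power bounds and primitives on \<open>(0,b]\<close>\<close>

text \<open>
  The mean value inequality on \<open>[y,x]\<close> in the limit \<open>y \<rightarrow> 0\<close>. The constant is not enlarged, which
  keeps the constants in iterated integrals geometric.
\<close>
lemma norm_le_powr_of_derivative:
  fixes F f :: "real \<Rightarrow> complex"
  assumes der: "\<And>x. x \<in> {0<..b} \<Longrightarrow> (F has_vector_derivative f x) (at x within {0<..b})"
    and lim: "(F \<longlongrightarrow> 0) (at_right 0)"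
    and bound: "\<And>x. x \<in> {0<..b} \<Longrightarrow> norm (f x) \<le> M * x powr a"
    and "a \<ge> 0" and x: "x \<in> {0<..b}"
  shows "norm (F x) \<le> M * x powr (a + 1)"
proof -
  have x0: "0 < x" using x by simp
  have "0 \<le> M * x powr a" using bound[OF x] norm_ge_zero order_trans by blast
  then have M: "0 \<le> M" using x0 by (simp add: zero_le_mult_iff)
  have step: "norm (F x - F y) \<le> M * x powr (a + 1)" if y: "0 < y" "y < x" for y
  proof -
    have "norm (F x - F y) \<le> M * x powr a * norm (x - y)"
    proof (rule differentiable_bound[where S = "{y..x}" and f' = "\<lambda>t h. h *\<^sub>R f t"])
      fix t assume t: "t \<in> {y..x}"
      then have tb: "t \<in> {0<..b}" using x y by auto
      show "(F has_derivative (\<lambda>h. h *\<^sub>R f t)) (at t within {y..x})"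
        using der[OF tb] x y unfolding has_vector_derivative_def
        by (elim has_derivative_subset) auto
      have "norm (f t) \<le> M * x powr a"
        using bound[OF tb] t y M \<open>a \<ge> 0\<close>
        by (meson atLeastAtMost_iff less_imp_le mult_left_mono order_trans powr_mono2)
      then show "onorm (\<lambda>h. h *\<^sub>R f t) \<le> M * x powr a"
        by (intro onorm_le) (simp add: mult.commute mult_left_mono)
    qed (use y in auto)
    also have "\<dots> \<le> M * x powr a * x" using y M by (intro mult_left_mono) auto
    finally show ?thesis using x0 by (simp add: powr_add)
  qed
  have "((\<lambda>y. norm (F x - F y)) \<longlongrightarrow> norm (F x - 0)) (at_right 0)"
    by (intro tendsto_intros lim)
  then have "norm (F x - 0) \<le> M * x powr (a + 1)"
  proof (rule tendsto_upperbound)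
    show "\<forall>\<^sub>F y in at_right 0. norm (F x - F y) \<le> M * x powr (a + 1)"
      using eventually_at_right_real[OF x0] by eventually_elim (use step in auto)
  qed simp
  then show ?thesis by simp
qed

lemma eq_of_derivative_eq:
  fixes F G f :: "real \<Rightarrow> complex"
  assumes "\<And>x. x \<in> {0<..b} \<Longrightarrow> (F has_vector_derivative f x) (at x within {0<..b})"
    and "\<And>x. x \<in> {0<..b} \<Longrightarrow> (G has_vector_derivative f x) (at x within {0<..b})"
    and "(F \<longlongrightarrow> 0) (at_right 0)" "(G \<longlongrightarrow> 0) (at_right 0)"
    and x: "x \<in> {0<..b}"
  shows "F x = G x"
proof -
  have "norm (F x - G x) \<le> 0 * x powr (0 + 1)"
  proof (rule norm_le_powr_of_derivative[where F = "\<lambda>x. F x - G x" and f = "\<lambda>x. 0" and b = b])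
    show "((\<lambda>x. F x - G x) \<longlongrightarrow> 0) (at_right 0)"
      using tendsto_diff[OF assms(3,4)] by simp
    show "((\<lambda>x. F x - G x) has_vector_derivative 0) (at y within {0<..b})" if "y \<in> {0<..b}" for y
      using has_vector_derivative_diff[OF assms(1,2)[OF that]] by simp
  qed (use x in auto)
  then show ?thesis by simp
qed

lemma tendsto_zero_of_powr_bound:
  fixes F :: "real \<Rightarrow> complex"
  assumes "\<And>x. x \<in> {0<..b} \<Longrightarrow> norm (F x) \<le> M * x powr a" and "a > 0" "b > 0"
  shows "(F \<longlongrightarrow> 0) (at_right 0)"
proof (rule Lim_null_comparison)
  show "\<forall>\<^sub>F x in at_right 0. norm (F x) \<le> M * x powr a"
    using eventually_at_right_real[OF \<open>b > 0\<close>] by eventually_elim (use assms(1) in auto)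
  have "((\<lambda>x::real. x powr a) \<longlongrightarrow> 0) (at_right 0)"
    using \<open>a > 0\<close>
    by (auto intro!: tendsto_eq_intros simp: eventually_at_filter)
  then show "((\<lambda>x. M * x powr a) \<longlongrightarrow> 0) (at_right 0)"
    by (auto intro: tendsto_mult_right_zero)
qed

lemma continuous_on_extend_zero:
  fixes f :: "real \<Rightarrow> complex"
  assumes f: "continuous_on {0<..b} f" and lim: "(f \<longlongrightarrow> L) (at_right 0)" and b: "b > 0"
  shows "continuous_on {0..b} (\<lambda>x. if x = 0 then L else f x)"
proof -
  define h where "h = (\<lambda>x. if x = 0 then L else f x)"
  have "continuous (at x within {0..b}) h" if x: "x \<in> {0..b}" for x
  proof (cases "x = 0")
    case True
    have "(h \<longlongrightarrow> L) (at_right 0)"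
      using lim by (rule Lim_transform_within[OF _ zero_less_one]) (auto simp: h_def)
    then have "(h \<longlongrightarrow> L) (at 0 within {0..b})"
      using b by (simp add: at_within_Icc_at_right)
    then show ?thesis by (simp add: continuous_within True) (simp add: h_def)
  next
    case False
    have "continuous (at x within {0<..b}) f"
      using x False f by (auto simp: continuous_on_eq_continuous_within)
    moreover have "at x within {0<..b} = at x within {0..b}"
      by (rule at_within_nhd[of x "{0<..}"]) (use x False in auto)
    ultimately have "continuous (at x within {0..b}) f" by simp
    then show ?thesis
      by (rule continuous_transform_within[where \<delta> = x]) (use x False in \<open>auto simp: h_def dist_real_def\<close>)
  qed
  then show ?thesis by (simp add: continuous_on_eq_continuous_within h_def)
qed

text \<open>
  The estimate \<open>O(x\<^sup>a)\<close> as \<open>x \<rightarrow> 0\<close>, but on all of \<open>(0,b]\<close>, so that it can be integrated from \<open>0\<close>.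
\<close>
definition powr_bounded :: "real \<Rightarrow> (real \<Rightarrow> complex) \<Rightarrow> real \<Rightarrow> bool" where
  "powr_bounded b f a \<longleftrightarrow> (\<exists>M. \<forall>x\<in>{0<..b}. norm (f x) \<le> M * x powr a)"

lemma powr_boundedI: "(\<And>x. 0 < x \<Longrightarrow> x \<le> b \<Longrightarrow> norm (f x) \<le> M * x powr a) \<Longrightarrow> powr_bounded b f a"
  unfolding powr_bounded_def by (intro exI[of _ M]) auto

lemma powr_boundedE:
  assumes "powr_bounded b f a"
  obtains M where "M \<ge> 0" "\<And>x. x \<in> {0<..b} \<Longrightarrow> norm (f x) \<le> M * x powr a"
proof -
  obtain M where "\<forall>x\<in>{0<..b}. norm (f x) \<le> M * x powr a"
    using assms unfolding powr_bounded_def by blast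
  then have "norm (f x) \<le> max M 0 * x powr a" if "x \<in> {0<..b}" for x
    using that by (smt (verit, best) mult_right_mono powr_ge_zero)
  then show ?thesis using that[of "max M 0"] by simp
qed

lemma powr_bounded_mult:
  assumes "powr_bounded b f a" "powr_bounded b g a'"
  shows "powr_bounded b (\<lambda>x. f x * g x) (a + a')"
proof -
  obtain M M' where M: "M \<ge> 0" "\<And>x. x \<in> {0<..b} \<Longrightarrow> norm (f x) \<le> M * x powr a"
    and M': "M' \<ge> 0" "\<And>x. x \<in> {0<..b} \<Longrightarrow> norm (g x) \<le> M' * x powr a'"
    using assms by (auto elim!: powr_boundedE)
  show ?thesis
  proof (rule powr_boundedI)
    fix x assume x: "0 < x" "x \<le> b"
    then have "norm (f x) * norm (g x) \<le> (M * x powr a) * (M' * x powr a')"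
      using M M' by (intro mult_mono) auto
    then show "norm (f x * g x) \<le> (M * M') * x powr (a + a')"
      by (simp add: norm_mult powr_add mult_ac)
  qed
qed

lemma powr_bounded_add:
  assumes "powr_bounded b f a" "powr_bounded b g a"
  shows "powr_bounded b (\<lambda>x. f x + g x) a"
proof -
  obtain M M' where M: "M \<ge> 0" "\<And>x. x \<in> {0<..b} \<Longrightarrow> norm (f x) \<le> M * x powr a"
    and M': "M' \<ge> 0" "\<And>x. x \<in> {0<..b} \<Longrightarrow> norm (g x) \<le> M' * x powr a"
    using assms by (auto elim!: powr_boundedE)
  show ?thesis
  proof (rule powr_boundedI)
    fix x assume x: "0 < x" "x \<le> b"
    show "norm (f x + g x) \<le> (M + M') * x powr a"
      using norm_triangle_le[OF add_mono[OF M(2)[of x] M'(2)[of x]]] x by (simp add: ring_distribs)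
  qed
qed

lemma powr_bounded_mono:
  assumes "powr_bounded b f a'" "a \<le> a'"
  shows "powr_bounded b f a"
proof -
  obtain M where M: "M \<ge> 0" "\<And>x. x \<in> {0<..b} \<Longrightarrow> norm (f x) \<le> M * x powr a'"
    using assms(1) by (auto elim!: powr_boundedE)
  show ?thesis
  proof (rule powr_boundedI)
    fix x assume x: "0 < x" "x \<le> b"
    have "x powr a' = x powr (a' - a) * x powr a" by (simp flip: powr_add)
    also have "\<dots> \<le> b powr (a' - a) * x powr a"
      using x assms(2) by (intro mult_right_mono powr_mono2) auto
    finally show "norm (f x) \<le> (M * b powr (a' - a)) * x powr a"
      using M(2)[of x] M(1) x by (smt (verit, best) greaterThanAtMost_iff mult.assoc mult_left_mono)
  qed
qed

lemma powr_bounded_powr: "powr_bounded b (\<lambda>x. of_real (x powr a)) a"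
  by (rule powr_boundedI[where M = 1]) simp

lemma powr_bounded_const: "powr_bounded b (\<lambda>x. c) 0"
  by (rule powr_boundedI[where M = "norm c"]) simp

lemma powr_bounded_cmult:
  assumes "powr_bounded b f a"
  shows "powr_bounded b (\<lambda>x. c * f x) a"
  using powr_bounded_mult[OF powr_bounded_const assms] by simp

lemma powr_bounded_uminus:
  assumes "powr_bounded b f a"
  shows "powr_bounded b (\<lambda>x. - f x) a"
  using powr_bounded_cmult[OF assms, of "-1"] by simp

lemma powr_bounded_diff:
  assumes "powr_bounded b f a" "powr_bounded b g a"
  shows "powr_bounded b (\<lambda>x. f x - g x) a"
  using powr_bounded_add[OF assms(1) powr_bounded_uminus[OF assms(2)]] by simp

lemma powr_bounded_sum:
  assumes "\<And>i. i \<in> I \<Longrightarrow> powr_bounded b (f i) a"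
  shows "powr_bounded b (\<lambda>x. \<Sum>i\<in>I. f i x) a"
proof (cases "finite I")
  case True
  then show ?thesis using assms
  proof (induction I rule: finite_induct)
    case empty
    then show ?case by (auto intro: powr_boundedI[where M = 0])
  next
    case (insert i I)
    then show ?case by (auto intro: powr_bounded_add)
  qed
qed (auto intro: powr_boundedI[where M = 0])

lemma powr_bounded_cong:
  assumes "\<And>x. x \<in> {0<..b} \<Longrightarrow> f x = g x" "powr_bounded b f a"
  shows "powr_bounded b g a"
  using assms unfolding powr_bounded_def by auto

lemma powr_bounded_tendsto_0:
  assumes "powr_bounded b f a" "a > 0" "b > 0"
  shows "(f \<longlongrightarrow> 0) (at_right 0)"
  using assms(1) by (rule powr_boundedE) (rule tendsto_zero_of_powr_bound[OF _ assms(2,3)])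

lemma at_within_Icc_eq_Ioc:
  assumes "0 < y" "y < (x::real)"
  shows "at x within {y..b} = at x within {0<..b}"
  by (rule at_within_nhd[of x "{y<..}"]) (use assms in auto)

text \<open>
  The form of integral in which \<open>\<eta>\<close> and \<open>\<theta>\<close> are defined; the integrands are meaningless at \<open>0\<close>.
\<close>
definition prim :: "(real \<Rightarrow> complex) \<Rightarrow> real \<Rightarrow> complex" where
  "prim f x = (LINT t:{0<..x}|lebesgue. f t)"

context
  fixes f :: "real \<Rightarrow> complex" and b a :: real
  assumes cont: "continuous_on {0<..b} f"
    and bounded: "powr_bounded b f a"
    and a: "a \<ge> 0"
begin

lemma absolutely_integrable_powr_bound:
  assumes x: "x \<in> {0<..b}"
  shows "f absolutely_integrable_on {0<..x}"
proof -
  obtain M where M: "M \<ge> 0" "\<And>x. x \<in> {0<..b} \<Longrightarrow> norm (f x) \<le> M * x powr a"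
    using bounded by (auto elim!: powr_boundedE)
  show ?thesis
  proof (rule measurable_bounded_by_integrable_imp_absolutely_integrable)
  have "continuous_on {0<..x} f" using cont x by (auto intro: continuous_on_subset)
  then show "f \<in> borel_measurable (lebesgue_on {0<..x})"
    by (intro continuous_imp_measurable_on_sets_lebesgue) auto
  have "(\<lambda>t::real. M * b powr a) integrable_on {0..x}"
    by (rule integrable_const_ivl)
  then show "(\<lambda>t::real. M * b powr a) integrable_on {0<..x}"
    by (rule integrable_spike_set) (auto intro: negligible_subset[of "{0}"])
  show "norm (f t) \<le> M * b powr a" if "t \<in> {0<..x}" for t
    using M(2)[of t] that x a M(1)
    by (smt (verit, best) greaterThanAtMost_iff mult_left_mono powr_mono2)
  qed auto
qed

lemma prim_eq_integral:
  assumes x: "x \<in> {0<..b}"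
  shows "f integrable_on {0..x}" "prim f x = integral {0..x} f"
proof -
  have i: "f integrable_on {0<..x}"
    using absolutely_integrable_powr_bound[OF x] set_lebesgue_integral_eq_integral(1) by blast
  then show "f integrable_on {0..x}"
    by (rule integrable_spike_set) (auto intro: negligible_subset[of "{0}"])
  have "prim f x = integral {0<..x} f"
    unfolding prim_def using absolutely_integrable_powr_bound[OF x]
    by (simp add: set_lebesgue_integral_eq_integral)
  also have "\<dots> = integral {0..x} f"
    by (rule integral_spike_set) (auto intro: negligible_subset[of "{0}"])
  finally show "prim f x = integral {0..x} f" .
qed

lemma has_vector_derivative_prim:
  assumes x: "x \<in> {0<..b}"
  shows "(prim f has_vector_derivative f x) (at x within {0<..b})"
proof -
  define y where "y = x / 2"
  have y: "0 < y" "y < x" "x \<le> b" using x by (auto simp: y_def)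
  have "continuous_on {y..b} f" using cont y by (auto intro: continuous_on_subset)
  then have "((\<lambda>u. integral {y..u} f) has_vector_derivative f x) (at x within {y..b})"
    using y by (intro integral_has_vector_derivative) auto
  then have "((\<lambda>u. prim f y + integral {y..u} f) has_vector_derivative f x) (at x within {y..b})"
    using has_vector_derivative_add[OF has_vector_derivative_const] by fastforce
  then have "(prim f has_vector_derivative f x) (at x within {y..b})"
  proof (rule has_vector_derivative_transform[rotated 2])
    show "prim f u = prim f y + integral {y..u} f" if "u \<in> {y..b}" for u
      using that y prim_eq_integral[of u] prim_eq_integral[of y]
      by (simp add: Henstock_Kurzweil_Integration.integral_combine)
  qed (use y in auto)
  then show ?thesis by (simp only: at_within_Icc_eq_Ioc[OF y(1,2)])
qed

lemma powr_bounded_prim: "powr_bounded b (prim f) (a + 1)"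
proof -
  obtain M where M: "M \<ge> 0" "\<And>x. x \<in> {0<..b} \<Longrightarrow> norm (f x) \<le> M * x powr a"
    using bounded by (auto elim!: powr_boundedE)
  have "norm (prim f x) \<le> M * x powr (a + 1)" if x: "x \<in> {0<..b}" for x
  proof -
  have f: "f integrable_on {0<..x}"
    using absolutely_integrable_powr_bound[OF x] set_lebesgue_integral_eq_integral(1) by blast
  have c: "((\<lambda>t. M * x powr a) has_integral (M * x powr a * x)) {0<..x}"
  proof -
    have "((\<lambda>t. M * x powr a) has_integral (M * x powr a * x)) {0..x}"
      using has_integral_const_real[of "M * x powr a" 0 x] x by (simp add: mult.commute)
    then show ?thesis
      by (rule has_integral_spike_set_eq[THEN iffD1, rotated 2])
         (auto intro: negligible_subset[of "{0}"])
  qed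
  have "prim f x = integral {0<..x} f"
    unfolding prim_def using absolutely_integrable_powr_bound[OF x]
    by (simp add: set_lebesgue_integral_eq_integral)
  also have "norm \<dots> \<le> integral {0<..x} (\<lambda>t. M * x powr a)"
  proof (rule integral_norm_bound_integral[OF f])
    fix t assume "t \<in> {0<..x}"
    then show "norm (f t) \<le> M * x powr a"
      using M(2)[of t] x M(1) a
      by (smt (verit, best) greaterThanAtMost_iff mult_left_mono powr_mono2)
  qed (use c in auto)
  also have "\<dots> = M * x powr a * x"
    using c by blast
  finally show ?thesis using x by (simp add: powr_add)
  qed
  then show ?thesis unfolding powr_bounded_def by blast
qed

lemma prim_tendsto_0: 
  assumes "b > 0"
  shows "(prim f \<longlongrightarrow> 0) (at_right 0)"
  by (rule powr_bounded_tendsto_0[OF powr_bounded_prim]) (use a assms in auto)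

end

lemma prim_eqI:
  fixes F f :: "real \<Rightarrow> complex"
  assumes "continuous_on {0<..b} f" "powr_bounded b f a" "a \<ge> 0"
    and "\<And>x. x \<in> {0<..b} \<Longrightarrow> (F has_vector_derivative f x) (at x within {0<..b})"
    and "(F \<longlongrightarrow> 0) (at_right 0)" and "x \<in> {0<..b}"
  shows "prim f x = F x"
  by (rule eq_of_derivative_eq[OF has_vector_derivative_prim[OF assms(1-3)] assms(4) _ assms(5)])
     (use assms prim_tendsto_0[OF assms(1-3)] in auto)

lemma has_vector_derivative_iff_quotient:
  fixes f :: "real \<Rightarrow> complex"
  shows "(f has_vector_derivative D) (at x within S) \<longleftrightarrow>
    ((\<lambda>y. (f y - f x) / of_real (y - x)) \<longlongrightarrow> D) (at x within S)"
proof -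
  have "((\<lambda>y. norm ((f y - f x) - (y - x) *\<^sub>R D) / norm (y - x)) \<longlongrightarrow> 0) (at x within S) \<longleftrightarrow>
    ((\<lambda>y. norm ((f y - f x) / of_real (y - x) - D)) \<longlongrightarrow> 0) (at x within S)"
  proof (rule tendsto_cong)
    have "norm ((f y - f x) - (y - x) *\<^sub>R D) / norm (y - x) = norm ((f y - f x) / of_real (y - x) - D)"
      if "y \<noteq> x" for y
    proof -
      have "(f y - f x) / of_real (y - x) - D = ((f y - f x) - (y - x) *\<^sub>R D) / of_real (y - x)"
        using that by (simp add: field_simps scaleR_conv_of_real)
      then show ?thesis by (simp only: norm_divide norm_of_real real_norm_def)
    qed
    then show "\<forall>\<^sub>F y in at x within S. norm ((f y - f x) - (y - x) *\<^sub>R D) / norm (y - x) =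
        norm ((f y - f x) / of_real (y - x) - D)"
      by (auto simp: eventually_at_filter)
  qed
  then show ?thesis
    unfolding has_vector_derivative_def has_derivative_iff_norm
    by (simp add: bounded_linear_scaleR_left tendsto_norm_zero_iff Lim_null[symmetric])
qed

lemma absolutely_integrable_mult_continuous:
  fixes K f :: "real \<Rightarrow> complex"
  assumes K: "K absolutely_integrable_on {a..b}" and f: "continuous_on {a..b} f"
  shows "(\<lambda>t. K t * f t) absolutely_integrable_on {a..b}"
proof -
  have "(\<lambda>t. f t * K t) absolutely_integrable_on {a..b}"
  proof (rule absolutely_integrable_bounded_measurable_product[where h = "(*)" and f = f, OF _ _ _ _ K])
    show "bilinear ((*) :: complex \<Rightarrow> complex \<Rightarrow> complex)" by (rule bilinear_times)
    show "f \<in> borel_measurable (lebesgue_on {a..b})"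
      by (intro continuous_imp_measurable_on_sets_lebesgue f) auto
    show "bounded (f ` {a..b})"
      by (intro compact_imp_bounded compact_continuous_image f) auto
  qed auto
  then show ?thesis by (simp add: mult.commute)
qed

text \<open>
  Integration by parts with one absolutely continuous factor, in differentiated form. The increment
  from \<open>s\<close> to \<open>t\<close> of the function on the left is \<open>(f t - f s) F t\<close> minus the integral of
  \<open>(f - f s) w\<close>. That integral is at most \<open>const \<bar>t - s\<bar>\<close> times the integral of \<open>\<bar>w\<bar>\<close> between \<open>s\<close> and
  \<open>t\<close>, hence \<open>o(t - s)\<close>. So the derivative exists everywhere, although that of \<open>F\<close> does so only almost
  everywhere.
\<close>
lemma has_vector_derivative_mult_ac:
  fixes f f' F w :: "real \<Rightarrow> complex"
  assumes ac: "\<And>x y. c \<le> x \<Longrightarrow> x \<le> y \<Longrightarrow> y \<le> d \<Longrightarrow> F y - F x = integral {x..y} w"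
    and w: "w absolutely_integrable_on {c..d}"
    and der: "\<And>x. x \<in> {c..d} \<Longrightarrow> (f has_vector_derivative f' x) (at x within {c..d})"
    and s: "s \<in> {c..d}"
  shows "(\<lambda>t. f t * w t) integrable_on {c..d}"
    and "((\<lambda>x. f x * F x - integral {c..x} (\<lambda>t. f t * w t)) has_vector_derivative f' s * F s)
           (at s within {c..d})"
proof -
  have cf: "continuous_on {c..d} f"
    using der by (meson continuous_on_vector_derivative)
  have "(\<lambda>t. f t * w t) absolutely_integrable_on {c..d}"
    using absolutely_integrable_mult_continuous[OF w cf] by (simp only: mult.commute)
  then show fw: "(\<lambda>t. f t * w t) integrable_on {c..d}"
    using set_lebesgue_integral_eq_integral(1) by blast
  have wi: "w integrable_on {c..d}" "(\<lambda>t. norm (w t)) integrable_on {c..d}"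
    using w by (auto simp: absolutely_integrable_on_def)
  have sub: "g integrable_on {x..y}" if "g integrable_on {c..d}" "c \<le> x" "y \<le> d" for x y and g :: "real \<Rightarrow> 'b :: banach"
    using integrable_on_subinterval[OF that(1)] that(2,3) by auto
  define N where "N = (\<lambda>x. integral {c..x} (\<lambda>t. norm (w t)))"
  have N: "(N \<longlongrightarrow> N s) (at s within {c..d})"
    using indefinite_integral_continuous_1[OF wi(2)] s unfolding N_def continuous_on_def by blast
  have F: "(F \<longlongrightarrow> F s) (at s within {c..d})"
  proof (rule Lim_transform_within)
    have lim: "((\<lambda>x. integral {c..x} w) \<longlongrightarrow> integral {c..s} w) (at s within {c..d})"
      using indefinite_integral_continuous_1[OF wi(1)] s unfolding continuous_on_def by blast
    have eq: "F s = F c + integral {c..s} w"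
      using ac[of c s] s by (simp add: algebra_simps)
    show "((\<lambda>x. F c + integral {c..x} w) \<longlongrightarrow> F s) (at s within {c..d})"
      unfolding eq by (intro tendsto_add tendsto_const lim)
    show "F c + integral {c..x} w = F x" if "x \<in> {c..d}" for x
      using ac[of c x] that by (simp add: algebra_simps)
  qed (rule zero_less_one)
  let ?I = "\<lambda>x y. integral {x..y} (\<lambda>r. (f r - f s) * w r)"
  let ?fw = "(\<lambda>t. f t * w t)"
  let ?at = "(at s within {c..d})"
  define E where "E = (\<lambda>t. if s \<le> t then ?I s t
     else - ?I t s)"
  define H where "H = (\<lambda>x. f x * F x - integral {c..x} ?fw)"
  have I: "?I x y = integral {x..y} ?fw - f s * (F y - F x)"
    if "c \<le> x" "x \<le> y" "y \<le> d" for x y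
    using that sub[OF fw that(1,3)] sub[OF wi(1) that(1,3)]
    by (simp add: ac left_diff_distrib integral_diff integrable_on_mult_right)
  have J: "integral {c..y} g - integral {c..x} g = integral {x..y} g"
    if "g integrable_on {c..d}" "c \<le> x" "x \<le> y" "y \<le> d" for x y and g :: "real \<Rightarrow> 'b :: banach"
    using Henstock_Kurzweil_Integration.integral_combine[OF that(2,3) sub[OF that(1) order_refl that(4)]]
    by (simp add: algebra_simps)
  have H: "H t - H s = (f t - f s) * F t - E t" if t: "t \<in> {c..d}" for t
  proof (cases "s \<le> t")
    case True
    then show ?thesis using I[of s t] J[OF fw, of s t] s t
      by (simp add: H_def E_def algebra_simps)
  next
    case False
    then show ?thesis using I[of t s] J[OF fw, of t s] s t
      by (simp add: H_def E_def algebra_simps)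
  qed
  have Q: "((\<lambda>y. (f y - f s) / of_real (y - s)) \<longlongrightarrow> f' s) ?at"
    using der[OF s] by (simp add: has_vector_derivative_iff_quotient)
  define L where "L = norm (f' s) + 1"
  have "\<forall>\<^sub>F y in at s within {c..d}. norm ((f y - f s) / of_real (y - s)) < L"
    using tendsto_norm[OF Q] by (rule order_tendstoD) (simp add: L_def)
  then obtain \<delta> where \<delta>: "\<delta> > 0"
    "\<And>y. y \<in> {c..d} \<Longrightarrow> y \<noteq> s \<Longrightarrow> dist y s < \<delta> \<Longrightarrow> norm ((f y - f s) / of_real (y - s)) < L"
    unfolding eventually_at by auto
  have lip: "norm (f y - f s) \<le> L * \<bar>y - s\<bar>" if "y \<in> {c..d}" "dist y s < \<delta>" for y
    using \<delta>(2)[OF that(1) _ that(2)]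
    by (cases "y = s") (auto simp: norm_divide field_simps simp flip: of_real_diff)
  have EI: "norm (?I x y) \<le> L * \<bar>y - x\<bar> * (N y - N x)"
    if xy: "c \<le> x" "x \<le> y" "y \<le> d" "dist x s < \<delta>" "dist y s < \<delta>" "x = s \<or> y = s" for x y
  proof -
    have "norm (?I x y) \<le> integral {x..y} (\<lambda>r. L * \<bar>y - x\<bar> * norm (w r))"
    proof (rule integral_norm_bound_integral)
      show "(\<lambda>r. (f r - f s) * w r) integrable_on {x..y}"
        using sub[OF fw xy(1,3)] sub[OF wi(1) xy(1,3)]
        by (auto simp: left_diff_distrib intro!: integrable_diff integrable_on_mult_right)
      show "(\<lambda>r. L * \<bar>y - x\<bar> * norm (w r)) integrable_on {x..y}"
        by (intro integrable_on_mult_right sub[OF wi(2) xy(1,3)])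
      fix r assume r: "r \<in> {x..y}"
      have "norm (f r - f s) \<le> L * \<bar>r - s\<bar>" 
        using lip[of r] r xy by (auto simp: dist_real_def)
      also have "\<dots> \<le> L * \<bar>y - x\<bar>" using r xy by (intro mult_left_mono) (auto simp: L_def)
      finally show "norm ((f r - f s) * w r) \<le> L * \<bar>y - x\<bar> * norm (w r)"
        by (simp add: norm_mult mult_right_mono)
    qed
    also have "\<dots> = L * \<bar>y - x\<bar> * (N y - N x)"
      using J[OF wi(2) xy(1-3)] by (simp add: N_def)
    finally show ?thesis .
  qed
  have E: "norm (E t / of_real (t - s)) \<le> L * \<bar>N t - N s\<bar>" if t: "t \<in> {c..d}" "t \<noteq> s" "dist t s < \<delta>" for t
  proof -
    have "norm (E t) \<le> L * \<bar>t - s\<bar> * \<bar>N t - N s\<bar>"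
    proof (cases "s \<le> t")
      case True
      have "norm (E t) \<le> L * \<bar>t - s\<bar> * (N t - N s)"
        using EI[of s t] t s True \<delta>(1) by (simp add: E_def)
      also have "\<dots> \<le> L * \<bar>t - s\<bar> * \<bar>N t - N s\<bar>"
        by (intro mult_left_mono) (auto simp: L_def)
      finally show ?thesis .
    next
      case False
      have "norm (E t) \<le> L * \<bar>t - s\<bar> * (N s - N t)"
        using EI[of t s] t s False \<delta>(1) by (simp add: E_def abs_minus_commute)
      also have "\<dots> \<le> L * \<bar>t - s\<bar> * \<bar>N t - N s\<bar>"
        by (intro mult_left_mono) (auto simp: L_def)
      finally show ?thesis .
    qed
    then show ?thesis using t(2)
      by (simp add: norm_divide field_simps flip: of_real_diff)
  qed
  have E0: "((\<lambda>t. E t / of_real (t - s)) \<longlongrightarrow> 0) ?at"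
  proof (rule Lim_null_comparison)
    show "\<forall>\<^sub>F t in at s within {c..d}. norm (E t / of_real (t - s)) \<le> L * \<bar>N t - N s\<bar>"
      unfolding eventually_at using E \<delta>(1) by blast
    have "((\<lambda>t. L * \<bar>N t - N s\<bar>) \<longlongrightarrow> L * \<bar>N s - N s\<bar>) ?at"
      by (intro tendsto_intros N)
    then show "((\<lambda>t. L * \<bar>N t - N s\<bar>) \<longlongrightarrow> 0) ?at" by simp
  qed
  have "((\<lambda>t. (f t - f s) / of_real (t - s) * F t - E t / of_real (t - s)) \<longlongrightarrow> f' s * F s - 0) ?at"
    by (intro tendsto_intros Q F E0)
  then have "((\<lambda>t. (H t - H s) / of_real (t - s)) \<longlongrightarrow> f' s * F s - 0) ?at"
    by (rule Lim_transform_within[OF _ zero_less_one]) (auto simp: H diff_divide_distrib left_diff_distrib)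
  then show "((\<lambda>x. f x * F x - integral {c..x} ?fw) has_vector_derivative f' s * F s)
           ?at"
    by (simp add: has_vector_derivative_iff_quotient H_def)
qed

section \<open>Wronskians of Caratheodory solutions\<close>

lemma AE_lebesgue_negligibleE:
  assumes "AE x in lebesgue. P x"
  obtains N :: "'a :: euclidean_space set" where "negligible N" "\<And>x. x \<notin> N \<Longrightarrow> P x"
proof -
  obtain N where "\<And>x. x \<in> space lebesgue - N \<Longrightarrow> P x" "N \<in> null_sets lebesgue"
    by (rule AE_E3[OF assms]) blast
  then show ?thesis using that[of N] by (simp add: negligible_iff_null_sets)
qed

lemma has_ac_derivative_continuous_on:
  assumes "has_ac_derivative f g {0<..b}"
  shows "continuous_on {0<..b} f"
proof (rule continuous_on_eq_continuous_within[THEN iffD2], rule ballI)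
  fix x assume x: "x \<in> {0<..b}"
  define y where "y = x / 2"
  have y: "0 < y" "y < x" "x \<le> b" using x by (auto simp: y_def)
  have f: "f t - f y = integral {y..t} g" if "t \<in> {y..b}" for t
    using assms that y unfolding has_ac_derivative_def
    by (force simp: set_lebesgue_integral_eq_integral)
  have "g absolutely_integrable_on {y..b}"
  proof -
    have "y \<le> b" "{y..b} \<subseteq> {0<..b}" using y by auto
    then show ?thesis using assms unfolding has_ac_derivative_def by blast
  qed
  then have "g integrable_on {y..b}" using set_lebesgue_integral_eq_integral(1) by blast
  then have "continuous_on {y..b} (\<lambda>t. f y + integral {y..t} g)"
    by (intro continuous_intros indefinite_integral_continuous_1)
  moreover have "f t = f y + integral {y..t} g" if "t \<in> {y..b}" for t
    using f[OF that] by (simp add: algebra_simps)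
  ultimately have "continuous_on {y..b} f"
    using continuous_on_cong[of "{y..b}" "{y..b}" f "\<lambda>t. f y + integral {y..t} g"] by blast
  then have "continuous (at x within {y..b}) f"
    using y by (auto simp: continuous_on_eq_continuous_within)
  then show "continuous (at x within {0<..b}) f" by (simp only: at_within_Icc_eq_Ioc[OF y(1,2)])
qed

lemma bessel_solution_continuous:
  assumes "bessel_solution b l q E u u'"
  shows "continuous_on {0<..b} u" "continuous_on {0<..b} u'"
proof -
  show "continuous_on {0<..b} u"
    using assms unfolding bessel_solution_def
    by (intro continuous_on_vector_derivative) blast
  show "continuous_on {0<..b} u'"
    using assms unfolding bessel_solution_def
    by (auto intro: has_ac_derivative_continuous_on)
qed

text \<open>
  The potential cancels almost everywhere in \<open>v u'' - v'' u\<close>, and what remains is continuous; the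
  Wronskian is therefore differentiable in the classical sense.
\<close>
lemma wronskian_derivative:
  assumes v: "bessel_solution b l q 0 v v'" and u: "bessel_solution b l q E u u'"
    and x: "x \<in> {0<..b}"
  shows "((\<lambda>x. v x * u' x - v' x * u x) has_vector_derivative - E * v x * u x) (at x within {0<..b})"
proof -
  define y where "y = x / 2"
  have y: "0 < y" "y < x" "x \<le> b" using x by (auto simp: y_def)
  obtain wv where wv: "has_ac_derivative v' wv {0<..b}"
      "AE x\<in>{0<..b} in lebesgue. - wv x + (of_real (l * (l + 1) / x\<^sup>2) + q x) * v x = 0 * v x"
    using v unfolding bessel_solution_def by blast
  obtain wu where wu: "has_ac_derivative u' wu {0<..b}"
      "AE x\<in>{0<..b} in lebesgue. - wu x + (of_real (l * (l + 1) / x\<^sup>2) + q x) * u x = E * u x"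
    using u unfolding bessel_solution_def by blast
  have ac: "g absolutely_integrable_on {y..b}" "f t - f s = integral {s..t} g"
    if "has_ac_derivative f g {0<..b}" "y \<le> s" "s \<le> t" "t \<le> b" for f g s t
  proof -
    have "{y..b} \<subseteq> {0<..b}" "{s..t} \<subseteq> {0<..b}" "y \<le> b" using that y by auto
    then show "g absolutely_integrable_on {y..b}" "f t - f s = integral {s..t} g"
      using that unfolding has_ac_derivative_def
      by (auto simp: set_lebesgue_integral_eq_integral)
  qed
  have sub: "(f has_vector_derivative D) (at t within {y..b})"
    if "(f has_vector_derivative D) (at t within {0<..b})" for f D t
    using that y by (elim has_vector_derivative_within_subset) auto
  have dv: "(v has_vector_derivative v' t) (at t within {y..b})" if "t \<in> {y..b}" for t
    using v that y unfolding bessel_solution_def by (intro sub) auto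
  have du: "(u has_vector_derivative u' t) (at t within {y..b})" if "t \<in> {y..b}" for t
    using u that y unfolding bessel_solution_def by (intro sub) auto
  have xy: "x \<in> {y..b}" "y \<le> y" "y \<le> b" "b \<le> b" using y by auto
  let ?H = "\<lambda>t. (v t * u' t - integral {y..t} (\<lambda>t. v t * wu t)) - (u t * v' t - integral {y..t} (\<lambda>t. u t * wv t)) + integral {y..t} (\<lambda>t. - E * v t * u t)"
  note H1 = has_vector_derivative_mult_ac[where f = v and f' = v' and F = u' and w = wu,
      OF ac(2)[OF wu(1)] ac(1)[OF wu(1) xy(2-4)] dv xy(1)]
  note H2 = has_vector_derivative_mult_ac[where f = u and f' = u' and F = v' and w = wv,
      OF ac(2)[OF wv(1)] ac(1)[OF wv(1) xy(2-4)] du xy(1)]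
  have cvu: "continuous_on {y..b} (\<lambda>t. - E * v t * u t)"
    by (intro continuous_intros)
       (use bessel_solution_continuous(1)[OF v] bessel_solution_continuous(1)[OF u] y
         in \<open>auto intro: continuous_on_subset\<close>)
  have I: "integral {y..t} (\<lambda>t. v t * wu t) - integral {y..t} (\<lambda>t. u t * wv t) =
      integral {y..t} (\<lambda>t. - E * v t * u t)" if t: "t \<in> {y..b}" for t
  proof -
    have AE: "AE x in lebesgue. x \<in> {0<..b} \<longrightarrow> v x * wu x - u x * wv x = - E * v x * u x"
      using wv(2) wu(2)
    proof eventually_elim
      case (elim x)
      show ?case
      proof
        assume "x \<in> {0<..b}"
        then have wvx: "wv x = (of_real (l * (l + 1) / x\<^sup>2) + q x) * v x"
          and wux: "wu x = (of_real (l * (l + 1) / x\<^sup>2) + q x) * u x - E * u x"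
          using elim by (auto simp: algebra_simps)
        show "v x * wu x - u x * wv x = - E * v x * u x"
          unfolding wvx wux by (simp add: algebra_simps)
      qed
    qed
    obtain N where N: "negligible N"
      "\<And>x. x \<notin> N \<Longrightarrow> x \<in> {0<..b} \<longrightarrow> v x * wu x - u x * wv x = - E * v x * u x"
      using AE_lebesgue_negligibleE[OF AE] by blast
    have "integral {y..t} (\<lambda>t. v t * wu t - u t * wv t) = integral {y..t} (\<lambda>t. - E * v t * u t)"
      by (rule integral_spike[of N]) (use N y t in auto)
    then show ?thesis
      using H1(1) H2(1) t by (simp add: integral_diff integrable_on_subinterval)
  qed
  have "((\<lambda>t. ?H t) has_vector_derivative (v' x * u' x - u' x * v' x + (- E * v x * u x)))
       (at x within {y..b})"
    by (intro has_vector_derivative_add has_vector_derivative_diff H1(2) H2(2)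
        integral_has_vector_derivative cvu xy)
  then have "((\<lambda>t. ?H t) has_vector_derivative (- E * v x * u x))
       (at x within {y..b})" by (simp add: mult.commute)
  then have "((\<lambda>x. v x * u' x - v' x * u x) has_vector_derivative - E * v x * u x) (at x within {y..b})"
  proof (rule has_vector_derivative_transform[rotated 2])
    show "v t * u' t - v' t * u t = ?H t" if "t \<in> {y..b}" for t
      using I[OF that] by (simp add: algebra_simps)
  qed (rule xy)
  then show ?thesis by (simp only: at_within_Icc_eq_Ioc[OF y(1,2)])
qed

text \<open>
  On \<open>(0,b]\<close> the second derivative is dominated by \<open>x\<^bsup>l-1\<^esup> + x\<^bsup>l+1\<^esup> \<bar>q x\<bar>\<close>. As \<open>l \<ge> -1/2\<close>, the first
  term is \<open>O(x\<^bsup>-3/2\<^esup>)\<close>, and \<open>l + 1 \<ge> 1/2 > \<mu>\<close> makes the second one integrable. This bound on \<open>u\<^sub>0'\<close> is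
  what makes the integral \<open>\<eta>\<close> converge.
\<close>
lemma bessel_solution_deriv_bounded:
  assumes b: "b > 0" and l: "l \<ge> -1/2" and \<mu>: "0 \<le> \<mu>" "\<mu> < 1/2"
    and q: "(\<lambda>x. of_real (x powr \<mu>) * q_tilde b l q x) absolutely_integrable_on {0<..b}"
    and v: "bessel_solution b l q 0 v v'"
    and bdd: "powr_bounded b v (l + 1)"
  shows "powr_bounded b v' (-1/2)"
proof -
  obtain w where w: "has_ac_derivative v' w {0<..b}"
      "AE x\<in>{0<..b} in lebesgue. - w x + (of_real (l * (l + 1) / x\<^sup>2) + q x) * v x = 0 * v x"
    using v unfolding bessel_solution_def by blast
  obtain N where N: "negligible N"
      "\<And>x. x \<notin> N \<Longrightarrow> x \<in> {0<..b} \<longrightarrow> - w x + (of_real (l * (l + 1) / x\<^sup>2) + q x) * v x = 0 * v x"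
    using AE_lebesgue_negligibleE[OF w(2)] by blast
  obtain M where M: "M \<ge> 0" "\<And>x. x \<in> {0<..b} \<Longrightarrow> norm (v x) \<le> M * x powr (l + 1)"
    using bdd by (auto elim!: powr_boundedE)
  define G where "G = (\<lambda>x. norm (of_real (x powr \<mu>) * q_tilde b l q x))"
  have G: "G integrable_on {0<..b}" using q unfolding G_def
    by (simp add: absolutely_integrable_on_def)
  define A where "A = \<bar>l * (l + 1)\<bar> * M * b powr (l + 1/2)"
  define B where "B = M * b powr (l + 1 - \<mu>)"
  let ?J = "\<lambda>t. A * t powr (-3/2) + B * G t"
  let ?G = "integral {0<..b} G"
  have wb: "norm (w x) \<le> ?J x" if x: "x \<in> {0<..b}" "x \<notin> N" for x
  proof -
    have x0: "0 < x" "x \<le> b" using x by auto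
    have wx: "w x = (of_real (l * (l + 1) / x\<^sup>2) + q x) * v x"
      using N(2)[OF x(2)] x(1) by (simp add: algebra_simps)
    have "norm (w x) \<le> (\<bar>l * (l + 1)\<bar> / x\<^sup>2 + norm (q x)) * (M * x powr (l + 1))"
      unfolding wx norm_mult
      using norm_triangle_ineq[of "of_real (l * (l + 1) / x\<^sup>2)" "q x"] M x
      by (intro mult_mono) (auto simp: norm_divide norm_mult norm_power abs_mult)
    also have "\<dots> = \<bar>l * (l + 1)\<bar> * M * (x powr (l + 1/2) * x powr (-3/2)) + M * (x powr (l + 1 - \<mu>) * (x powr \<mu> * norm (q x)))"
    proof -
      have "x powr (l + 1) / x powr 2 = x powr (l + 1/2) * x powr (-3/2)"
        by (simp add: powr_diff[symmetric] powr_add[symmetric])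
      then have eq1: "x powr (l + 1) / x\<^sup>2 = x powr (l + 1/2) * x powr (-3/2)"
        using x0 by (simp add: powr_numeral)
      have eq2: "x powr (l + 1) = x powr (l + 1 - \<mu>) * x powr \<mu>" by (simp flip: powr_add)
      have "(\<bar>l * (l + 1)\<bar> / x\<^sup>2 + norm (q x)) * (M * x powr (l + 1)) =
          \<bar>l * (l + 1)\<bar> * M * (x powr (l + 1) / x\<^sup>2) + M * (x powr (l + 1) * norm (q x))"
        by (simp only: ring_distribs) (simp add: ac_simps)
      also have "\<dots> = \<bar>l * (l + 1)\<bar> * M * (x powr (l + 1/2) * x powr (-3/2)) +
          M * (x powr (l + 1 - \<mu>) * (x powr \<mu> * norm (q x)))"
        by (subst eq1, subst eq2) (simp only: mult.assoc)
      finally show ?thesis .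
    qed
    also have "\<dots> \<le> ?J x"
    proof (rule add_mono)
      show "\<bar>l * (l + 1)\<bar> * M * (x powr (l + 1/2) * x powr (-3/2)) \<le> A * x powr (-3/2)"
        unfolding A_def mult.assoc using x0 l M
        by (intro mult_left_mono mult_right_mono powr_mono2) auto
      have "norm (q x) \<le> norm (q_tilde b l q x)"
      proof -
        have "ln (x / b) \<le> 0" using x0 b by (simp add: ln_div)
        then have "1 \<le> norm (complex_of_real (1 - ln (x / b)))"
          by (simp only: norm_of_real)
        then have "1 * norm (q x) \<le> norm (complex_of_real (1 - ln (x / b))) * norm (q x)"
          by (rule mult_right_mono) simp
        moreover have "q_tilde b l q x = (if l > -1/2 then q x else of_real (1 - ln (x / b)) * q x)"
          by (rule q_tilde_def)
        ultimately show ?thesis by (simp only: norm_mult mult_1 split: if_split) blast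
      qed
      then have "x powr \<mu> * norm (q x) \<le> G x"
        by (simp add: G_def norm_mult mult_left_mono)
      then show "M * (x powr (l + 1 - \<mu>) * (x powr \<mu> * norm (q x))) \<le> B * G x"
        unfolding B_def mult.assoc using x0 l M \<mu>
        by (intro mult_left_mono mult_mono powr_mono2) auto
    qed
    finally show ?thesis .
  qed
  show ?thesis
  proof (rule powr_boundedI)
    fix x assume x: "0 < x" "x \<le> b"
    have sub: "{x..b} \<subseteq> {0<..b}" using x by auto
    have wi: "w absolutely_integrable_on {x..b}" "v' b - v' x = integral {x..b} w"
      using w(1) x sub unfolding has_ac_derivative_def
      by (auto simp: set_lebesgue_integral_eq_integral)
    have P: "((\<lambda>t. t powr (-3/2)) has_integral ((-2) * b powr (-1/2) - (-2) * x powr (-1/2))) {x..b}"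
    proof (rule fundamental_theorem_of_calculus[OF x(2)])
      fix t assume "t \<in> {x..b}"
      then have "((\<lambda>t. (-2) * t powr (-1/2)) has_real_derivative t powr (-3/2)) (at t)"
        using x by (auto intro!: derivative_eq_intros)
      then show "((\<lambda>t. (-2) * t powr (-1/2)) has_vector_derivative t powr (-3/2)) (at t within {x..b})"
        by (simp add: has_real_derivative_iff_has_vector_derivative has_vector_derivative_at_within)
    qed
    have G': "G integrable_on {x..b}"
      by (rule integrable_on_subinterval[OF G sub])
    have PG: "(\<lambda>t. ?J t) integrable_on {x..b}"
      using P G' by (intro integrable_add integrable_on_mult_right) auto
    have "norm (integral {x..b} (\<lambda>t. if t \<in> N then 0 else w t)) \<le> integral {x..b} (\<lambda>t. ?J t)"
    proof (rule integral_norm_bound_integral[OF _ PG])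
      show "(\<lambda>t. if t \<in> N then 0 else w t) integrable_on {x..b}"
        by (rule integrable_spike[of w _ N])
           (use wi set_lebesgue_integral_eq_integral(1) N in auto)
      fix t assume "t \<in> {x..b}"
      moreover have "0 \<le> ?J t" by (auto simp: A_def B_def G_def M)
      ultimately show "norm (if t \<in> N then 0 else w t) \<le> ?J t"
        using wb[of t] sub by auto
    qed
    also have "integral {x..b} (\<lambda>t. if t \<in> N then 0 else w t) = integral {x..b} w"
      by (rule integral_spike[of N]) (use N in auto)
    also have "integral {x..b} (\<lambda>t. ?J t) =
        A * (2 * x powr (-1/2) - 2 * b powr (-1/2)) + B * integral {x..b} G"
      using P G' by (subst integral_add) (auto intro: integrable_on_mult_right simp: integral_unique)
    also have "\<dots> \<le> A * (2 * x powr (-1/2)) + B * ?G"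
    proof (intro add_mono mult_left_mono)
      show "integral {x..b} G \<le> ?G"
        by (intro integral_subset_le sub G' G) (auto simp: G_def)
    qed (auto simp: A_def B_def M)
    finally have I: "norm (integral {x..b} w) \<le> A * (2 * x powr (-1/2)) + B * ?G" .
    have "v' x = v' b - integral {x..b} w" using wi(2) by (simp add: algebra_simps)
    then have "norm (v' x) \<le> norm (v' b) + norm (integral {x..b} w)"
      by (simp add: norm_triangle_ineq4)
    also have "\<dots> \<le> 2 * A * x powr (-1/2) + (norm (v' b) + B * ?G) * 1"
      using I by simp
    also have "\<dots> \<le> 2 * A * x powr (-1/2) + (norm (v' b) + B * ?G) * (b powr (1/2) * x powr (-1/2))"
    proof (rule add_mono[OF order_refl mult_left_mono])
      have "x powr (1/2) * x powr (-1/2) \<le> b powr (1/2) * x powr (-1/2)"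
        using x by (intro mult_right_mono powr_mono2) auto
      then show "1 \<le> b powr (1/2) * x powr (-1/2)" using x by (simp flip: powr_add)
      have "0 \<le> ?G" by (rule integral_nonneg[OF G]) (simp add: G_def)
      then show "0 \<le> norm (v' b) + B * ?G" by (simp add: B_def M)
    qed
    finally show "norm (v' x) \<le> (2 * A + (norm (v' b) + B * ?G) * b powr (1/2)) * x powr (-1/2)"
      by (simp only: ring_distribs mult.assoc)
  qed
qed

section \<open>Power series of the regular solution in the spectral parameter\<close>

locale zero_energy_solution =
  fixes b l :: real and v v' :: "real \<Rightarrow> complex"
  assumes b: "b > 0" and l: "l \<ge> -1/2"
    and v_deriv: "\<And>x. x \<in> {0<..b} \<Longrightarrow> (v has_vector_derivative v' x) (at x within {0<..b})"
    and v'_cont: "continuous_on {0<..b} v'"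
    and v_asymp: "((\<lambda>x. v x / of_real (x powr (l + 1))) \<longlongrightarrow> 1) (at_right 0)"
    and v_nonzero: "\<And>x. x \<in> {0<..b} \<Longrightarrow> v x \<noteq> 0"
begin

lemma v_cont: "continuous_on {0<..b} v"
  using v_deriv by (rule continuous_on_vector_derivative)

lemma powr_cont: "continuous_on {0<..b} (\<lambda>x. complex_of_real (x powr a))"
  by (intro continuous_intros) auto

text \<open>
  The quotient \<open>v / x\<^bsup>l+1\<^esup>\<close> extends to a continuous function without zeros on the compact interval
  \<open>[0,b]\<close>.
\<close>
lemma v_two_sided_bound:
  obtains c C where "0 < c" "0 < C"
    "\<And>x. x \<in> {0<..b} \<Longrightarrow> c * x powr (l + 1) \<le> norm (v x)"
    "\<And>x. x \<in> {0<..b} \<Longrightarrow> norm (v x) \<le> C * x powr (l + 1)"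
proof -
  define h where "h = (\<lambda>x. if x = 0 then 1 else v x / of_real (x powr (l + 1)))"
  have "continuous_on {0<..b} (\<lambda>x. v x / of_real (x powr (l + 1)))"
    by (intro continuous_intros v_cont) auto
  then have ch: "continuous_on {0..b} (\<lambda>x. norm (h x))"
    unfolding h_def by (intro continuous_on_norm continuous_on_extend_zero v_asymp b)
  have pos: "norm (h x) > 0" if "x \<in> {0..b}" for x
    using v_nonzero[of x] that by (auto simp: h_def)
  have "{0..b} \<noteq> {}" using b by auto
  then obtain y z where yz: "y \<in> {0..b}" "z \<in> {0..b}"
    "\<And>x. x \<in> {0..b} \<Longrightarrow> norm (h y) \<le> norm (h x)" "\<And>x. x \<in> {0..b} \<Longrightarrow> norm (h x) \<le> norm (h z)"
    using continuous_attains_inf[OF compact_Icc _ ch] continuous_attains_sup[OF compact_Icc _ ch] by metis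
  show ?thesis
  proof (rule that[of "norm (h y)" "norm (h z)"])
    fix x assume x: "x \<in> {0<..b}"
    then have "norm (h x) * x powr (l + 1) = norm (v x)" by (simp add: h_def norm_divide)
    moreover have "norm (h y) * x powr (l + 1) \<le> norm (h x) * x powr (l + 1)"
      "norm (h x) * x powr (l + 1) \<le> norm (h z) * x powr (l + 1)"
      using x yz by (auto intro!: mult_right_mono)
    ultimately show "norm (h y) * x powr (l + 1) \<le> norm (v x)" "norm (v x) \<le> norm (h z) * x powr (l + 1)"
      by auto
  qed (use pos yz in auto)
qed

lemma v_bounded: "powr_bounded b v (l + 1)"
  using v_two_sided_bound by (metis powr_bounded_def)

lemma norm_inverse_v2_le:
  assumes "0 < c" "c * x powr (l + 1) \<le> norm (v x)" and x: "x \<in> {0<..b}"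
  shows "norm (1 / (v x)\<^sup>2) \<le> 1 / c\<^sup>2 * x powr (- 2 * l - 2)"
proof -
  have "norm (1 / (v x)\<^sup>2) = 1 / (norm (v x))\<^sup>2" by (simp add: norm_divide norm_power)
  also have "\<dots> \<le> 1 / (c * x powr (l + 1))\<^sup>2"
    using assms v_nonzero[of x] by (intro divide_left_mono power_mono mult_pos_pos) auto
  also have "(x powr (l + 1))\<^sup>2 = x powr (2 * l + 2)"
    by (simp add: power2_eq_square flip: powr_add)
  then have "1 / (c * x powr (l + 1))\<^sup>2 = (1 / c\<^sup>2) * x powr (- 2 * l - 2)"
    by (simp add: power_mult_distrib) (simp add: divide_simps flip: powr_add)
  finally show ?thesis .
qed

lemma inverse_v2_bounded: "powr_bounded b (\<lambda>x. 1 / (v x)\<^sup>2) (- 2 * l - 2)"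
proof -
  obtain c where "0 < c" "\<And>x. x \<in> {0<..b} \<Longrightarrow> c * x powr (l + 1) \<le> norm (v x)"
    using v_two_sided_bound by metis
  then show ?thesis unfolding powr_bounded_def using norm_inverse_v2_le by blast
qed

lemma v2_bounded: "powr_bounded b (\<lambda>x. (v x)\<^sup>2) (2 * l + 2)"
  using powr_bounded_mult[OF v_bounded v_bounded] by (simp add: power2_eq_square)

text \<open>
  The coefficients of \<open>\<omega>\<^sup>2\<^sup>k\<close> in \<open>u(\<omega>,x) / v(x)\<close> and in the Wronskian \<open>v u' - v' u\<close>, for the
  normalisation \<open>u \<sim> v\<close> at \<open>0\<close>. Thus \<open>r\<^sub>k' = W\<^sub>k / v\<^sup>2\<close> and \<open>W\<^sub>k\<^sub>+\<^sub>1' = - v\<^sup>2 r\<^sub>k\<close>.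
\<close>
primrec r :: "nat \<Rightarrow> real \<Rightarrow> complex" where
  "r 0 = (\<lambda>x. 1)"
| "r (Suc k) = prim (\<lambda>t. - prim (\<lambda>s. (v s)\<^sup>2 * r k s) t / (v t)\<^sup>2)"

definition W :: "nat \<Rightarrow> real \<Rightarrow> complex" where
  "W k = (case k of 0 \<Rightarrow> (\<lambda>x. 0) | Suc j \<Rightarrow> (\<lambda>x. - prim (\<lambda>s. (v s)\<^sup>2 * r j s) x))"

lemma r_Suc: "r (Suc k) = prim (\<lambda>t. W (Suc k) t / (v t)\<^sup>2)"
  by (simp add: W_def)

context
  fixes k :: nat
  assumes r: "continuous_on {0<..b} (r k)" "powr_bounded b (r k) (2 * real k)"
begin

lemma W_integrand:
  "continuous_on {0<..b} (\<lambda>s. (v s)\<^sup>2 * r k s)"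
  "powr_bounded b (\<lambda>s. (v s)\<^sup>2 * r k s) (2 * l + 2 + 2 * real k)"
  by (intro continuous_intros v_cont r powr_bounded_mult v2_bounded)+

lemma W_Suc_deriv:
  "x \<in> {0<..b} \<Longrightarrow> (W (Suc k) has_vector_derivative - (v x)\<^sup>2 * r k x) (at x within {0<..b})"
  using has_vector_derivative_minus[OF has_vector_derivative_prim[OF W_integrand]] l
  by (simp add: W_def)

lemma W_Suc_cont: "continuous_on {0<..b} (W (Suc k))"
  using W_Suc_deriv by (rule continuous_on_vector_derivative)

lemma W_Suc_bounded: "powr_bounded b (W (Suc k)) (2 * l + 3 + 2 * real k)"
  using powr_bounded_uminus[OF powr_bounded_prim[OF W_integrand]] l
  by (simp add: W_def algebra_simps)

lemma r_Suc_integrand: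
  "continuous_on {0<..b} (\<lambda>t. W (Suc k) t / (v t)\<^sup>2)"
  "powr_bounded b (\<lambda>t. W (Suc k) t / (v t)\<^sup>2) (2 * real k + 1)"
proof -
  show "continuous_on {0<..b} (\<lambda>t. W (Suc k) t / (v t)\<^sup>2)"
    using v_nonzero by (intro continuous_intros v_cont W_Suc_cont) auto
  show "powr_bounded b (\<lambda>t. W (Suc k) t / (v t)\<^sup>2) (2 * real k + 1)"
    using powr_bounded_mult[OF W_Suc_bounded inverse_v2_bounded] by (simp add: add.commute)
qed

lemma r_Suc_deriv:
  "x \<in> {0<..b} \<Longrightarrow> (r (Suc k) has_vector_derivative W (Suc k) x / (v x)\<^sup>2) (at x within {0<..b})"
  unfolding r_Suc using has_vector_derivative_prim[OF r_Suc_integrand] by simp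

lemma r_Suc_props: "continuous_on {0<..b} (r (Suc k))" "powr_bounded b (r (Suc k)) (2 * real (Suc k))"
proof -
  show "continuous_on {0<..b} (r (Suc k))"
    using r_Suc_deriv by (rule continuous_on_vector_derivative)
  show "powr_bounded b (r (Suc k)) (2 * real (Suc k))"
    unfolding r_Suc using powr_bounded_prim[OF r_Suc_integrand] by (simp add: algebra_simps)
qed

end

lemma r_props: "continuous_on {0<..b} (r k) \<and> powr_bounded b (r k) (2 * real k)"
proof (induction k)
  case 0
  then show ?case using powr_bounded_const[of b 1] by simp
next
  case (Suc k)
  then show ?case using r_Suc_props by blast
qed

lemmas r_cont = r_props[THEN conjunct1] and r_bounded = r_props[THEN conjunct2]

lemma W_0 [simp]: "W 0 x = 0"
  by (simp add: W_def)

lemma W_bounded: "powr_bounded b (W k) (2 * l + 1 + 2 * real k)"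
proof (cases k)
  case 0
  then show ?thesis by (auto intro: powr_boundedI[where M = 0])
next
  case (Suc j)
  then show ?thesis using W_Suc_bounded[OF r_cont r_bounded, of j] by (simp add: algebra_simps)
qed

lemma r_deriv:
  assumes "x \<in> {0<..b}"
  shows "(r k has_vector_derivative W k x / (v x)\<^sup>2) (at x within {0<..b})"
proof (cases k)
  case (Suc j)
  then show ?thesis using r_Suc_deriv[OF r_cont r_bounded assms, of j] by (simp only: Suc)
qed simp

lemma W_deriv:
  assumes "x \<in> {0<..b}"
  shows "(W k has_vector_derivative (if k = 0 then 0 else - (v x)\<^sup>2 * r (k - 1) x)) (at x within {0<..b})"
proof (cases k)
  case (Suc j)
  then show ?thesis using W_Suc_deriv[OF r_cont r_bounded assms, of j] by simp
qed (simp add: W_def)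

lemma r_Suc_tendsto_0: "(r (Suc k) \<longlongrightarrow> 0) (at_right 0)"
  using powr_bounded_tendsto_0[OF r_bounded[of "Suc k"] _ b] by simp

lemma W_tendsto_0: "(W k \<longlongrightarrow> 0) (at_right 0)"
proof (cases k)
  case (Suc j)
  then show ?thesis using powr_bounded_tendsto_0[OF W_bounded[of k] _ b] l by simp
qed (simp add: W_def)

context
  fixes \<omega> :: real and g w :: "real \<Rightarrow> complex"
  assumes g_deriv: "\<And>x. x \<in> {0<..b} \<Longrightarrow> (g has_vector_derivative w x / (v x)\<^sup>2) (at x within {0<..b})"
    and w_deriv: "\<And>x. x \<in> {0<..b} \<Longrightarrow>
      (w has_vector_derivative - of_real (\<omega>\<^sup>2) * (v x)\<^sup>2 * g x) (at x within {0<..b})"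
    and g_lim: "(g \<longlongrightarrow> 1) (at_right 0)"
begin

lemma g_bounded: "powr_bounded b g 0"
proof -
  have cg: "continuous_on {0<..b} g" using g_deriv by (rule continuous_on_vector_derivative)
  define h where "h = (\<lambda>x. if x = 0 then 1 else g x)"
  have "bounded (h ` {0..b})" unfolding h_def
    by (intro compact_imp_bounded compact_continuous_image continuous_on_extend_zero cg g_lim b) auto
  then obtain M where M: "\<forall>y\<in>h ` {0..b}. norm y \<le> M"
    unfolding bounded_iff by blast
  show ?thesis
  proof (rule powr_boundedI)
    fix x assume "0 < x" "x \<le> b"
    then show "norm (g x) \<le> M * x powr 0" using M by (auto simp: h_def)
  qed
qed

text \<open>
  The derivative of \<open>w\<close> is integrable, so \<open>w\<close> has a limit \<open>c\<close> at \<open>0\<close>. If \<open>c \<noteq> 0\<close>, then \<open>g' = w / v\<^sup>2\<close>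
  behaves like \<open>c x\<^bsup>-2l-2\<^esup>\<close>; since \<open>2l + 2 \<ge> 1\<close>, \<open>g\<close> would be unbounded, at least like \<open>\<bar>ln x\<bar>\<close>.
\<close>
lemma w_tendsto_0: "(w \<longlongrightarrow> 0) (at_right 0)"
proof -
  let ?p = "\<lambda>x. - of_real (\<omega>\<^sup>2) * (v x)\<^sup>2 * g x"
  have cg: "continuous_on {0<..b} g" using g_deriv by (rule continuous_on_vector_derivative)
  have P: "continuous_on {0<..b} ?p" by (intro continuous_intros v_cont cg)
  have B: "powr_bounded b ?p (2 * l + 2)"
    using powr_bounded_cmult[OF powr_bounded_mult[OF v2_bounded g_bounded], of "- of_real (\<omega>\<^sup>2)"]
    by (simp add: mult.assoc)
  have l2: "0 \<le> 2 * l + 2" using l by simp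
  have "((\<lambda>x. w x - prim ?p x) has_vector_derivative 0) (at x within {0<..b})" if "x \<in> {0<..b}" for x
    using has_vector_derivative_diff[OF w_deriv[OF that] has_vector_derivative_prim[OF P B l2 that]] by simp
  then obtain c where c: "\<And>x. x \<in> {0<..b} \<Longrightarrow> w x - prim ?p x = c"
    using has_vector_derivative_zero_constant[of "{0<..b}" "\<lambda>x. w x - prim ?p x"] by auto
  have wc: "(w \<longlongrightarrow> c) (at_right 0)"
  proof (rule Lim_transform_eventually)
    show "((\<lambda>x. c + prim ?p x) \<longlongrightarrow> c) (at_right 0)"
      using tendsto_add[OF tendsto_const prim_tendsto_0[OF P B l2 b], of c] by simp
    show "\<forall>\<^sub>F x in at_right 0. c + prim ?p x = w x"
      using eventually_at_right_real[OF b] by eventually_elim (use c in \<open>force simp: algebra_simps\<close>)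
  qed
  have "c = 0"
  proof (rule ccontr)
    assume "c \<noteq> 0"
    define m where "m = (norm c)\<^sup>2 / 2"
    have m: "m > 0" using \<open>c \<noteq> 0\<close> by (simp add: m_def)
    let ?s = "\<lambda>x. w x / (v x / of_real (x powr (l + 1)))\<^sup>2"
  let ?g = "\<lambda>x. Re (cnj c * (w x / (v x)\<^sup>2))"
  let ?h = "\<lambda>x. Re (cnj c * ?s x)"
  let ?k = "\<lambda>x. Re (cnj c * g x)"
    have "((\<lambda>x. ?h x) \<longlongrightarrow> Re (cnj c * (c / 1\<^sup>2))) (at_right 0)"
      by (intro tendsto_intros wc v_asymp) auto
    moreover have "Re (cnj c * (c / 1\<^sup>2)) = 2 * m"
      by (simp add: m_def cmod_power2) (simp add: power2_eq_square)
    ultimately have "((\<lambda>x. ?h x) \<longlongrightarrow> 2 * m) (at_right 0)" by simp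
    then have "\<forall>\<^sub>F x in at_right 0. m < ?h x"
      using m by (intro order_tendstoD(1)) auto
    then obtain \<delta> where \<delta>: "\<delta> > 0" "\<And>x. 0 < x \<Longrightarrow> x < \<delta> \<Longrightarrow> m < ?h x"
      unfolding eventually_at_right_field by auto
    define z where "z = min (\<delta> / 2) (min (b / 2) 1)"
    have z: "0 < z" "z < \<delta>" "z < b" "z \<le> 1" using \<delta> b by (auto simp: z_def)
    define h where "h = (\<lambda>x. ?k x - m * ln x)"
    have hd: "\<exists>D. (h has_real_derivative D) (at x) \<and> D \<ge> 0" if x: "0 < x" "x \<le> z" for x
    proof -
      have xb: "x \<in> {0<..b}" using x z by auto
      have "at x within {0<..b} = at x"
        by (rule at_within_nhd[of x "{0<..<b}"]) (use x z in auto)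
      then have "(g has_vector_derivative w x / (v x)\<^sup>2) (at x)"
        using g_deriv[OF xb] by simp
      then have "((\<lambda>x. ?k x) has_vector_derivative ?g x) (at x)"
        by (rule bounded_linear.has_vector_derivative[rotated])
           (intro bounded_linear_compose[OF bounded_linear_Re bounded_linear_mult_right])
      then have "((\<lambda>x. ?k x) has_real_derivative ?g x) (at x)"
        by (simp add: has_real_derivative_iff_has_vector_derivative)
      then have "(h has_real_derivative (?g x - m * (1 / x))) (at x)"
        unfolding h_def by (intro DERIV_diff DERIV_cmult DERIV_ln_divide x(1))
      moreover have "m * (1 / x) \<le> ?g x"
      proof -
        have p: "x powr (- 2 * l - 2) = 1 / (x powr (l + 1))\<^sup>2"
          using x by (simp add: power2_eq_square divide_simps flip: powr_add)
        have "w x / (v x)\<^sup>2 = of_real (x powr (- 2 * l - 2)) * ?s x"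
          unfolding p using x v_nonzero[OF xb] by (simp add: field_simps power_divide)
        then have e: "?g x = x powr (- 2 * l - 2) * ?h x"
          by (simp only: scaleR_conv_of_real[symmetric] mult_scaleR_right scaleR_complex.simps)
        have "x * x powr (- 2 * l - 2) = x powr (1 + (- 2 * l - 2))"
          using powr_mult_base[of x "- 2 * l - 2"] x by simp
        also have "x powr (1 + (- 2 * l - 2)) = x powr (- 2 * l - 1)" by (rule arg_cong) simp
        also have "\<dots> \<ge> x powr 0"
          using l x z by (intro powr_mono') auto
        finally have "1 \<le> x * x powr (- 2 * l - 2)" using x by simp
        then have "1 / x \<le> x powr (- 2 * l - 2)" using x by (simp add: field_simps)
        then have "m * (1 / x) \<le> ?h x * x powr (- 2 * l - 2)"
          using \<delta>(2)[of x] x z m by (intro mult_mono) auto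
        then show ?thesis unfolding e by (simp add: mult.commute)
      qed
      ultimately show ?thesis by auto
    qed
    obtain M where M: "M \<ge> 0" "\<And>x. x \<in> {0<..b} \<Longrightarrow> norm (g x) \<le> M * x powr 0"
      using g_bounded by (auto elim!: powr_boundedE)
    have gb: "\<bar>?k x\<bar> \<le> norm c * M" if "0 < x" "x \<le> z" for x
    proof -
      have "\<bar>?k x\<bar> \<le> norm c * norm (g x)"
        using abs_Re_le_cmod[of "cnj c * g x"] by (simp add: norm_mult)
      also have "\<dots> \<le> norm c * M" using M(2)[of x] that z by (intro mult_left_mono) auto
      finally show ?thesis .
    qed
    \<comment> \<open>Chosen so that \<open>m (ln z - ln y)\<close> exceeds the largest possible variation of \<open>Re (cnj c * g)\<close>.\<close>
    define y where "y = z * exp (- (2 * norm c * M + 1) / m)"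
    have "0 \<le> norm c * M" using M(1) by simp
    then have "- (2 * norm c * M + 1) / m \<le> 0" by (intro divide_nonpos_pos m) simp
    then have y: "0 < y" "y \<le> z" using z by (auto simp: y_def mult_le_cancel_left1)
    have "h y \<le> h z"
      by (rule DERIV_nonneg_imp_nondecreasing[OF y(2)]) (use hd y in auto)
    then have "m * (ln z - ln y) \<le> 2 * norm c * M"
      using gb[of y] gb[of z] y z by (simp add: h_def algebra_simps)
    moreover have "m * (ln z - ln y) = 2 * norm c * M + 1"
      using z m by (simp add: y_def ln_mult)
    ultimately show False by simp
  qed
  then show ?thesis using wc by simp
qed

definition g_rest :: "nat \<Rightarrow> real \<Rightarrow> complex" where
  "g_rest n x = g x - (\<Sum>k<n. of_real (\<omega> ^ (2 * k)) * r k x)"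

definition w_rest :: "nat \<Rightarrow> real \<Rightarrow> complex" where
  "w_rest n x = w x - (\<Sum>k<n. of_real (\<omega> ^ (2 * k)) * W k x)"

text \<open>
  Subtracting one more term of the series turns the remainder \<open>\<rho>\<close> of \<open>g\<close> into \<open>-\<omega>\<^sup>2\<close> times the
  double integral \<open>\<integral> v\<^sup>-\<^sup>2 \<integral> v\<^sup>2 \<rho>\<close>. This gains a factor \<open>\<omega>\<^sup>2 (C/c)\<^sup>2 x\<^sup>2\<close>.
\<close>
lemma remainder_bounds:
  assumes c: "0 < c" "\<And>x. x \<in> {0<..b} \<Longrightarrow> c * x powr (l + 1) \<le> norm (v x)"
    and C: "\<And>x. x \<in> {0<..b} \<Longrightarrow> norm (v x) \<le> C * x powr (l + 1)"
    and M: "\<And>x. x \<in> {0<..b} \<Longrightarrow> norm (g x) \<le> M"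
  shows "x \<in> {0<..b} \<Longrightarrow> norm (g_rest n x) \<le>
      M * (\<omega>\<^sup>2 * (C / c)\<^sup>2) ^ n * x powr (2 * real n)"
    and "x \<in> {0<..b} \<Longrightarrow> norm (w_rest (Suc n) x) \<le>
      \<omega>\<^sup>2 * C\<^sup>2 * M * (\<omega>\<^sup>2 * (C / c)\<^sup>2) ^ n * x powr (2 * l + 3 + 2 * real n)"
proof -
  define K where "K = \<omega>\<^sup>2 * (C / c)\<^sup>2"
  have M0: "0 \<le> M" using M[of b] b norm_ge_zero[of "g b"] by (smt (verit) greaterThanAtMost_iff)
  have v2: "norm ((v x)\<^sup>2) \<le> C\<^sup>2 * x powr (2 * l + 2)" if "x \<in> {0<..b}" for x
  proof -
    have "(norm (v x))\<^sup>2 \<le> (C * x powr (l + 1))\<^sup>2" using C[OF that] by (intro power_mono) auto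
    also have "\<dots> = C\<^sup>2 * x powr (2 * l + 2)" by (simp add: power2_eq_square flip: powr_add)
    finally show ?thesis by (simp add: norm_power)
  qed
  have \<sigma>: "norm (w_rest (Suc n) x) \<le> \<omega>\<^sup>2 * C\<^sup>2 * M * K ^ n * x powr (2 * l + 3 + 2 * real n)"
    if \<rho>: "\<And>x. x \<in> {0<..b} \<Longrightarrow> norm (g_rest n x) \<le> M * K ^ n * x powr (2 * real n)" and x: "x \<in> {0<..b}" for n x
  proof -
    have "norm (w_rest (Suc n) x) \<le> (\<omega>\<^sup>2 * C\<^sup>2 * M * K ^ n) * x powr ((2 * l + 2 + 2 * real n) + 1)"
    proof (rule norm_le_powr_of_derivative[where f = "\<lambda>x. - of_real (\<omega>\<^sup>2) * (v x)\<^sup>2 * g_rest n x" and b = b])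
      fix x assume x: "x \<in> {0<..b}"
      have "(w_rest (Suc n) has_vector_derivative - of_real (\<omega>\<^sup>2) * (v x)\<^sup>2 * g x -
          (\<Sum>k<Suc n. of_real (\<omega> ^ (2 * k)) * (if k = 0 then 0 else - (v x)\<^sup>2 * r (k - 1) x))) (at x within {0<..b})"
        unfolding w_rest_def[abs_def]
        by (intro has_vector_derivative_diff w_deriv x has_vector_derivative_sum has_vector_derivative_mult_right W_deriv)
      also have "- of_real (\<omega>\<^sup>2) * (v x)\<^sup>2 * g x -
          (\<Sum>k<Suc n. of_real (\<omega> ^ (2 * k)) * (if k = 0 then 0 else - (v x)\<^sup>2 * r (k - 1) x)) =
          - of_real (\<omega>\<^sup>2) * (v x)\<^sup>2 * g_rest n x"
        unfolding sum.lessThan_Suc_shift g_rest_def[abs_def]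
        by (simp add: algebra_simps sum_distrib_left power_add power2_eq_square sum_negf)
      finally show "(w_rest (Suc n) has_vector_derivative - of_real (\<omega>\<^sup>2) * (v x)\<^sup>2 * g_rest n x) (at x within {0<..b})" .
      have "norm ((v x)\<^sup>2) * norm (g_rest n x) \<le> (C\<^sup>2 * x powr (2 * l + 2)) * (M * K ^ n * x powr (2 * real n))"
        using v2[OF x] \<rho>[OF x] by (intro mult_mono) auto
      then have "\<omega>\<^sup>2 * (norm ((v x)\<^sup>2) * norm (g_rest n x)) \<le> \<omega>\<^sup>2 * ((C\<^sup>2 * x powr (2 * l + 2)) * (M * K ^ n * x powr (2 * real n)))"
        by (intro mult_left_mono) auto
      then show "norm (- of_real (\<omega>\<^sup>2) * (v x)\<^sup>2 * g_rest n x) \<le> \<omega>\<^sup>2 * C\<^sup>2 * M * K ^ n * x powr (2 * l + 2 + 2 * real n)"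
        by (simp add: norm_mult norm_power powr_add mult_ac)
    next
      have "((\<lambda>x. w x - (\<Sum>k<Suc n. of_real (\<omega> ^ (2 * k)) * W k x)) \<longlongrightarrow>
          0 - (\<Sum>k<Suc n. of_real (\<omega> ^ (2 * k)) * 0)) (at_right 0)"
        by (intro tendsto_intros w_tendsto_0 W_tendsto_0)
      then show "(w_rest (Suc n) \<longlongrightarrow> 0) (at_right 0)" by (simp add: w_rest_def[abs_def])
    qed (use l x in auto)
    then show ?thesis by (simp add: algebra_simps)
  qed
  have \<rho>: "norm (g_rest n x) \<le> M * K ^ n * x powr (2 * real n)" if "x \<in> {0<..b}" for n x
    using that
  proof (induction n arbitrary: x)
    case 0
    then show ?case using M by (simp add: g_rest_def[abs_def])
  next
    case (Suc n)
    have "norm (g_rest (Suc n) x) \<le> (M * K ^ Suc n) * x powr ((2 * real n + 1) + 1)"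
    proof (rule norm_le_powr_of_derivative[where f = "\<lambda>x. w_rest (Suc n) x / (v x)\<^sup>2" and b = b])
      fix x assume x: "x \<in> {0<..b}"
      have "(g_rest (Suc n) has_vector_derivative w x / (v x)\<^sup>2 - (\<Sum>k<Suc n. of_real (\<omega> ^ (2 * k)) * (W k x / (v x)\<^sup>2))) (at x within {0<..b})"
        unfolding g_rest_def[abs_def]
        by (intro has_vector_derivative_diff g_deriv x has_vector_derivative_sum has_vector_derivative_mult_right r_deriv)
      also have "w x / (v x)\<^sup>2 - (\<Sum>k<Suc n. of_real (\<omega> ^ (2 * k)) * (W k x / (v x)\<^sup>2)) = w_rest (Suc n) x / (v x)\<^sup>2"
        by (simp only: w_rest_def[abs_def] diff_divide_distrib sum_divide_distrib times_divide_eq_right)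
      finally show "(g_rest (Suc n) has_vector_derivative w_rest (Suc n) x / (v x)\<^sup>2) (at x within {0<..b})" .
      have "norm (w_rest (Suc n) x) * norm (1 / (v x)\<^sup>2) \<le>
          (\<omega>\<^sup>2 * C\<^sup>2 * M * K ^ n * x powr (2 * l + 3 + 2 * real n)) * (1 / c\<^sup>2 * x powr (- 2 * l - 2))"
        using \<sigma>[OF Suc.IH x] norm_inverse_v2_le[OF c(1) c(2)[OF x] x] by (intro mult_mono) (auto simp: M0 K_def)
      also have "\<dots> = M * (\<omega>\<^sup>2 * (C\<^sup>2 * (1 / c\<^sup>2)) * K ^ n) *
          (x powr (2 * l + 3 + 2 * real n) * x powr (- 2 * l - 2))"
        by (simp only: mult_ac)
      also have "\<omega>\<^sup>2 * (C\<^sup>2 * (1 / c\<^sup>2)) * K ^ n = K ^ Suc n"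
        by (simp add: K_def power_divide)
      also have "x powr (2 * l + 3 + 2 * real n) * x powr (- 2 * l - 2) = x powr (2 * real n + 1)"
        by (simp add: add.commute flip: powr_add)
      finally show "norm (w_rest (Suc n) x / (v x)\<^sup>2) \<le> M * K ^ Suc n * x powr (2 * real n + 1)"
        by (simp add: norm_divide)
    next
      have "((\<lambda>x. g x - (r 0 x + (\<Sum>k<n. of_real (\<omega> ^ (2 * Suc k)) * r (Suc k) x))) \<longlongrightarrow>
          1 - (1 + (\<Sum>k<n. of_real (\<omega> ^ (2 * Suc k)) * 0))) (at_right 0)"
        by (intro tendsto_intros g_lim r_Suc_tendsto_0) simp
      then show "(g_rest (Suc n) \<longlongrightarrow> 0) (at_right 0)"
        by (simp add: g_rest_def[abs_def] sum.lessThan_Suc_shift del: sum.lessThan_Suc r.simps(2))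
    qed (use Suc.prems in auto)
    then show ?case by (simp add: algebra_simps)
  qed
  show "norm (g_rest n x) \<le>
      M * (\<omega>\<^sup>2 * (C / c)\<^sup>2) ^ n * x powr (2 * real n)" if "x \<in> {0<..b}"
    using \<rho>[OF that, of n] by (simp add: K_def)
  show "norm (w_rest (Suc n) x) \<le>
      \<omega>\<^sup>2 * C\<^sup>2 * M * (\<omega>\<^sup>2 * (C / c)\<^sup>2) ^ n * x powr (2 * l + 3 + 2 * real n)" if "x \<in> {0<..b}"
    using \<sigma>[OF \<rho> that, of n] unfolding K_def .
qed

text \<open>
  The remainders decay geometrically as soon as \<open>\<omega> C b / c < 1\<close>.
\<close>
lemma spectral_series_sums:
  assumes c: "0 < c" "\<And>x. x \<in> {0<..b} \<Longrightarrow> c * x powr (l + 1) \<le> norm (v x)"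
    and C: "\<And>x. x \<in> {0<..b} \<Longrightarrow> norm (v x) \<le> C * x powr (l + 1)"
    and \<omega>: "\<omega>\<^sup>2 * (C / c)\<^sup>2 * b\<^sup>2 < 1" and x: "x \<in> {0<..b}"
  shows "(\<lambda>k. of_real (\<omega> ^ (2 * k)) * r k x) sums g x"
    and "(\<lambda>k. of_real (\<omega> ^ (2 * k)) * W k x) sums w x"
proof -
  obtain M where M: "M \<ge> 0" "\<And>x. x \<in> {0<..b} \<Longrightarrow> norm (g x) \<le> M * x powr 0"
    using g_bounded by (auto elim!: powr_boundedE)
  have gM: "norm (g x) \<le> M" if "x \<in> {0<..b}" for x using M(2)[OF that] that by simp
  define K where "K = \<omega>\<^sup>2 * (C / c)\<^sup>2"
  have R1: "norm (g_rest n x) \<le> M * K ^ n * x powr (2 * real n)" for n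
    unfolding K_def by (rule remainder_bounds(1)) (use c C gM x in auto)
  have R2: "norm (w_rest (Suc n) x) \<le>
      \<omega>\<^sup>2 * C\<^sup>2 * M * K ^ n * x powr (2 * l + 3 + 2 * real n)" for n
    unfolding K_def by (rule remainder_bounds(2)) (use c C gM x in auto)
  have "K * x\<^sup>2 \<le> K * b\<^sup>2" using x by (intro mult_left_mono power_mono) (auto simp: K_def)
  then have K: "0 \<le> K * x\<^sup>2" "K * x\<^sup>2 < 1" using \<omega> by (auto simp: K_def)
  have xp: "x powr (2 * real n) = (x\<^sup>2) ^ n" for n
    using x powr_realpow[of x "2 * n"] by (simp add: power_mult)
  have lim: "(\<lambda>n. A * (K * x\<^sup>2) ^ n) \<longlonglongrightarrow> 0" for A
    using tendsto_mult_right_zero[OF LIMSEQ_realpow_zero[OF K]] by simp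
  have "(\<lambda>n. g_rest n x) \<longlonglongrightarrow> 0"
  proof (rule Lim_null_comparison[OF _ lim[of M]], intro always_eventually allI)
    show "norm (g_rest n x) \<le> M * (K * x\<^sup>2) ^ n" for n
      using R1[of n] unfolding xp by (simp only: power_mult_distrib mult_ac)
  qed
  from tendsto_diff[OF tendsto_const[of "g x"] this[unfolded g_rest_def]]
  show "(\<lambda>k. of_real (\<omega> ^ (2 * k)) * r k x) sums g x" by (simp add: sums_def)
  have "(\<lambda>n. w_rest (Suc n) x) \<longlonglongrightarrow> 0"
  proof (rule Lim_null_comparison[OF _ lim[of "\<omega>\<^sup>2 * C\<^sup>2 * M * x powr (2 * l + 3)"]], intro always_eventually allI)
    show "norm (w_rest (Suc n) x) \<le>
        \<omega>\<^sup>2 * C\<^sup>2 * M * x powr (2 * l + 3) * (K * x\<^sup>2) ^ n" for n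
      using R2[of n] unfolding powr_add[of x "2 * l + 3"] xp
      by (simp only: power_mult_distrib mult_ac)
  qed
  from tendsto_diff[OF tendsto_const[of "w x"] this[unfolded w_rest_def]]
  have "(\<lambda>n. \<Sum>k<Suc n. of_real (\<omega> ^ (2 * k)) * W k x) \<longlonglongrightarrow> w x" by simp
  then show "(\<lambda>k. of_real (\<omega> ^ (2 * k)) * W k x) sums w x"
    unfolding sums_def by (subst (asm) filterlim_sequentially_Suc)
qed

end

end

section \<open>Even Jacobi polynomials with equal parameters\<close>

lemma jacobi_P_has_derivative:
  "(jacobi_P (Suc n) \<alpha> \<beta> has_real_derivative
     (real n + \<alpha> + \<beta> + 2) / 2 * jacobi_P n (\<alpha> + 1) (\<beta> + 1) x) (at x)"
proof -
  define c where "c = (\<lambda>s. ((real (Suc n) + \<alpha>) gchoose (Suc n - s)) * ((real (Suc n) + \<beta>) gchoose s))"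
  define y z where "y = (x - 1) / 2" and "z = (x + 1) / 2"
  let ?S1 = "\<lambda>s. c s * (real s * y ^ (s - 1) / 2) * z ^ (Suc n - s)"
  let ?S2 = "\<lambda>s. c s * y ^ s * (real (Suc n - s) * z ^ (Suc n - s - 1) / 2)"
  let ?S3 = "\<lambda>s. c (Suc s) * (real (Suc s) * y ^ s / 2) * z ^ (n - s)"
  let ?S4 = "\<lambda>s. c s * y ^ s * (real (Suc n - s) * z ^ (n - s) / 2)"
  have coeff: "c (Suc s) * real (Suc s) / 2 + c s * real (Suc n - s) / 2 =
      (real n + \<alpha> + \<beta> + 2) / 2 * (((real n + (\<alpha> + 1)) gchoose (n - s)) * ((real n + (\<beta> + 1)) gchoose s))"
    if "s \<le> n" for s
  proof -
    have 1: "((real (Suc n) + \<beta>) gchoose (Suc s)) * real (Suc s) =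
        (real (Suc n) + \<beta> - real s) * ((real (Suc n) + \<beta>) gchoose s)"
      using gbinomial_mult_1[of "real (Suc n) + \<beta>" s] by (simp add: algebra_simps del: of_nat_Suc)
    have 2: "((real (Suc n) + \<alpha>) gchoose (Suc (n - s))) * real (Suc (n - s)) =
        (real (Suc n) + \<alpha> - real (n - s)) * ((real (Suc n) + \<alpha>) gchoose (n - s))"
      using gbinomial_mult_1[of "real (Suc n) + \<alpha>" "n - s"] by (simp add: algebra_simps del: of_nat_Suc)
    have "c (Suc s) * real (Suc s) + c s * real (Suc n - s) =
      ((real (Suc n) + \<alpha>) gchoose (n - s)) * (((real (Suc n) + \<beta>) gchoose (Suc s)) * real (Suc s)) +
      (((real (Suc n) + \<alpha>) gchoose (Suc (n - s))) * real (Suc (n - s))) * ((real (Suc n) + \<beta>) gchoose s)"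
      using that by (simp add: c_def Suc_diff_le algebra_simps del: of_nat_Suc)
    also have "\<dots> = (real n + \<alpha> + \<beta> + 2) * (((real (Suc n) + \<alpha>) gchoose (n - s)) * ((real (Suc n) + \<beta>) gchoose s))"
      unfolding 1 2 using that by (simp add: of_nat_diff algebra_simps)
    finally show ?thesis by (simp add: add_ac)
  qed
  have "((\<lambda>x. \<Sum>s\<le>Suc n. c s * ((x - 1) / 2) ^ s * ((x + 1) / 2) ^ (Suc n - s)) has_real_derivative
      (\<Sum>s\<le>Suc n. ?S1 s +
         ?S2 s)) (at x)"
    unfolding y_def z_def
    by (rule DERIV_sum) (auto intro!: derivative_eq_intros simp: algebra_simps)
  also have "(\<Sum>s\<le>Suc n. ?S1 s +
         ?S2 s) =
      (\<Sum>s\<le>Suc n. ?S1 s) +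
      (\<Sum>s\<le>Suc n. ?S2 s)"
    by (rule sum.distrib)
  also have "(\<Sum>s\<le>Suc n. ?S1 s) =
      (\<Sum>s\<le>n. ?S3 s)"
    by (subst sum.atMost_Suc_shift) simp
  also have "(\<Sum>s\<le>Suc n. ?S2 s) =
      (\<Sum>s\<le>n. ?S4 s)"
    by simp
  also have "(\<Sum>s\<le>n. ?S3 s) +
      (\<Sum>s\<le>n. ?S4 s) =
      (\<Sum>s\<le>n. (c (Suc s) * real (Suc s) / 2 + c s * real (Suc n - s) / 2) * y ^ s * z ^ (n - s))"
    by (simp only: sum.distrib[symmetric]) (rule sum.cong, auto simp: algebra_simps)
  also have "\<dots> = (real n + \<alpha> + \<beta> + 2) / 2 * jacobi_P n (\<alpha> + 1) (\<beta> + 1) x"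
    unfolding jacobi_P_def y_def z_def sum_distrib_left
    by (rule sum.cong) (simp_all only: coeff atMost_iff mult.assoc)
  finally show ?thesis by (simp only: jacobi_P_def[abs_def] c_def)
qed

text \<open>
  The coefficient of \<open>X\<^sup>n\<close> in \<open>(1-X)\<^sup>c (1+X)\<^sup>c = (1-X\<^sup>2)\<^sup>c\<close>. For real \<open>c\<close> this is proved from the
  differential equation \<open>(1-X\<^sup>2) H' = -2 c X H\<close>, which is a two-step recurrence for the coefficients.
\<close>
lemma alternating_gbinomial_convolution:
  fixes c :: real
  shows "(\<Sum>s\<le>n. (-1) ^ s * (c gchoose s) * (c gchoose (n - s))) =
    (if even n then (-1) ^ (n div 2) * (c gchoose (n div 2)) else 0)"
proof -
  define A B where "A = fps_binomial c" and "B = Abs_fps (\<lambda>n. (-1) ^ n * (c gchoose n))"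
  define h where "h = (\<lambda>n. fps_nth (B * A) n)"
  have A: "(1 + fps_X) * fps_deriv A = fps_const c * A"
  proof (rule fps_ext)
    fix m show "fps_nth ((1 + fps_X) * fps_deriv A) m = fps_nth (fps_const c * A) m"
      using gbinomial_mult_1[of c m] by (cases m) (simp_all add: A_def distrib_right algebra_simps)
  qed
  have B: "(1 - fps_X) * fps_deriv B = - (fps_const c * B)"
  proof (rule fps_ext)
    fix m show "fps_nth ((1 - fps_X) * fps_deriv B) m = fps_nth (- (fps_const c * B)) m"
      using arg_cong[OF gbinomial_mult_1[of c m], of "\<lambda>t. (-1) ^ m * t"]
      by (cases m) (simp_all add: B_def left_diff_distrib algebra_simps)
  qed
  have "(1 - fps_X ^ 2) * fps_deriv (B * A) =
      (1 + fps_X) * A * ((1 - fps_X) * fps_deriv B) + (1 - fps_X) * B * ((1 + fps_X) * fps_deriv A)"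
    by (simp add: algebra_simps power2_eq_square)
  also have "\<dots> = - (2 * fps_const c * (fps_X * (B * A)))"
    unfolding A B by (simp add: algebra_simps)
  also have "2 * fps_const c = fps_const (2 * c)" by (simp add: numeral_fps_const)
  finally have ode': "(1 - fps_X ^ 2) * fps_deriv (B * A) = - (fps_const (2 * c) * (fps_X * (B * A)))" .
  define H where "H = B * A"
  have ode: "(1 - fps_X ^ 2) * fps_deriv H = - (fps_const (2 * c) * (fps_X * H))"
    unfolding H_def by (rule ode')
  have hH: "h = fps_nth H" by (simp add: h_def H_def fun_eq_iff)
  have h0: "h 0 = 1" by (simp add: h_def A_def B_def)
  have h1: "h 1 = 0" by (simp add: h_def A_def B_def fps_mult_nth)
  have rec: "real (m + 2) * h (m + 2) = (real m - 2 * c) * h m" for m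
  proof -
    have "fps_nth ((1 - fps_X ^ 2) * fps_deriv H) (Suc m) = fps_nth (- (fps_const (2 * c) * (fps_X * H))) (Suc m)"
      by (simp only: ode)
    then show ?thesis
      by (cases m) (simp_all add: left_diff_distrib fps_X_power_mult_nth hH)
  qed
  have "h (2 * m) = (-1) ^ m * (c gchoose m) \<and> h (2 * m + 1) = 0" for m
  proof (induction m)
    case 0
    then show ?case using h0 h1 by simp
  next
    case (Suc m)
    have "real (2 * m + 2) * h (2 * Suc m) = real (2 * m + 2) * ((-1) ^ Suc m * (c gchoose Suc m))"
      using rec[of "2 * m"] Suc.IH arg_cong[OF gbinomial_mult_1[of c m], of "\<lambda>t. (-1) ^ m * t"]
      by (simp add: algebra_simps)
    moreover have "real (2 * m + 3) * h (2 * Suc m + 1) = 0"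
      using rec[of "2 * m + 1"] Suc.IH by (simp add: numeral_3_eq_3)
    ultimately show ?case
      by (simp only: mult_cancel_left mult_eq_0_iff of_nat_eq_0_iff) auto
  qed
  then have "h n = (if even n then (-1) ^ (n div 2) * (c gchoose (n div 2)) else 0)"
    by (cases "even n") (auto elim!: evenE oddE)
  moreover have "h n = (\<Sum>s\<le>n. (-1) ^ s * (c gchoose s) * (c gchoose (n - s)))"
    by (simp add: h_def fps_mult_nth A_def B_def atLeast0AtMost)
  ultimately show ?thesis by simp
qed

text \<open>
  The coefficient of \<open>x\<^sup>j\<close> in \<open>P\<^sub>n\<^bsup>(a,a)\<^esup>\<close>, a multiple of the Gegenbauer polynomial of order \<open>a + 1/2\<close>.
\<close>
definition gegenbauer_coeff :: "nat \<Rightarrow> real \<Rightarrow> nat \<Rightarrow> real" where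
  "gegenbauer_coeff n a j = (if even (n - j)
     then (-1) ^ ((n - j) div 2) * pochhammer (real n + 2 * a + 1) j / (2 ^ n * fact j) *
       ((real n + a) gchoose ((n - j) div 2)) else 0)"

lemma jacobi_P_at_0: "jacobi_P n a a 0 = gegenbauer_coeff n a 0"
proof -
  have "jacobi_P n a a 0 = (\<Sum>s\<le>n. (-1) ^ s * ((real n + a) gchoose s) * ((real n + a) gchoose (n - s)) / 2 ^ n)"
    unfolding jacobi_P_def
  proof (rule sum.cong)
    fix s assume "s \<in> {..n}"
    then have "(2::real) ^ n = 2 ^ s * 2 ^ (n - s)" by (simp flip: power_add)
    then show "(real n + a gchoose (n - s)) * (real n + a gchoose s) * ((0 - 1) / 2) ^ s * ((0 + 1) / 2) ^ (n - s) =
        (-1) ^ s * ((real n + a) gchoose s) * ((real n + a) gchoose (n - s)) / 2 ^ n"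
      by (simp only:) (simp add: power_divide power_minus[of "1/2"] power_one_over)
  qed simp
  also have "\<dots> = gegenbauer_coeff n a 0"
    unfolding sum_divide_distrib[symmetric] alternating_gbinomial_convolution
    by (simp add: gegenbauer_coeff_def)
  finally show ?thesis .
qed

text \<open>
  Induction on \<open>n\<close> for all \<open>a\<close> at once: differentiation replaces \<open>n\<close> by \<open>n - 1\<close> and \<open>a\<close> by \<open>a + 1\<close>, and
  the constant of integration is the value at \<open>0\<close>.
\<close>
lemma jacobi_P_expansion: "jacobi_P n a a x = (\<Sum>j\<le>n. gegenbauer_coeff n a j * x ^ j)"
proof (induction n arbitrary: a x)
  case 0
  then show ?case by (simp add: jacobi_P_def gegenbauer_coeff_def)
next
  case (Suc n)
  define f where "f = (\<lambda>x. jacobi_P (Suc n) a a x - (\<Sum>j\<le>Suc n. gegenbauer_coeff (Suc n) a j * x ^ j))"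
  have step: "gegenbauer_coeff (Suc n) a (Suc j) * real (Suc j) =
      (real n + a + a + 2) / 2 * gegenbauer_coeff n (a + 1) j" if "j \<le> n" for j
  proof -
    have "pochhammer (real (Suc n) + 2 * a + 1) (Suc j) =
        (real n + 2 * a + 2) * pochhammer (real n + 2 * (a + 1) + 1) j"
      by (simp add: pochhammer_rec algebra_simps)
    then show ?thesis
      by (simp add: gegenbauer_coeff_def del: of_nat_Suc) (simp add: field_simps)
  qed
  have "(f has_real_derivative 0) (at x)" for x
  proof -
    have "((\<lambda>x. \<Sum>j\<le>Suc n. gegenbauer_coeff (Suc n) a j * x ^ j) has_real_derivative
        (\<Sum>j\<le>Suc n. gegenbauer_coeff (Suc n) a j * (real j * x ^ (j - 1)))) (at x)"
      by (rule DERIV_sum) (auto intro!: derivative_eq_intros)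
    also have "(\<Sum>j\<le>Suc n. gegenbauer_coeff (Suc n) a j * (real j * x ^ (j - 1))) =
        (\<Sum>j\<le>n. (gegenbauer_coeff (Suc n) a (Suc j) * real (Suc j)) * x ^ j)"
      by (subst sum.atMost_Suc_shift) (simp add: mult.assoc)
    also have "\<dots> = (\<Sum>j\<le>n. ((real n + a + a + 2) / 2 * gegenbauer_coeff n (a + 1) j) * x ^ j)"
      by (rule sum.cong) (simp_all only: step atMost_iff)
    also have "\<dots> = (real n + a + a + 2) / 2 * jacobi_P n (a + 1) (a + 1) x"
      by (simp only: Suc.IH sum_distrib_left mult.assoc)
    finally show ?thesis
      unfolding f_def using DERIV_diff[OF jacobi_P_has_derivative[of n a a x]] by fastforce
  qed
  then have "f x = f 0" by (rule DERIV_isconst_all[rule_format])  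
  also have "f 0 = 0"
    unfolding f_def jacobi_P_at_0 by (subst sum.atMost_Suc_shift) simp
  finally show ?case by (simp add: f_def)
qed

lemma sum_even_indices:
  fixes f :: "nat \<Rightarrow> 'a :: comm_monoid_add"
  assumes "\<And>j. odd j \<Longrightarrow> j \<le> 2 * n \<Longrightarrow> f j = 0"
  shows "(\<Sum>j\<le>2 * n. f j) = (\<Sum>k\<le>n. f (2 * k))"
  using assms by (induction n) auto

text \<open>
  The factor with which the Taylor coefficient of \<open>\<omega>\<^sup>2\<^sup>k\<close> enters \<open>\<beta>\<^sub>n / (4n+2l+3)\<close>, up to a power of \<open>x\<close>.
\<close>
definition nsbf_weight :: "real \<Rightarrow> nat \<Rightarrow> nat \<Rightarrow> real" where
  "nsbf_weight l n k = 4 ^ k * pochhammer (l + 3/2) (n + k) / fact (n - k)"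

lemma jacobi_P_even_expansion:
  "jacobi_P (2 * n) a a x = (\<Sum>k\<le>n. gegenbauer_coeff (2 * n) a (2 * k) * x ^ (2 * k))"
  unfolding jacobi_P_expansion
proof (rule sum_even_indices)
  show "gegenbauer_coeff (2 * n) a j * x ^ j = 0" if "odd j" "j \<le> 2 * n" for j
    using that by (auto simp: gegenbauer_coeff_def)
qed

lemma Gamma_legendre_duplication_real:
  assumes "x > 0"
  shows "Gamma x * Gamma (x + 1/2) = 2 powr (1 - 2 * x) * sqrt pi * Gamma (2 * x)"
proof -
  have "complex_of_real x \<notin> \<int>\<^sub>\<le>\<^sub>0" "complex_of_real x + 1/2 \<notin> \<int>\<^sub>\<le>\<^sub>0"
    using assms by (auto elim!: nonpos_Ints_cases simp: complex_eq_iff)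
  from Gamma_legendre_duplication[OF this]
  have "complex_of_real (Gamma x * Gamma (x + 1/2)) = of_real (exp ((1 - 2 * x) * ln 2) * sqrt pi * Gamma (2 * x))"
    by (simp flip: Gamma_complex_of_real exp_of_real)
  then show ?thesis by (simp only: of_real_eq_iff) (simp add: powr_def)
qed

text \<open>
  The duplication formula at \<open>n + k + l + 3/2\<close> turns \<open>\<Gamma>(2n+2k+2l+3)\<close> into
  \<open>\<Gamma>(n+k+l+3/2) \<Gamma>(n+k+l+2)\<close>; the second factor cancels against the binomial coefficient.
\<close>
lemma nsbf_normalization:
  assumes l: "l \<ge> -1/2" and k: "k \<le> n"
  shows "(-1) ^ n * (2 * sqrt pi * Gamma (l + 2 * real n + 2)) / (Gamma (l + 3/2) * fact (2 * n)) *
      (1 / jacobi_h l (2 * n)) * gegenbauer_coeff (2 * n) (l + 1) (2 * k) =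
    (4 * real n + 2 * l + 3) * nsbf_weight l n k * ((-1) ^ k / fact (2 * k))"
proof -
  have pG: "pochhammer z m = Gamma (z + real m) / Gamma z" if "z > 0" for z :: real and m
    using that by (intro pochhammer_Gamma) (auto elim!: nonpos_Ints_cases)
  define G0 where "G0 = Gamma (l + 3/2)"
  define G1 where "G1 = Gamma (2 * real n + l + 2)"
  define G2 where "G2 = Gamma (2 * real n + 2 * l + 3)"
  define G3 where "G3 = Gamma (real n + real k + l + 2)"
  define G4 where "G4 = Gamma (real n + real k + l + 3/2)"
  have pos: "G0 > 0" "G1 > 0" "G2 > 0" "G3 > 0" "G4 > 0"
    unfolding G0_def G1_def G2_def G3_def G4_def using l by (auto intro!: Gamma_real_pos)
  have e1: "pochhammer (real (2 * n) + 2 * (l + 1) + 1) (2 * k) = 2 powr (2 * l + 2) * 4 ^ (n + k) * G4 * G3 / (sqrt pi * G2)"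
  proof -
    have "pochhammer (real (2 * n) + 2 * (l + 1) + 1) (2 * k) = Gamma (2 * (real n + real k + l + 3/2)) / G2"
      using l by (subst pG) (simp_all add: G2_def algebra_simps)
    also have "Gamma (2 * (real n + real k + l + 3/2)) = 2 powr (2 * l + 2 + 2 * real (n + k)) * G4 * G3 / sqrt pi"
    proof -
      define z where "z = real n + real k + l + 3/2"
      have "G4 * G3 = 2 powr (1 - 2 * z) * sqrt pi * Gamma (2 * z)"
        using Gamma_legendre_duplication_real[of z] l by (simp add: z_def G3_def G4_def add_ac)
      then have "2 powr (2 * z - 1) * (G4 * G3) =
          (2 powr (2 * z - 1) * 2 powr (1 - 2 * z)) * sqrt pi * Gamma (2 * z)"
        by simp
      moreover have "(2::real) powr (2 * z - 1) * 2 powr (1 - 2 * z) = 1"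
        by (simp flip: powr_add)
      moreover have e: "2 * l + 2 + 2 * real (n + k) = 2 * z - 1" by (simp add: z_def)
      ultimately show ?thesis unfolding z_def[symmetric] e by (simp add: mult.assoc)
    qed
    also have "(2::real) powr (2 * l + 2 + 2 * real (n + k)) = 2 powr (2 * l + 2) * 4 ^ (n + k)"
    proof -
      have "(2::real) powr (2 * real (n + k)) = 2 ^ (2 * (n + k))"
        using powr_realpow[of 2 "2 * (n + k)"] by simp
      also have "\<dots> = 4 ^ (n + k)" by (simp only: power_mult) simp
      finally show ?thesis by (simp only: powr_add)
    qed
    finally show ?thesis by simp
  qed
  have e2: "(real (2 * n) + (l + 1)) gchoose (n - k) = G1 / (G3 * fact (n - k))"
    unfolding gbinomial_pochhammer' using l k
    by (subst pG) (simp_all add: G1_def G3_def of_nat_diff algebra_simps)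
  have e3: "nsbf_weight l n k = 4 ^ k * (G4 / G0) / fact (n - k)"
    unfolding nsbf_weight_def using l by (subst pG) (simp_all add: G4_def G0_def algebra_simps)
  have e4: "jacobi_h l (2 * n) = 2 * 2 powr (2 * l + 2) / (4 * real n + 2 * l + 3) * (G1\<^sup>2 / (fact (2 * n) * G2))"
    unfolding jacobi_h_def G1_def G2_def using powr_add[of 2 1 "2 * l + 2"] by (simp add: algebra_simps)
  have e5: "gegenbauer_coeff (2 * n) (l + 1) (2 * k) = (-1) ^ n * (-1) ^ k *
      (2 powr (2 * l + 2) * 4 ^ k * G4 * G1) / (sqrt pi * G2 * fact (2 * k) * fact (n - k))"
  proof -
    have "even (2 * n - 2 * k)" and h: "(2 * n - 2 * k) div 2 = n - k" using k by auto
    then have "gegenbauer_coeff (2 * n) (l + 1) (2 * k) = (-1) ^ (n - k) *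
        pochhammer (real (2 * n) + 2 * (l + 1) + 1) (2 * k) / (2 ^ (2 * n) * fact (2 * k)) *
        ((real (2 * n) + (l + 1)) gchoose (n - k))"
      by (simp only: gegenbauer_coeff_def if_True h)
    also have "\<dots> = (-1) ^ (n - k) * (2 powr (2 * l + 2) * 4 ^ (n + k) * G4 * G3 / (sqrt pi * G2)) /
        (2 ^ (2 * n) * fact (2 * k)) * (G1 / (G3 * fact (n - k)))"
      by (simp only: e1 e2)
    also have "(2::real) ^ (2 * n) = 4 ^ n" by (simp only: power_mult) simp
    also have "(-1::real) ^ (n - k) = (-1) ^ n * (-1) ^ k"
      using k by (simp add: minus_one_power_iff)
    also have "(-1) ^ n * (-1) ^ k * (2 powr (2 * l + 2) * 4 ^ (n + k) * G4 * G3 / (sqrt pi * G2)) /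
        (4 ^ n * fact (2 * k)) * (G1 / (G3 * fact (n - k))) = (-1) ^ n * (-1) ^ k *
      (2 powr (2 * l + 2) * 4 ^ k * G4 * G1) / (sqrt pi * G2 * fact (2 * k) * fact (n - k))"
      using pos by (simp add: power_add)
    finally show ?thesis .
  qed
  have "4 * real n + 2 * l + 3 > 0" using l by simp
  moreover have "(-1::real) ^ n * (-1) ^ n = 1" by (simp flip: power_add)
  moreover have "Gamma (l + 2 * real n + 2) = G1" by (simp add: G1_def algebra_simps)
  moreover have "(2::real) powr (2 * l + 2) > 0" "sqrt pi > 0" by auto
  ultimately show ?thesis
    unfolding e3 e4 e5 G0_def[symmetric] using pos
    by (simp add: field_simps power2_eq_square)
qed

definition moment :: "(real \<Rightarrow> complex) \<Rightarrow> real \<Rightarrow> nat \<Rightarrow> complex" where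
  "moment K x m = (LINT t:{-x..x}|lebesgue. K t * of_real t ^ m)"

lemma nsbf_coeff_eq_moments:
  assumes l: "l \<ge> -1/2" and x: "x > 0" and K: "K x absolutely_integrable_on {-x..x}"
  shows "nsbf_coeff l K n x = of_real (4 * real n + 2 * l + 3) *
    (\<Sum>k\<le>n. of_real (nsbf_weight l n k / (x powr (l + 1) * x ^ (2 * k))) *
       ((-1) ^ k / fact (2 * k) * moment (K x) x (2 * k)))"
proof -
  let ?c = "\<lambda>k. gegenbauer_coeff (2 * n) (l + 1) (2 * k)"
  let ?N = "(-1) ^ n * (2 * sqrt pi * Gamma (l + 2 * real n + 2))"
  let ?D = "Gamma (l + 3/2) * fact (2 * n)"
  have ai: "(\<lambda>t. K x t * of_real t ^ m) absolutely_integrable_on {-x..x}" for m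
    by (intro absolutely_integrable_mult_continuous K continuous_intros)
  have "(LINT t:{-x..x}|lebesgue. K x t * of_real (jacobi_P (2 * n) (l + 1) (l + 1) (t / x))) =
      (LINT t:{-x..x}|lebesgue. \<Sum>k\<le>n. of_real (?c k / x ^ (2 * k)) * (K x t * of_real t ^ (2 * k)))"
    unfolding jacobi_P_even_expansion by (simp add: sum_distrib_left power_divide mult_ac)
  also have "\<dots> = (\<Sum>k\<le>n. LINT t:{-x..x}|lebesgue. of_real (?c k / x ^ (2 * k)) * (K x t * of_real t ^ (2 * k)))"
    unfolding set_lebesgue_integral_def scaleR_sum_right
  proof (rule Bochner_Integration.integral_sum)
    show "integrable lebesgue (\<lambda>t. indicator {-x..x} t *\<^sub>R (of_real (?c k / x ^ (2 * k)) * (K x t * of_real t ^ (2 * k))))" for k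
      using set_integrable_mult_right[of "of_real (?c k / x ^ (2 * k))" lebesgue "{-x..x}", OF ai[of "2 * k"]]
      by (simp only: set_integrable_def)
  qed
  also have "\<dots> = (\<Sum>k\<le>n. of_real (?c k / x ^ (2 * k)) * moment (K x) x (2 * k))"
    unfolding moment_def by (rule sum.cong) (simp_all only: set_integral_mult_right)
  finally have J: "jacobi_coeff l K n x =
      (\<Sum>k\<le>n. of_real (1 / jacobi_h l (2 * n)) * (of_real (?c k / x ^ (2 * k)) * moment (K x) x (2 * k)))"
    unfolding jacobi_coeff_def by (simp only: sum_distrib_left)
  show ?thesis
    unfolding nsbf_coeff_def J sum_distrib_left
  proof (rule sum.cong)
    fix k assume "k \<in> {..n}"
    then have k: "k \<le> n" by simp
    define X where "X = x powr (l + 1) * x ^ (2 * k)"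
    define sg where "sg = (-1 :: real) ^ k / fact (2 * k)"
    have "?N / (x powr (l + 1) * Gamma (l + 3/2) * fact (2 * n)) * ((1 / jacobi_h l (2 * n)) * (?c k / x ^ (2 * k))) =
        (?N / ?D * (1 / jacobi_h l (2 * n)) * ?c k) / X"
      by (simp add: X_def)
    also have "\<dots> = (4 * real n + 2 * l + 3) * nsbf_weight l n k * sg / X"
      by (simp only: nsbf_normalization[OF l k] sg_def)
    also have "\<dots> = (4 * real n + 2 * l + 3) * ((nsbf_weight l n k / X) * sg)"
      by (simp add: mult_ac)
    finally have "complex_of_real (?N / (x powr (l + 1) * Gamma (l + 3/2) * fact (2 * n))) *
        (of_real (1 / jacobi_h l (2 * n)) * of_real (?c k / x ^ (2 * k))) =
        of_real (4 * real n + 2 * l + 3) * (of_real (nsbf_weight l n k / X) * of_real sg)"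
      by (simp only: of_real_mult[symmetric])
    from arg_cong[OF this, of "\<lambda>z. z * moment (K x) x (2 * k)"]
    have "complex_of_real (?N / (x powr (l + 1) * Gamma (l + 3/2) * fact (2 * n))) *
        (of_real (1 / jacobi_h l (2 * n)) * (of_real (?c k / x ^ (2 * k)) * moment (K x) x (2 * k))) =
        of_real (4 * real n + 2 * l + 3) * (of_real (nsbf_weight l n k / X) * (of_real sg * moment (K x) x (2 * k)))"
      by (simp only: mult.assoc)
    moreover have "complex_of_real sg = (-1) ^ k / fact (2 * k)" by (simp add: sg_def)
    ultimately show "complex_of_real (?N / (x powr (l + 1) * Gamma (l + 3/2) * fact (2 * n))) *
        (of_real (1 / jacobi_h l (2 * n)) * (of_real (?c k / x ^ (2 * k)) * moment (K x) x (2 * k))) =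
        of_real (4 * real n + 2 * l + 3) *
        (of_real (nsbf_weight l n k / (x powr (l + 1) * x ^ (2 * k))) * ((-1) ^ k / fact (2 * k) * moment (K x) x (2 * k)))"
      by (simp only: X_def)
  qed simp
qed

section \<open>Power series of Fourier integrals and Bessel functions\<close>

lemma moment_odd:
  assumes even: "\<And>t. t \<in> {-x..x} \<Longrightarrow> K (- t) = K t"
    and K: "K absolutely_integrable_on {-x..x}" and m: "odd m"
  shows "moment K x m = 0"
proof -
  let ?f = "\<lambda>t. K t * of_real t ^ m"
  have ai: "?f absolutely_integrable_on {-x..x}"
    by (intro absolutely_integrable_mult_continuous K continuous_intros)
  have "integral {-x..x} ?f = integral {-x..x} (\<lambda>t. ?f (- t))"
    using Henstock_Kurzweil_Integration.integral_reflect_real[of x "-x" ?f] by simp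
  also have "\<dots> = integral {-x..x} (\<lambda>t. - ?f t)"
    by (rule integral_cong) (use even m in simp)
  also have "\<dots> = - integral {-x..x} ?f" by simp
  finally have "integral {-x..x} ?f = 0" by simp
  then show ?thesis unfolding moment_def using ai by (simp add: set_lebesgue_integral_eq_integral)
qed

text \<open>
  The exponential series is integrated term by term; odd moments vanish by symmetry.
\<close>
lemma fourier_moment_sums:
  assumes even: "\<And>t. t \<in> {-x..x} \<Longrightarrow> K (- t) = K t"
    and K: "K absolutely_integrable_on {-x..x}"
  shows "(\<lambda>k. of_real (\<omega> ^ (2 * k)) * ((-1) ^ k / fact (2 * k) * moment K x (2 * k))) sums
    (LINT t:{-x..x}|lebesgue. K t * exp (\<i> * of_real \<omega> * of_real t))"
proof -
  let ?z = "\<lambda>t. \<i> * of_real \<omega> * complex_of_real t"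
  let ?K = "\<lambda>t. indicator {-x..x} t *\<^sub>R K t"
  let ?q = "(\<bar>\<omega>\<bar> * \<bar>x\<bar>)"
  define f where "f = (\<lambda>m t. indicator {-x..x} t *\<^sub>R (K t * (?z t ^ m / fact m)))"
  have ai: "(\<lambda>t. K t * (?z t ^ m / fact m)) absolutely_integrable_on {-x..x}" for m
    by (intro absolutely_integrable_mult_continuous K continuous_intros) auto
  have int: "integrable lebesgue (f m)" for m
    using ai[of m] by (simp add: f_def set_integrable_def)
  have Kint: "integrable lebesgue (\<lambda>t. ?K t)"
    using K by (simp add: set_integrable_def)
  have exps: "(\<lambda>m. w ^ m / fact m) sums exp w" for w :: complex
    using exp_converges[of w] by (simp add: scaleR_conv_of_real field_simps)
  have nsum: "summable (\<lambda>m. norm (f m t))" for t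
  proof -
    have "summable (\<lambda>m. norm (?z t ^ m / fact m))"
      using summable_norm_exp[of "?z t"] by (simp add: scaleR_conv_of_real field_simps)
    then have "summable (\<lambda>m. norm (?K t) * norm (?z t ^ m / fact m))"
      by (rule summable_mult)
    then show ?thesis by (simp only: f_def norm_mult norm_scaleR mult.assoc)
  qed
  have bound: "norm (f m t) \<le> ?q ^ m / fact m * norm (?K t)" for m t
  proof (cases "t \<in> {-x..x}")
    case True
    then have "(\<bar>\<omega>\<bar> * \<bar>t\<bar>) ^ m \<le> ?q ^ m"
      by (intro power_mono mult_left_mono) auto
    then have "norm (?z t ^ m / fact m) \<le> ?q ^ m / fact m"
      by (simp add: norm_divide norm_power norm_mult divide_right_mono)
    then have le: "norm (?z t ^ m / fact m) \<le> ?q ^ m / fact m" .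
    have "norm (f m t) = norm (?K t) * norm (?z t ^ m / fact m)"
      by (simp only: f_def norm_mult norm_scaleR mult.assoc)
    also have "\<dots> \<le> norm (?K t) * (?q ^ m / fact m)"
      by (rule mult_left_mono[OF le]) simp
    finally show ?thesis by (simp only: mult.commute)
  qed (simp add: f_def)
  have "summable (\<lambda>m. \<integral>t. norm (f m t) \<partial>lebesgue)"
  proof (rule summable_comparison_test')
    let ?C = "\<integral>t. norm (?K t) \<partial>lebesgue"
    show "summable (\<lambda>m. ?q ^ m / fact m * ?C)"
      using summable_mult2[OF summable_exp[of "\<bar>\<omega>\<bar> * \<bar>x\<bar>"], of ?C] by (simp add: field_simps)
    fix m :: nat
    have "(\<integral>t. norm (f m t) \<partial>lebesgue) \<le>
        (\<integral>t. ?q ^ m / fact m * norm (?K t) \<partial>lebesgue)"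
      by (intro integral_mono integrable_mult_right integrable_norm Kint int bound)
    then show "norm (\<integral>t. norm (f m t) \<partial>lebesgue) \<le> ?q ^ m / fact m * ?C" by simp
  qed
  then have "(\<lambda>m. integral\<^sup>L lebesgue (f m)) sums (\<integral>t. (\<Sum>m. f m t) \<partial>lebesgue)"
    by (intro sums_integral int) (auto simp: nsum)
  also have "(\<lambda>t. \<Sum>m. f m t) = (\<lambda>t. indicator {-x..x} t *\<^sub>R (K t * exp (?z t)))"
  proof
    fix t
    have "(\<lambda>m. f m t) sums (indicator {-x..x} t *\<^sub>R (K t * exp (?z t)))"
      unfolding f_def by (intro sums_scaleR_right sums_mult exps)
    then show "(\<Sum>m. f m t) = indicator {-x..x} t *\<^sub>R (K t * exp (?z t))" by (simp add: sums_iff)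
  qed
  finally have S: "(\<lambda>m. integral\<^sup>L lebesgue (f m)) sums (LINT t:{-x..x}|lebesgue. K t * exp (?z t))"
    by (simp only: set_lebesgue_integral_def)
  have I: "integral\<^sup>L lebesgue (f m) = (\<i> * of_real \<omega>) ^ m / fact m * moment K x m" for m
  proof -
    have "integral\<^sup>L lebesgue (f m) =
        (LINT t:{-x..x}|lebesgue. (\<i> * of_real \<omega>) ^ m / fact m * (K t * of_real t ^ m))"
      unfolding f_def set_lebesgue_integral_def by (simp add: power_mult_distrib mult_ac)
    then show ?thesis by (simp only: set_integral_mult_right moment_def)
  qed
  have "(\<lambda>k. integral\<^sup>L lebesgue (f (2 * k))) sums (LINT t:{-x..x}|lebesgue. K t * exp (?z t))"
  proof (subst sums_mono_reindex[of "\<lambda>k. 2 * k"])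
    show "strict_mono (\<lambda>k::nat. 2 * k)" by (simp add: strict_mono_def)
    show "integral\<^sup>L lebesgue (f m) = 0" if "m \<notin> range ((*) 2)" for m
    proof -
      have "odd m" using that by (auto elim!: evenE)
      then show ?thesis using moment_odd[OF even K] by (simp add: I)
    qed
  qed (rule S)
  moreover have "integral\<^sup>L lebesgue (f (2 * k)) =
      of_real (\<omega> ^ (2 * k)) * ((-1) ^ k / fact (2 * k) * moment K x (2 * k))" for k
  proof -
    have "(\<i> * complex_of_real \<omega>) ^ (2 * k) = (\<i>\<^sup>2) ^ k * (of_real \<omega> ^ 2) ^ k"
      by (simp only: power_mult power_mult_distrib)
    also have "\<dots> = of_real (\<omega> ^ (2 * k)) * (-1) ^ k"
      by (simp only: power2_i of_real_power power_mult) (simp only: mult.commute)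
    finally show ?thesis unfolding I by simp
  qed
  ultimately show ?thesis by simp
qed

text \<open>
  The coefficient of \<open>\<omega>\<^sup>2\<^sup>k x\<^bsup>l+1+2k\<^esup>\<close> in \<open>d\<^sub>l(\<omega>) b\<^sub>l(\<omega>x)\<close>.
\<close>
definition bessel_coeff :: "real \<Rightarrow> nat \<Rightarrow> real" where
  "bessel_coeff l k = (-1) ^ k / (4 ^ k * fact k * pochhammer (l + 3/2) k)"

lemma pochhammer_ge_1: "z \<ge> 1 \<Longrightarrow> pochhammer (z::real) k \<ge> 1"
proof (induction k)
  case (Suc k)
  then have "1 * 1 \<le> pochhammer z k * (z + real k)" by (intro mult_mono) auto
  then show ?case by (simp add: pochhammer_Suc)
qed simp

lemma bessel_coeff_summable:
  fixes y :: "'a :: {real_normed_field, banach}"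
  assumes "l \<ge> -1/2"
  shows "summable (\<lambda>k. of_real (bessel_coeff l k) * y ^ k)"
proof (rule summable_comparison_test')
  show "summable (\<lambda>k. norm y ^ k / fact k)"
    using summable_exp[of "norm y"] by (simp add: field_simps)
  fix k :: nat
  have p: "1 \<le> pochhammer (l + 3/2) k" using assms by (intro pochhammer_ge_1) auto
  have "fact k * (1 * 1) \<le> fact k * (4 ^ k * pochhammer (l + 3/2) k)"
    using p by (intro mult_left_mono mult_mono) auto
  then have "norm y ^ k / (fact k * (4 ^ k * pochhammer (l + 3/2) k)) \<le> norm y ^ k / fact k"
    by (intro divide_left_mono mult_pos_pos) (use p in auto)
  moreover have "norm (of_real (bessel_coeff l k) * y ^ k) = \<bar>bessel_coeff l k\<bar> * norm y ^ k"
    by (simp only: norm_mult norm_of_real norm_power)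
  moreover have "\<bar>bessel_coeff l k\<bar> = 1 / (fact k * (4 ^ k * pochhammer (l + 3/2) k))"
    using p by (simp add: bessel_coeff_def abs_mult power_abs mult_ac)
  ultimately show "norm (of_real (bessel_coeff l k) * y ^ k) \<le> norm y ^ k / fact k"
    by simp
qed

lemma bessel_J_series:
  fixes w :: complex
  assumes l: "l \<ge> -1/2"
  shows "(\<Sum>k. (-1) ^ k / fact k * rGamma (of_real (l + 1/2 + real k + 1)) * (w / 2) ^ (2 * k)) =
    of_real (1 / Gamma (l + 3/2)) * (\<Sum>k. of_real (bessel_coeff l k) * (w\<^sup>2) ^ k)"
proof -
  have G: "Gamma (l + 3/2) > 0" using l by (intro Gamma_real_pos) auto
  have rG: "rGamma (l + 3/2 + real k) = 1 / (Gamma (l + 3/2) * pochhammer (l + 3/2) k)" for k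
  proof -
    have "pochhammer (l + 3/2) k = Gamma (l + 3/2 + real k) / Gamma (l + 3/2)"
      using l by (intro pochhammer_Gamma) (auto elim!: nonpos_Ints_cases)
    then show ?thesis using G by (simp add: rGamma_inverse_Gamma field_simps)
  qed
  have "(\<lambda>k. of_real (1 / Gamma (l + 3/2)) * (of_real (bessel_coeff l k) * (w\<^sup>2) ^ k)) sums
      (of_real (1 / Gamma (l + 3/2)) * (\<Sum>k. of_real (bessel_coeff l k) * (w\<^sup>2) ^ k))"
    by (intro sums_mult summable_sums bessel_coeff_summable l)
  also have "(\<lambda>k. of_real (1 / Gamma (l + 3/2)) * (of_real (bessel_coeff l k) * (w\<^sup>2) ^ k)) =
      (\<lambda>k. (-1) ^ k / fact k * rGamma (of_real (l + 1/2 + real k + 1)) * (w / 2) ^ (2 * k))"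
  proof
    fix k
    have "l + 1/2 + real k + 1 = l + 3/2 + real k" by simp
    then have R: "rGamma (complex_of_real (l + 1/2 + real k + 1)) =
        of_real (1 / (Gamma (l + 3/2) * pochhammer (l + 3/2) k))"
      by (simp only: rGamma_complex_of_real rG)
    have Q: "(w / 2) ^ (2 * k) = (w\<^sup>2) ^ k / 4 ^ k" by (simp only: power_mult power_divide) simp
    show "of_real (1 / Gamma (l + 3/2)) * (of_real (bessel_coeff l k) * (w\<^sup>2) ^ k) =
       (-1) ^ k / fact k * rGamma (of_real (l + 1/2 + real k + 1)) * (w / 2) ^ (2 * k)"
      unfolding R Q by (simp add: bessel_coeff_def mult_ac)
  qed
  finally show ?thesis by (simp only: sums_iff)
qed

lemma bessel_b_of_real:
  assumes l: "l \<ge> -1/2" and z: "z > 0"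
  shows "bessel_b l (of_real z) =
    of_real (sqrt pi / Gamma (l + 3/2) * (z / 2) powr (l + 1) * (\<Sum>k. bessel_coeff l k * (z\<^sup>2) ^ k))"
proof -
  let ?S = "(\<Sum>k. bessel_coeff l k * (z\<^sup>2) ^ k)"
  have "(\<lambda>k. complex_of_real (bessel_coeff l k * (z\<^sup>2) ^ k)) sums of_real ?S"
    using bessel_coeff_summable[OF l, of "z\<^sup>2"] by (intro sums_of_real summable_sums) simp
  then have "(\<Sum>k. of_real (bessel_coeff l k) * ((complex_of_real z)\<^sup>2) ^ k) =
      of_real ?S"
    by (simp add: sums_iff)
  then have S: "(\<Sum>k. (-1) ^ k / fact k * rGamma (of_real (l + 1/2 + real k + 1)) * (complex_of_real z / 2) ^ (2 * k)) =
      of_real (1 / Gamma (l + 3/2) * ?S)"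
    by (simp only: bessel_J_series[OF l] of_real_mult)
  have P: "(complex_of_real z / 2) powr of_real (l + 1/2) = of_real ((z / 2) powr (l + 1/2))"
    using powr_of_real[of "z / 2" "l + 1/2"] z by simp
  have C: "csqrt (of_real pi / (2 * of_real z)) = of_real (sqrt (pi / (2 * z)))"
    using of_real_sqrt[of "pi / (2 * z)"] z by simp
  have "z * sqrt (pi / (2 * z)) = sqrt pi * (z / 2) powr (1/2)"
  proof -
    have "z * sqrt (pi / (2 * z)) = sqrt (z\<^sup>2 * (pi / (2 * z)))"
      using z by (simp only: real_sqrt_mult) simp
    also have "z\<^sup>2 * (pi / (2 * z)) = pi * (z / 2)" using z by (simp add: power2_eq_square)
    finally show ?thesis using z by (simp only: real_sqrt_mult) (simp add: powr_half_sqrt)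
  qed
  moreover have "(z / 2) powr (l + 1) = (z / 2) powr (1/2) * (z / 2) powr (l + 1/2)"
    by (simp add: add.commute flip: powr_add)
  ultimately have E: "sqrt pi / Gamma (l + 3/2) * (z / 2) powr (l + 1) * ?S =
      z * (sqrt (pi / (2 * z)) * ((z / 2) powr (l + 1/2) * (1 / Gamma (l + 3/2) * ?S)))"
    by (simp add: mult_ac)
  show ?thesis
    unfolding E bessel_b_def spherical_j_def bessel_J_def S P C by (simp only: of_real_mult)
qed

lemma d_coeff_cancel:
  assumes l: "l \<ge> -1/2" and \<omega>: "\<omega> > 0" and x: "x > 0"
  shows "d_coeff l (of_real \<omega>) * of_real (sqrt pi / Gamma (l + 3/2) * (\<omega> * x / 2) powr (l + 1) * y) =
    of_real (x powr (l + 1) * y)"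
proof -
  have G: "Gamma (l + 3/2) > 0" using l by (intro Gamma_real_pos) auto
  have "d_coeff l (of_real \<omega>) = of_real (2 powr (l + 1) * Gamma (l + 3/2) / sqrt pi / \<omega> powr (l + 1))"
    using powr_of_real[of \<omega> "l + 1"] \<omega> by (simp add: d_coeff_def)
  moreover have "2 powr (l + 1) * Gamma (l + 3/2) / sqrt pi / \<omega> powr (l + 1) *
      (sqrt pi / Gamma (l + 3/2) * (\<omega> * x / 2) powr (l + 1) * y) = x powr (l + 1) * y"
    using G \<omega> x by (simp add: powr_mult powr_divide)
  ultimately show ?thesis by (simp only: of_real_mult[symmetric])
qed

lemma d_coeff_bessel_b:
  assumes l: "l \<ge> -1/2" and \<omega>: "\<omega> > 0" and x: "x > 0"
  shows "(\<lambda>k. of_real (\<omega> ^ (2 * k)) * of_real (bessel_coeff l k * (x powr (l + 1) * x ^ (2 * k)))) sums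
    (d_coeff l (of_real \<omega>) * bessel_b l (of_real \<omega> * of_real x))"
proof -
  have "(\<lambda>k. complex_of_real (x powr (l + 1) * (bessel_coeff l k * ((\<omega> * x)\<^sup>2) ^ k))) sums
      of_real (x powr (l + 1) * (\<Sum>k. bessel_coeff l k * ((\<omega> * x)\<^sup>2) ^ k))"
    using bessel_coeff_summable[OF l, of "(\<omega> * x)\<^sup>2"]
    by (intro sums_of_real sums_mult summable_sums) simp
  moreover have "d_coeff l (of_real \<omega>) * bessel_b l (of_real \<omega> * of_real x) =
      of_real (x powr (l + 1) * (\<Sum>k. bessel_coeff l k * ((\<omega> * x)\<^sup>2) ^ k))"
    using bessel_b_of_real[OF l, of "\<omega> * x"] d_coeff_cancel[OF l \<omega> x] \<omega> x by simp
  moreover have "complex_of_real (x powr (l + 1) * (bessel_coeff l k * ((\<omega> * x)\<^sup>2) ^ k)) =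
      of_real (\<omega> ^ (2 * k)) * of_real (bessel_coeff l k * (x powr (l + 1) * x ^ (2 * k)))" for k
  proof -
    have "((\<omega> * x)\<^sup>2) ^ k = \<omega> ^ (2 * k) * x ^ (2 * k)" by (simp only: power_mult_distrib power_mult)
    then show ?thesis unfolding of_real_mult[symmetric] by (simp only: mult_ac)
  qed
  ultimately show ?thesis by (simp only:)
qed

lemma bessel_b_field_differentiable:
  assumes l: "l \<ge> -1/2" and z: "z > 0"
  shows "bessel_b l field_differentiable at (of_real z)"
proof -
  let ?P = "\<lambda>y. \<Sum>k. of_real (bessel_coeff l k) * y ^ k :: complex"
  let ?b = "\<lambda>w. w * (csqrt (of_real pi / (2 * w)) * ((w / 2) powr of_real (l + 1/2) * (of_real (1 / Gamma (l + 3/2)) * ?P (w\<^sup>2))))"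
  have "(?P has_field_derivative (\<Sum>k. diffs (\<lambda>k. of_real (bessel_coeff l k)) k * y ^ k)) (at y)" for y
    by (rule termdiffs_strong_converges_everywhere) (rule bessel_coeff_summable[OF l])
  then have P: "?P field_differentiable at y" for y
    using field_differentiable_def by blast
  have "((\<lambda>w. ?P (w\<^sup>2)) has_field_derivative deriv ?P (w\<^sup>2) * (2 * w)) (at w)" for w
    by (rule DERIV_chain2[OF field_differentiable_derivI[OF P]]) (auto intro!: derivative_eq_intros)
  then have P2: "(\<lambda>w. ?P (w\<^sup>2)) field_differentiable at w" for w
    using field_differentiable_def by blast
  have n1: "complex_of_real z / 2 \<notin> \<real>\<^sub>\<le>\<^sub>0" using z by (auto simp: complex_nonpos_Reals_iff)
  have n2: "complex_of_real pi / (2 * of_real z) \<notin> \<real>\<^sub>\<le>\<^sub>0"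
  proof -
    have "complex_of_real pi / (2 * of_real z) = of_real (pi / (2 * z))" by simp
    moreover have "pi / (2 * z) > 0" using z pi_gt_zero by (intro divide_pos_pos) auto
    ultimately show ?thesis by (simp only: complex_nonpos_Reals_iff) simp
  qed
  have "((\<lambda>w::complex. (w / 2) powr of_real (l + 1/2)) has_field_derivative
      (of_real (l + 1/2) * (of_real z / 2) powr (of_real (l + 1/2) - 1)) * (1 / 2)) (at (of_real z))"
    by (rule DERIV_chain2[where f = "\<lambda>w::complex. w powr of_real (l + 1/2)" and g = "\<lambda>w. w / 2",
          OF has_field_derivative_powr[OF n1]]) (auto intro!: derivative_eq_intros)
  then have D1: "(\<lambda>w::complex. (w / 2) powr of_real (l + 1/2)) field_differentiable at (of_real z)"
    using field_differentiable_def by blast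
  have "((\<lambda>w. of_real pi / (2 * w)) has_field_derivative - (of_real pi * 2) / (2 * of_real z)\<^sup>2) (at (complex_of_real z))"
    using z by (auto intro!: derivative_eq_intros simp: power2_eq_square)
  then have "((\<lambda>w. csqrt (of_real pi / (2 * w))) has_field_derivative
      inverse (2 * csqrt (of_real pi / (2 * of_real z))) * (- (of_real pi * 2) / (2 * of_real z)\<^sup>2)) (at (complex_of_real z))"
    by (rule DERIV_chain2[where f = csqrt and g = "\<lambda>w. of_real pi / (2 * w)", OF has_field_derivative_csqrt[OF n2]])
  then have D2: "(\<lambda>w. csqrt (of_real pi / (2 * w))) field_differentiable at (of_real z)"
    using field_differentiable_def by blast
  have "(\<lambda>w. ?b w)
      field_differentiable at (of_real z)"
    by (intro field_differentiable_mult field_differentiable_ident field_differentiable_const D1 D2 P2)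
  also have "(\<lambda>w. ?b w)
      = bessel_b l"
    unfolding bessel_b_def spherical_j_def bessel_J_def bessel_J_series[OF l] by (simp add: fun_eq_iff)
  finally show ?thesis .
qed

text \<open>
  The complex derivative of \<open>b\<^sub>l\<close> at a positive point is the derivative along the real axis, where
  \<open>b\<^sub>l\<close> is a power times an even power series and can be differentiated term by term.
\<close>
lemma d_coeff_deriv_bessel_b:
  assumes l: "l \<ge> -1/2" and \<omega>: "\<omega> > 0" and x: "x > 0"
  shows "(\<lambda>k. of_real (\<omega> ^ (2 * k)) *
      of_real ((l + 1 + 2 * real k) / x * (bessel_coeff l k * (x powr (l + 1) * x ^ (2 * k))))) sums
    (d_coeff l (of_real \<omega>) * (of_real \<omega> * deriv (bessel_b l) (of_real \<omega> * of_real x)))"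
proof -
  let ?lhs = "d_coeff l (of_real \<omega>) * (of_real \<omega> * deriv (bessel_b l) (of_real \<omega> * of_real x))"
  define z where "z = \<omega> * x"
  have z: "z > 0" using \<omega> x by (simp add: z_def)
  define P where "P = (\<lambda>y::real. \<Sum>k. bessel_coeff l k * y ^ k)"
  define P' where "P' = (\<lambda>y::real. \<Sum>k. diffs (bessel_coeff l) k * y ^ k)"
  have sm: "summable (\<lambda>k. bessel_coeff l k * y ^ k)" for y :: real
    using bessel_coeff_summable[OF l, of y] by simp
  have dP: "(P has_real_derivative P' y) (at y)" for y
    unfolding P_def P'_def by (rule termdiffs_strong_converges_everywhere) (rule sm)
  define K where "K = sqrt pi / Gamma (l + 3/2)"
  let ?F = "((l + 1) / z * P (z\<^sup>2) + 2 * z * P' (z\<^sup>2))"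
  let ?G = "((l + 1) * P (z\<^sup>2) + 2 * (z\<^sup>2 * P' (z\<^sup>2)))"
  let ?g = "\<lambda>k. complex_of_real (x powr (l + 1) * (((l + 1) * (bessel_coeff l k * (z\<^sup>2) ^ k) + 2 * (real k * (bessel_coeff l k * (z\<^sup>2) ^ k))) / x))"
  define f where "f = (\<lambda>t. K * (t / 2) powr (l + 1) * P (t\<^sup>2))"
  define f' where "f' = K * (z / 2) powr (l + 1) * ?F"
  have dP2: "((\<lambda>t. P (t\<^sup>2)) has_real_derivative P' (z\<^sup>2) * (2 * z)) (at z)"
    by (rule DERIV_chain2[OF dP]) (auto intro!: derivative_eq_intros)
  have "((\<lambda>t. (t / 2) powr (l + 1)) has_real_derivative (l + 1) / z * (z / 2) powr (l + 1)) (at z)"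
  proof -
    have "((\<lambda>t. (t / 2) powr (l + 1)) has_real_derivative (l + 1) * (z / 2) powr (l + 1 - 1) * (1 / 2)) (at z)"
      by (rule DERIV_chain2[where f = "\<lambda>t. t powr (l + 1)" and g = "\<lambda>t. t / 2", OF has_real_derivative_powr])
         (use z in \<open>auto intro!: derivative_eq_intros\<close>)
    moreover have "(l + 1) * (z / 2) powr (l + 1 - 1) * (1 / 2) = (l + 1) / z * (z / 2) powr (l + 1)"
      using z by (simp add: powr_add)
    ultimately show ?thesis by (simp only:)
  qed
  from DERIV_mult[OF DERIV_cmult[OF this, of K] dP2]
  have "(f has_real_derivative f') (at z)"
    unfolding f_def f'_def by (simp add: algebra_simps)
  then have "((\<lambda>t. complex_of_real (f t)) has_vector_derivative of_real f') (at z)"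
    by (intro has_vector_derivative_of_real) (simp add: has_real_derivative_iff_has_vector_derivative)
  moreover have "((\<lambda>t. complex_of_real (f t)) has_vector_derivative deriv (bessel_b l) (of_real z)) (at z)"
  proof (rule has_vector_derivative_transform_within_open[where S = "{0<..}"])
    show "((\<lambda>t. bessel_b l (of_real t)) has_vector_derivative deriv (bessel_b l) (of_real z)) (at z)"
      by (intro has_vector_derivative_real_field field_differentiable_derivI bessel_b_field_differentiable l z)
    show "bessel_b l (of_real t) = of_real (f t)" if "t \<in> {0<..}" for t
      using bessel_b_of_real[OF l, of t] that by (simp only: f_def K_def P_def greaterThan_iff)
  qed (use z in auto)
  ultimately have d: "deriv (bessel_b l) (of_real z) = of_real f'"
    by (rule vector_derivative_unique_at[symmetric])
  have "?lhs =
      d_coeff l (of_real \<omega>) * of_real (K * (\<omega> * x / 2) powr (l + 1) *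
        (\<omega> * ?F))"
    using d unfolding f'_def by (simp add: z_def mult_ac)
  also have "\<dots> = of_real (x powr (l + 1) * (\<omega> * ?F))"
    unfolding K_def by (rule d_coeff_cancel[OF l \<omega> x])
  also have "\<omega> * ?F = ?G / x"
    using \<omega> x by (simp add: z_def field_simps power2_eq_square)
  finally have E: "?lhs =
      of_real (x powr (l + 1) * (?G / x))" .
  have s1: "(\<lambda>k. bessel_coeff l k * (z\<^sup>2) ^ k) sums P (z\<^sup>2)"
    unfolding P_def by (rule summable_sums[OF sm])
  have "(\<lambda>k. diffs (bessel_coeff l) k * (z\<^sup>2) ^ k) sums P' (z\<^sup>2)"
    unfolding P'_def by (rule summable_sums[OF termdiff_converges_all[OF sm]])
  from sums_mult[OF this, of "z\<^sup>2"]
  have "(\<lambda>k. real (Suc k) * (bessel_coeff l (Suc k) * (z\<^sup>2) ^ Suc k)) sums (z\<^sup>2 * P' (z\<^sup>2))"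
    by (simp only: diffs_def power_Suc mult_ac)
  then have s2: "(\<lambda>k. real k * (bessel_coeff l k * (z\<^sup>2) ^ k)) sums (z\<^sup>2 * P' (z\<^sup>2))"
    by (subst (asm) sums_Suc_iff) simp
  have "(\<lambda>k. ?g k) sums
      of_real (x powr (l + 1) * (?G / x))"
    by (intro sums_of_real sums_mult sums_divide sums_add s1 s2)
  moreover have "?g k =
      of_real (\<omega> ^ (2 * k)) * of_real ((l + 1 + 2 * real k) / x * (bessel_coeff l k * (x powr (l + 1) * x ^ (2 * k))))" for k
  proof -
    have "(z\<^sup>2) ^ k = \<omega> ^ (2 * k) * x ^ (2 * k)"
      unfolding z_def by (simp only: power_mult_distrib power_mult)
    then show ?thesis unfolding of_real_mult[symmetric] by (simp only:) (simp add: algebra_simps add_divide_distrib)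
  qed
  ultimately show ?thesis by (simp only: E)
qed

text \<open>
  The expansions are available for small positive \<open>\<omega>\<close> only, so the constant terms are compared in the
  limit \<open>\<omega> \<rightarrow> 0\<close> from the right, and the others after division by powers of \<open>\<omega>\<^sup>2\<close>.
\<close>
lemma even_series_coeff_unique:
  fixes a c :: "nat \<Rightarrow> complex"
  assumes "\<delta> > 0"
    and "\<And>\<omega>. 0 < \<omega> \<Longrightarrow> \<omega> < \<delta> \<Longrightarrow> (\<lambda>k. of_real (\<omega> ^ (2 * k)) * a k) sums S \<omega>"
    and "\<And>\<omega>. 0 < \<omega> \<Longrightarrow> \<omega> < \<delta> \<Longrightarrow> (\<lambda>k. of_real (\<omega> ^ (2 * k)) * c k) sums S \<omega>"
  shows "a k = c k"
proof -
  let ?t = "\<lambda>e s. (\<lambda>k. e k * complex_of_real s ^ k)"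
  have zero0: "e 0 = 0" if d: "d > 0" and S: "\<And>s. 0 < s \<Longrightarrow> s < d \<Longrightarrow> ?t e s sums 0"
    for e :: "nat \<Rightarrow> complex" and d :: real
  proof -
  define f where "f = (\<lambda>z. \<Sum>k. e k * z ^ k)"
  have sf: "(\<lambda>k. e k * z ^ k) sums f z" if z: "norm z < d / 2" for z
  proof -
    have "summable (\<lambda>k. e k * complex_of_real (d / 2) ^ k)"
      using S[of "d / 2"] \<open>d > 0\<close> by (auto simp: sums_iff)
    then have "summable (\<lambda>k. e k * z ^ k)"
      by (rule powser_inside) (use z \<open>d > 0\<close> in auto)
    then show ?thesis unfolding f_def by (rule summable_sums)
  qed
  have "(f \<longlongrightarrow> e 0) (at 0)"
    by (rule powser_limit_0[of "d / 2", OF _ sf]) (use \<open>d > 0\<close> in auto)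
  moreover have "filterlim (\<lambda>s. complex_of_real s) (at 0) (at_right 0)"
    unfolding filterlim_at
    by (auto simp: eventually_at_filter intro!: tendsto_eq_intros)
  ultimately have "((\<lambda>s. f (of_real s)) \<longlongrightarrow> e 0) (at_right 0)"
    by (rule filterlim_compose)
  moreover have "\<forall>\<^sub>F s in at_right 0. f (of_real s) = 0"
  proof -
    have "\<forall>\<^sub>F s in at_right 0. s \<in> {0<..<d / 2}"
      by (rule eventually_at_right_real) (use d in auto)
    then show ?thesis
    proof eventually_elim
      case (elim s)
      then have "?t e s sums f (of_real s)" by (intro sf) auto
      moreover have "?t e s sums 0" using elim d by (intro S) auto
      ultimately show ?case by (rule sums_unique2)
    qed
  qed
  ultimately have "((\<lambda>s. 0) \<longlongrightarrow> e 0) (at_right (0::real))"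
    by (rule Lim_transform_eventually)
  then show ?thesis by (simp add: tendsto_const_iff)
  qed
  have zero: "e k = 0" if "d > 0" "\<And>s. 0 < s \<Longrightarrow> s < d \<Longrightarrow> ?t e s sums 0"
    for e :: "nat \<Rightarrow> complex" and d :: real and k
    using that(2)
  proof (induction k arbitrary: e)
    case 0
    then show ?case by (rule zero0[OF \<open>d > 0\<close>])
  next
    case (Suc k)
    have e0: "e 0 = 0" by (rule zero0[OF \<open>d > 0\<close> Suc.prems])
    show ?case
    proof (rule Suc.IH[of "\<lambda>k. e (Suc k)"])
      fix s assume s: "0 < s" "s < d"
      have "(\<lambda>k. e (Suc k) * complex_of_real s ^ Suc k) sums 0"
        using Suc.prems[OF s] e0 by (subst sums_Suc_iff) simp
      from sums_mult[OF this, of "inverse (of_real s)"]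
      have "(\<lambda>k. inverse (of_real s) * (e (Suc k) * complex_of_real s ^ Suc k)) sums 0" by simp
      moreover have "inverse (of_real s) * (e (Suc k) * complex_of_real s ^ Suc k) = e (Suc k) * of_real s ^ k" for k
        using s by simp
      ultimately show "(\<lambda>k. e (Suc k) * complex_of_real s ^ k) sums 0" by (simp only:)
    qed
  qed
  have "(\<lambda>k. (a k - c k) * complex_of_real s ^ k) sums 0" if s: "0 < s" "s < \<delta>\<^sup>2" for s
  proof -
    have "sqrt s < \<delta>" using s \<open>\<delta> > 0\<close> by (intro real_less_lsqrt) auto
    then have "(\<lambda>k. of_real (sqrt s ^ (2 * k)) * a k - of_real (sqrt s ^ (2 * k)) * c k) sums (S (sqrt s) - S (sqrt s))"
      using s by (intro sums_diff assms(2,3)) auto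
    moreover have "of_real (sqrt s ^ (2 * k)) * a k - of_real (sqrt s ^ (2 * k)) * c k = (a k - c k) * complex_of_real s ^ k" for k
    proof -
      have "sqrt s ^ (2 * k) = s ^ k" using s by (simp only: power_mult) simp
      then have e: "complex_of_real (sqrt s ^ (2 * k)) = of_real s ^ k" by (simp only: of_real_power)
      show ?thesis unfolding e by (simp add: algebra_simps)
    qed
    ultimately show ?thesis by (simp only: diff_self)
  qed
  then have "a k - c k = 0" using zero[of "\<delta>\<^sup>2" "\<lambda>k. a k - c k" k] \<open>\<delta> > 0\<close> by simp
  then show ?thesis by simp
qed

section \<open>The recurrences\<close>

text \<open>
  The weights of \<open>\<rho>\<close>, the common multiple of two neighbouring rows of \<open>nsbf_weight\<close>. Row \<open>m\<close> belongs to
  the step from \<open>m\<close> to \<open>m + 1\<close>; this shift avoids \<open>n - 1\<close>.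
\<close>
definition nsbf_step :: "real \<Rightarrow> nat \<Rightarrow> nat \<Rightarrow> real" where
  "nsbf_step l m k = 4 ^ k * pochhammer (l + 3/2) (m + k) / fact (Suc m - k)"

lemma nsbf_step_mult:
  assumes "k \<le> m"
  shows "(real m + 1 - real k) * nsbf_step l m k = nsbf_weight l m k"
proof -
  obtain d where d: "m = k + d" using assms le_Suc_ex by blast
  show ?thesis unfolding d nsbf_step_def nsbf_weight_def by (simp add: Suc_diff_le divide_simps)
qed

lemma nsbf_step_Suc:
  assumes "k \<le> m"
  shows "nsbf_step l m (Suc k) = 4 * (l + 3/2 + real m + real k) * nsbf_weight l m k"
  using assms by (simp add: nsbf_step_def nsbf_weight_def pochhammer_Suc)

lemma nsbf_weight_Suc:
  assumes "k < m"
  shows "nsbf_weight l m (Suc k) = 4 * (l + 3/2 + real m + real k) * (real m - real k) * nsbf_weight l m k"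
proof -
  have "m - k = Suc (m - Suc k)" using assms by simp
  then have f: "(fact (m - k) :: real) = (real m - real k) * fact (m - Suc k)"
    using assms by (simp only: fact_Suc) (simp add: of_nat_diff)
  have p: "pochhammer (l + 3/2) (m + Suc k) = pochhammer (l + 3/2) (m + k) * (l + 3/2 + real m + real k)"
    by (simp add: pochhammer_Suc add_ac)
  show ?thesis unfolding nsbf_weight_def f p using assms by simp
qed

lemma nsbf_weight_add:
  assumes "k \<le> m"
  shows "nsbf_weight l (Suc m) k + nsbf_weight l m k = (2 * real m + l + 5/2) * nsbf_step l m k"
proof -
  have "nsbf_weight l (Suc m) k = (l + 3/2 + real m + real k) * nsbf_step l m k"
    by (simp add: nsbf_step_def nsbf_weight_def pochhammer_Suc)
  then show ?thesis using nsbf_step_mult[OF assms, of l] by (simp add: algebra_simps)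
qed

lemma nsbf_weight_top:
  "nsbf_weight l (Suc m) (Suc m) = (2 * real m + l + 5/2) * nsbf_step l m (Suc m)"
  by (simp add: nsbf_step_def nsbf_weight_def pochhammer_Suc algebra_simps)

lemma sum_nsbf_weight_add:
  fixes f :: "nat \<Rightarrow> complex"
  shows "(\<Sum>k\<le>Suc m. of_real (nsbf_weight l (Suc m) k) * f k) + (\<Sum>k\<le>m. of_real (nsbf_weight l m k) * f k) =
    of_real (2 * real m + l + 5/2) * (\<Sum>k\<le>Suc m. of_real (nsbf_step l m k) * f k)"
proof -
  define A B D where "A = (\<Sum>k\<le>m. of_real (nsbf_weight l (Suc m) k) * f k)"
    and "B = (\<Sum>k\<le>m. of_real (nsbf_weight l m k) * f k)"
    and "D = (\<Sum>k\<le>m. of_real (nsbf_step l m k) * f k)"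
  have "A + B = (\<Sum>k\<le>m. of_real (nsbf_weight l (Suc m) k + nsbf_weight l m k) * f k)"
    by (simp add: A_def B_def sum.distrib distrib_right)
  also have "\<dots> = (\<Sum>k\<le>m. of_real ((2 * real m + l + 5/2) * nsbf_step l m k) * f k)"
    by (rule sum.cong) (simp_all only: nsbf_weight_add atMost_iff)
  also have "\<dots> = of_real (2 * real m + l + 5/2) * D"
    by (simp only: D_def sum_distrib_left of_real_mult mult.assoc)
  finally have AB: "A + B = of_real (2 * real m + l + 5/2) * D" .
  have "(A + of_real (2 * real m + l + 5/2) * (of_real (nsbf_step l m (Suc m)) * f (Suc m))) + B =
      of_real (2 * real m + l + 5/2) * (D + of_real (nsbf_step l m (Suc m)) * f (Suc m))"
    unfolding distrib_left AB[symmetric] by (simp only: add_ac)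
  then show ?thesis
    unfolding sum.atMost_Suc nsbf_weight_top A_def B_def D_def by (simp only: of_real_mult mult.assoc)
qed

text \<open>
  A Gosper summation: the partial sums over \<open>k < n\<close> are multiples of the next term, with the factor in
  \<open>partial\<close>, and the last term cancels the sum of the others. It is the recurrence for
  \<open>q = 0\<close>, where \<open>\<rho> = 0\<close>.
\<close>
lemma sum_nsbf_step_bessel:
  assumes l: "l \<ge> -1/2"
  shows "(\<Sum>k\<le>Suc m. nsbf_step l m k * bessel_coeff l k) = 0"
proof -
  define t where "t = (\<lambda>k. nsbf_step l m k * bessel_coeff l k)"
  have p: "pochhammer (l + 3/2) k > 0" for k
    using pochhammer_ge_1[of "l + 3/2" k] l by linarith
  have ratio: "(real k + 1) * (l + 3/2 + real k) * t (Suc k) =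
      - ((l + 3/2 + real m + real k) * (real m + 1 - real k) * t k)" if "k \<le> m" for k
  proof -
    have b: "(real k + 1) * (l + 3/2 + real k) * bessel_coeff l (Suc k) = - bessel_coeff l k / 4"
    proof -
      have "l + 3/2 + real k > 0" using l by linarith
      then show ?thesis using p[of k] by (simp add: bessel_coeff_def pochhammer_Suc divide_simps)
    qed
    have "(real k + 1) * (l + 3/2 + real k) * t (Suc k) =
        nsbf_step l m (Suc k) * ((real k + 1) * (l + 3/2 + real k) * bessel_coeff l (Suc k))"
      by (simp add: t_def mult_ac)
    also have "\<dots> = - ((l + 3/2 + real m + real k) * nsbf_weight l m k * bessel_coeff l k)"
      unfolding b nsbf_step_Suc[OF that] by simp
    also have "nsbf_weight l m k = (real m + 1 - real k) * nsbf_step l m k"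
      using nsbf_step_mult[OF that] by simp
    finally show ?thesis by (simp add: t_def mult_ac)
  qed
  have partial: "(real m + 1) * (l + 3/2 + real m) * (\<Sum>k<n. t k) = - (real n * (l + 1/2 + real n) * t n)"
    if "n \<le> Suc m" for n
    using that
  proof (induction n)
    case (Suc n)
    then have "(real m + 1) * (l + 3/2 + real m) * (\<Sum>k<Suc n. t k) =
        - (real n * (l + 1/2 + real n) * t n) + (real m + 1) * (l + 3/2 + real m) * t n"
      by (simp add: distrib_left)
    also have "\<dots> = (l + 3/2 + real m + real n) * (real m + 1 - real n) * t n"
    proof -
      have "(y + 1) * (a + y) - z * (a - 1 + z) = (a + y + z) * (y + 1 - z)" for a y z :: real
        by (simp add: algebra_simps)
      note this[of "real m" "l + 3/2" "real n"]
      moreover have "l + 3/2 - 1 + real n = l + 1/2 + real n" by simp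
      ultimately have "(l + 3/2 + real m + real n) * (real m + 1 - real n) =
          (real m + 1) * (l + 3/2 + real m) - real n * (l + 1/2 + real n)"
        by (simp only:)
      then show ?thesis by (simp only: left_diff_distrib)
    qed
    also have "\<dots> = - (real (Suc n) * (l + 1/2 + real (Suc n)) * t (Suc n))"
      using ratio[of n] Suc.prems by (simp add: algebra_simps)
    finally show ?case .
  qed simp
  have "(real m + 1) * (l + 3/2 + real m) * (\<Sum>k\<le>Suc m. t k) =
      (real m + 1) * (l + 3/2 + real m) * (\<Sum>k<Suc m. t k) + (real m + 1) * (l + 3/2 + real m) * t (Suc m)"
    by (simp only: lessThan_Suc_atMost sum.atMost_Suc distrib_left)
  also have "\<dots> = 0" unfolding partial[OF order_refl] by (simp add: algebra_simps)
  finally have "(real m + 1) * (l + 3/2 + real m) * (\<Sum>k\<le>Suc m. t k) = 0" .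
  moreover have "(real m + 1) * (l + 3/2 + real m) \<noteq> 0" using l by auto
  ultimately show ?thesis unfolding t_def by simp
qed

lemma sum_nsbf_weight_bessel:
  assumes l: "l \<ge> -1/2"
  shows "(\<Sum>k\<le>n. nsbf_weight l n k * bessel_coeff l k) = (-1) ^ n"
proof (induction n)
  case 0
  then show ?case by (simp add: nsbf_weight_def bessel_coeff_def)
next
  case (Suc m)
  have "complex_of_real ((\<Sum>k\<le>Suc m. nsbf_weight l (Suc m) k * bessel_coeff l k) + (\<Sum>k\<le>m. nsbf_weight l m k * bessel_coeff l k)) =
      of_real ((2 * real m + l + 5/2) * (\<Sum>k\<le>Suc m. nsbf_step l m k * bessel_coeff l k))"
    using sum_nsbf_weight_add[of l m "\<lambda>k. of_real (bessel_coeff l k)"] by (simp del: sum.atMost_Suc)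
  then have "(\<Sum>k\<le>Suc m. nsbf_weight l (Suc m) k * bessel_coeff l k) + (\<Sum>k\<le>m. nsbf_weight l m k * bessel_coeff l k) = 0"
    unfolding sum_nsbf_step_bessel[OF l] by (simp only: of_real_eq_iff mult_zero_right)
  then show ?case using Suc.IH by simp
qed

lemma sum_nsbf_step_bessel_deriv:
  assumes l: "l \<ge> -1/2"
  shows "(\<Sum>k\<le>Suc m. nsbf_step l m k * ((l + 1 + 2 * real k) * bessel_coeff l k)) = - 2 * (-1) ^ m"
proof -
  let ?S = "(\<Sum>k\<le>Suc m. (real m + 1 - real k) * nsbf_step l m k * bessel_coeff l k)"
  have "(\<Sum>k\<le>Suc m. nsbf_step l m k * ((l + 1 + 2 * real k) * bessel_coeff l k)) =
      (\<Sum>k\<le>Suc m. (l + 3 + 2 * real m) * (nsbf_step l m k * bessel_coeff l k) -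
        2 * ((real m + 1 - real k) * nsbf_step l m k * bessel_coeff l k))"
    by (rule sum.cong) (simp_all add: algebra_simps)
  also have "\<dots> = (l + 3 + 2 * real m) * 0 - 2 * ?S"
    by (simp only: sum_subtractf sum_distrib_left[symmetric] sum_nsbf_step_bessel[OF l])
  also have "?S =
      (\<Sum>k\<le>m. nsbf_weight l m k * bessel_coeff l k)"
    by (simp add: nsbf_step_mult)
  finally show ?thesis by (simp add: sum_nsbf_weight_bessel[OF l])
qed

lemma has_vector_derivative_of_real_powr:
  assumes "x > 0"
  shows "((\<lambda>x. complex_of_real (c * x powr a)) has_vector_derivative of_real (c * (a * x powr (a - 1)))) (at x within S)"
proof (rule has_vector_derivative_of_real)
  show "((\<lambda>x. c * x powr a) has_real_derivative c * (a * x powr (a - 1))) (at x within S)"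
    by (intro DERIV_cmult has_field_derivative_at_within[OF has_real_derivative_powr] assms)
qed

lemma powr_bounded_of_real_powr: "powr_bounded b (\<lambda>x. of_real (c * x powr a)) a"
  using powr_bounded_cmult[OF powr_bounded_powr, of b "of_real c" a] by simp

context zero_energy_solution
begin

text \<open>
  \<open>Ahat n\<close> is \<open>\<beta>\<^sub>n / (4n+2l+3) + (-1)\<^sup>n\<close> and \<open>Ahat'\<close> its derivative. The factors \<open>1 *\<close> here and below
  match the rule for \<open>c * x powr a\<close>.
\<close>
definition Ahat :: "nat \<Rightarrow> real \<Rightarrow> complex" where
  "Ahat n x = (\<Sum>k\<le>n. of_real (nsbf_weight l n k) * (of_real (1 * x powr (- l - 1 - 2 * real k)) * (v x * r k x)))"

definition Ahat' :: "nat \<Rightarrow> real \<Rightarrow> complex" where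
  "Ahat' n x = (\<Sum>k\<le>n. of_real (nsbf_weight l n k) *
     (of_real (x powr (- l - 1 - 2 * real k)) * (v' x * r k x + W k x / v x) +
      of_real ((- l - 1 - 2 * real k) * x powr (- l - 2 - 2 * real k)) * (v x * r k x)))"

definition rho :: "nat \<Rightarrow> real \<Rightarrow> complex" where
  "rho m x = (\<Sum>k\<le>Suc m. of_real (nsbf_step l m k) * (of_real (1 * x powr (2 * real m + 2 - 2 * real k)) * r k x))"

text \<open>
  This is \<open>v\<^sup>2 \<rho>'\<close> (lemma \<open>rho_deriv\<close>), written with \<open>W\<^sub>k\<^sub>+\<^sub>1\<close> in place of \<open>W\<^sub>k\<close>: the derivative
  \<open>-v\<^sup>2 r\<^sub>k\<close> of \<open>W\<^sub>k\<^sub>+\<^sub>1\<close> then carries the same index as the other terms.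
\<close>
definition V :: "nat \<Rightarrow> real \<Rightarrow> complex" where
  "V m x = (\<Sum>k\<le>m. of_real (nsbf_weight l m k) *
     (of_real (2 * x powr (2 * real m + 1 - 2 * real k)) * ((v x)\<^sup>2 * r k x) +
      of_real (4 * (l + 3/2 + real m + real k) * x powr (2 * real m - 2 * real k)) * W (Suc k) x))"

lemma vr_deriv:
  assumes x: "x \<in> {0<..b}"
  shows "((\<lambda>x. v x * r k x) has_vector_derivative v' x * r k x + W k x / v x) (at x within {0<..b})"
proof -
  have "((\<lambda>x. v x * r k x) has_vector_derivative v x * (W k x / (v x)\<^sup>2) + v' x * r k x) (at x within {0<..b})"
    by (intro has_vector_derivative_mult v_deriv r_deriv x)
  also have "v x * (W k x / (v x)\<^sup>2) + v' x * r k x = v' x * r k x + W k x / v x"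
    using v_nonzero[OF x] by (simp add: power2_eq_square)
  finally show ?thesis .
qed

lemma Ahat_deriv:
  assumes x: "x \<in> {0<..b}"
  shows "(Ahat n has_vector_derivative Ahat' n x) (at x within {0<..b})"
proof -
  have x0: "x > 0" using x by simp
  let ?A = "\<Sum>k\<le>n. of_real (nsbf_weight l n k) *
     (of_real (1 * x powr (- l - 1 - 2 * real k)) * (v' x * r k x + W k x / v x) +
      of_real (1 * ((- l - 1 - 2 * real k) * x powr (- l - 1 - 2 * real k - 1))) * (v x * r k x))"
  have "(Ahat n has_vector_derivative ?A) (at x within {0<..b})"
    unfolding Ahat_def
    by (intro has_vector_derivative_sum has_vector_derivative_mult_right has_vector_derivative_mult
        has_vector_derivative_of_real_powr vr_deriv x x0)
  also have "?A = Ahat' n x"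
  proof -
    have "- l - 1 - 2 * real k - 1 = - l - 2 - 2 * real k" for k by simp
    then show ?thesis unfolding Ahat'_def by (simp only: mult_1)
  qed
  finally show ?thesis .
qed

lemma V_eq:
  "V m x = (\<Sum>k\<le>m. of_real (2 * nsbf_weight l m k * x powr (2 * real m + 1 - 2 * real k)) * ((v x)\<^sup>2 * r k x)) +
    (\<Sum>k\<le>Suc m. of_real (nsbf_step l m k * x powr (2 * real m + 2 - 2 * real k)) * W k x)"
proof -
  let ?e = "\<lambda>k. x powr (2 * real m - 2 * real k)"
  let ?t = "\<lambda>k. of_real (nsbf_weight l m k) * (of_real (4 * (l + 3/2 + real m + real k) * ?e k) * W (Suc k) x)"
  have "(\<Sum>k\<le>Suc m. of_real (nsbf_step l m k * x powr (2 * real m + 2 - 2 * real k)) * W k x) =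
      (\<Sum>k\<le>m. of_real (nsbf_step l m (Suc k) * x powr (2 * real m + 2 - 2 * real (Suc k))) * W (Suc k) x)"
    by (subst sum.atMost_Suc_shift) simp
  also have "\<dots> = (\<Sum>k\<le>m. ?t k)"
  proof (rule sum.cong)
    fix k assume "k \<in> {..m}"
    then have k: "k \<le> m" by simp
    have e: "2 * real m + 2 - 2 * real (Suc k) = 2 * real m - 2 * real k" by simp
    show "of_real (nsbf_step l m (Suc k) * x powr (2 * real m + 2 - 2 * real (Suc k))) * W (Suc k) x =
        ?t k"
      unfolding e nsbf_step_Suc[OF k] by (simp only: of_real_mult mult_ac)
  qed simp
  finally show ?thesis unfolding V_def by (simp only: distrib_left sum.distrib of_real_mult mult_ac)
qed

lemma rho_deriv:
  assumes x: "x \<in> {0<..b}"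
  shows "(rho m has_vector_derivative V m x / (v x)\<^sup>2) (at x within {0<..b})"
proof -
  have x0: "x > 0" using x by simp
  let ?e = "\<lambda>k. 2 * real m + 2 - 2 * real k"
  let ?a = "\<lambda>k. of_real (nsbf_step l m k) * (of_real (1 * x powr ?e k) * (W k x / (v x)\<^sup>2) + of_real (1 * (?e k * x powr (?e k - 1))) * r k x)"
  let ?b = "\<lambda>k. of_real (2 * nsbf_weight l m k * x powr (2 * real m + 1 - 2 * real k)) * ((v x)\<^sup>2 * r k x)"
  let ?c = "\<lambda>k. of_real (nsbf_step l m k * (?e k * x powr (?e k - 1))) * r k x"
  let ?d = "\<lambda>k. of_real (nsbf_step l m k * x powr ?e k) * W k x"
  have "(rho m has_vector_derivative (\<Sum>k\<le>Suc m. ?a k)) (at x within {0<..b})"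
    unfolding rho_def
    by (intro has_vector_derivative_sum has_vector_derivative_mult_right has_vector_derivative_mult
        has_vector_derivative_of_real_powr r_deriv x x0)
  also have "(\<Sum>k\<le>Suc m. ?a k) =
      (\<Sum>k\<le>Suc m. ?d k) / (v x)\<^sup>2 +
      (\<Sum>k\<le>Suc m. ?c k)"
    by (simp only: distrib_left sum.distrib sum_divide_distrib of_real_mult mult_1 mult.assoc times_divide_eq_right)
  also have "(\<Sum>k\<le>Suc m. ?c k) =
      (\<Sum>k\<le>m. ?b k) / (v x)\<^sup>2"
  proof -
    have "(\<Sum>k\<le>Suc m. ?c k) =
        (\<Sum>k\<le>m. ?c k)"
      by simp
    also have "\<dots> = (\<Sum>k\<le>m. (?b k) / (v x)\<^sup>2)"
    proof (rule sum.cong)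
      fix k assume "k \<in> {..m}"
      then have k: "k \<le> m" by simp
      have e: "?e k - 1 = 2 * real m + 1 - 2 * real k" by simp
      have "nsbf_step l m k * (?e k * x powr (?e k - 1)) = 2 * nsbf_weight l m k * x powr (2 * real m + 1 - 2 * real k)"
        unfolding e nsbf_step_mult[OF k, symmetric] by (simp add: algebra_simps)
      then show "?c k =
          (?b k) / (v x)\<^sup>2"
        using v_nonzero[OF x] by (simp only:) simp
    qed simp
    finally show ?thesis by (simp only: sum_divide_distrib)
  qed
  also have "(\<Sum>k\<le>Suc m. ?d k) / (v x)\<^sup>2 +
      (\<Sum>k\<le>m. ?b k) / (v x)\<^sup>2 =
      V m x / (v x)\<^sup>2"
    unfolding V_eq by (simp only: add_divide_distrib add.commute)
  finally show ?thesis .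
qed

text \<open>
  The terms with \<open>r\<^sub>k\<close> agree for each \<open>k\<close>, those with \<open>W\<^sub>k\<close> only after summation: the difference is
  \<open>T\<^sub>k\<^sub>+\<^sub>1 - T\<^sub>k\<close>, which telescopes to \<open>0\<close>.
\<close>
lemma V_deriv:
  assumes x: "x \<in> {0<..b}"
  shows "(V m has_vector_derivative 4 * v x * of_real (x powr (2 * real m + 2 + l)) * Ahat' m x) (at x within {0<..b})"
proof -
  have x0: "x > 0" using x by simp
  let ?L = "\<lambda>k. l + 3/2 + real m + real k"
  let ?e = "\<lambda>k. 2 * real m - 2 * real k"
  let ?d = "\<lambda>k. 2 * real m + 1 - 2 * real k"
  let ?raw = "\<lambda>k. of_real (nsbf_weight l m k) *
     ((of_real (2 * x powr ?d k) * ((v x)\<^sup>2 * (W k x / (v x)\<^sup>2) + (v x * v' x + v' x * v x) * r k x) +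
       of_real (2 * (?d k * x powr (?d k - 1))) * ((v x)\<^sup>2 * r k x)) +
      (of_real (4 * ?L k * x powr ?e k) * (- (v x)\<^sup>2 * r k x) +
       of_real (4 * ?L k * (?e k * x powr (?e k - 1))) * W (Suc k) x))"
  let ?target = "\<lambda>k. 4 * v x * of_real (x powr (2 * real m + 2 + l)) * (of_real (nsbf_weight l m k) *
     (of_real (x powr (- l - 1 - 2 * real k)) * (v' x * r k x + W k x / v x) +
      of_real ((- l - 1 - 2 * real k) * x powr (- l - 2 - 2 * real k)) * (v x * r k x)))"
  have v2: "((\<lambda>x. (v x)\<^sup>2) has_vector_derivative v x * v' x + v' x * v x) (at x within {0<..b})"
    unfolding power2_eq_square by (intro has_vector_derivative_mult v_deriv x)
  have WS: "(W (Suc k) has_vector_derivative - (v x)\<^sup>2 * r k x) (at x within {0<..b})" for k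
    using W_deriv[OF x, of "Suc k"] by simp
  have D: "(V m has_vector_derivative (\<Sum>k\<le>m. ?raw k)) (at x within {0<..b})"
    unfolding V_def
    by (intro has_vector_derivative_sum has_vector_derivative_mult_right has_vector_derivative_add has_vector_derivative_mult
        has_vector_derivative_of_real_powr r_deriv v2 WS x x0)
  \<comment> \<open>For \<open>k = m + 1\<close> the natural definition has the factor \<open>?e m = 0\<close>.\<close>
  define T where "T = (\<lambda>k. if k \<le> m then of_real (2 * nsbf_weight l m k * x powr ?d k) * W k x else 0)"
  have step: "?raw k =
     ?target k +
     (T (Suc k) - T k)" if k: "k \<le> m" for k
  proof -
    have T: "T (Suc k) = of_real (nsbf_weight l m k) * (of_real (4 * ?L k * (?e k * x powr (?e k - 1))) * W (Suc k) x)"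
    proof (cases "k < m")
      case True
      have e: "?d (Suc k) = ?e k - 1" by simp
      have "2 * nsbf_weight l m (Suc k) * x powr ?d (Suc k) = nsbf_weight l m k * (4 * ?L k * (?e k * x powr (?e k - 1)))"
        unfolding e nsbf_weight_Suc[OF True] by (simp add: algebra_simps)
      then show ?thesis using True unfolding T_def by (simp only:) simp
    next
      case False
      then have "k = m" using k by simp
      then show ?thesis by (simp add: T_def)
    qed
    have Tk: "T k = of_real (nsbf_weight l m k) * (of_real (2 * x powr ?d k) * W k x)"
      using k unfolding T_def by simp
    define X Y where "X = x powr ?e k" and "Y = x powr ?d k"
    have pe: "x powr (2 * real m + 2 + l) * x powr (- l - 1 - 2 * real k) = Y"
      "x powr (2 * real m + 2 + l) * x powr (- l - 2 - 2 * real k) = X" "x powr (?d k - 1) = X"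
      unfolding X_def Y_def powr_add[symmetric] by (rule arg_cong[where f = "(powr) x"], simp)+
    have "?target k =
      of_real (nsbf_weight l m k) * (4 * of_real (x powr (2 * real m + 2 + l) * x powr (- l - 1 - 2 * real k)) * (v x * v' x * r k x + v x * (W k x / v x)) +
        4 * of_real ((- l - 1 - 2 * real k) * (x powr (2 * real m + 2 + l) * x powr (- l - 2 - 2 * real k))) * ((v x)\<^sup>2 * r k x))"
      by (simp add: algebra_simps power2_eq_square)
    also have "\<dots> = of_real (nsbf_weight l m k) * (4 * of_real Y * (v x * v' x * r k x + W k x) +
        4 * of_real ((- l - 1 - 2 * real k) * X) * ((v x)\<^sup>2 * r k x))"
      unfolding pe using v_nonzero[OF x] by simp
    finally have R: "?target k =
      of_real (nsbf_weight l m k) * (4 * of_real Y * (v x * v' x * r k x + W k x) +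
        4 * of_real ((- l - 1 - 2 * real k) * X) * ((v x)\<^sup>2 * r k x))" .
    have c: "4 * of_real ((- l - 1 - 2 * real k) * X) = of_real (2 * (?d k * X)) - complex_of_real (4 * ?L k * X)"
      by (simp add: algebra_simps)
    have vv: "(v x)\<^sup>2 * (W k x / (v x)\<^sup>2) = W k x" using v_nonzero[OF x] by simp
    show ?thesis
      unfolding R T Tk pe X_def[symmetric] Y_def[symmetric] c vv by (simp add: algebra_simps)
  qed
  have tel: "(\<Sum>k\<le>m. T (Suc k) - T k) = 0"
    unfolding lessThan_Suc_atMost[symmetric] sum_lessThan_telescope by (simp add: T_def)
  note D
  also have "(\<Sum>k\<le>m. ?raw k) =
     (\<Sum>k\<le>m. ?target k +
     (T (Suc k) - T k))"
    by (rule sum.cong[OF refl], rule step) simp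
  also have "\<dots> = 4 * v x * of_real (x powr (2 * real m + 2 + l)) * Ahat' m x"
    unfolding sum.distrib tel Ahat'_def sum_distrib_left by simp
  finally show ?thesis .
qed

lemma Ahat_bounded: "powr_bounded b (Ahat n) 0"
  unfolding Ahat_def
proof (intro powr_bounded_sum powr_bounded_cmult)
  show "powr_bounded b (\<lambda>x. of_real (1 * x powr (- l - 1 - 2 * real k)) * (v x * r k x)) 0" for k
    using powr_bounded_mult[OF powr_bounded_of_real_powr[of b 1 "- l - 1 - 2 * real k"]
        powr_bounded_mult[OF v_bounded r_bounded[of k]]] by simp
qed

lemma V_bounded: "powr_bounded b (V m) (2 * real m + 2 * l + 3)"
  unfolding V_def
proof (intro powr_bounded_sum powr_bounded_cmult powr_bounded_add)
  fix k
  have "2 * real m + 1 - 2 * real k + (2 * l + 2 + 2 * real k) = 2 * real m + 2 * l + 3" by simp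
  with powr_bounded_mult[OF powr_bounded_of_real_powr[of b 2 "2 * real m + 1 - 2 * real k"]
      powr_bounded_mult[OF v2_bounded r_bounded[of k]]]
  show "powr_bounded b (\<lambda>x. of_real (2 * x powr (2 * real m + 1 - 2 * real k)) * ((v x)\<^sup>2 * r k x)) (2 * real m + 2 * l + 3)"
    by (simp only:)
  have "2 * real m - 2 * real k + (2 * l + 1 + 2 * real (Suc k)) = 2 * real m + 2 * l + 3" by simp
  with powr_bounded_mult[OF powr_bounded_of_real_powr[of b "4 * (l + 3/2 + real m + real k)" "2 * real m - 2 * real k"]
      W_bounded[of "Suc k"]]
  show "powr_bounded b (\<lambda>x. of_real (4 * (l + 3/2 + real m + real k) * x powr (2 * real m - 2 * real k)) * W (Suc k) x)
      (2 * real m + 2 * l + 3)"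
    by (simp only:)
qed

lemma rho_bounded: "powr_bounded b (rho m) (2 * real m + 2)"
  unfolding rho_def
proof (intro powr_bounded_sum powr_bounded_cmult)
  fix k
  have "2 * real m + 2 - 2 * real k + 2 * real k = 2 * real m + 2" by simp
  with powr_bounded_mult[OF powr_bounded_of_real_powr[of b 1 "2 * real m + 2 - 2 * real k"] r_bounded[of k]]
  show "powr_bounded b (\<lambda>x. of_real (1 * x powr (2 * real m + 2 - 2 * real k)) * r k x) (2 * real m + 2)"
    by (simp only:)
qed

text \<open>
  \<open>Ahat\<close> with the coefficients \<open>\<phi>'\<^sub>k\<close> of \<open>u'\<close> instead of \<open>\<phi>\<^sub>k\<close>.
\<close>
definition Chat :: "nat \<Rightarrow> real \<Rightarrow> complex" where
  "Chat n x = (\<Sum>k\<le>n. of_real (nsbf_weight l n k) * (of_real (1 * x powr (- l - 1 - 2 * real k)) * (v' x * r k x + W k x / v x)))"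

definition bessel_deriv_sum :: "nat \<Rightarrow> real" where
  "bessel_deriv_sum n = (\<Sum>k\<le>n. nsbf_weight l n k * ((l + 1 + 2 * real k) * bessel_coeff l k))"

lemma bessel_deriv_sum_Suc_add:
  "bessel_deriv_sum (Suc m) + bessel_deriv_sum m = (2 * real m + l + 5/2) * (- 2 * (-1) ^ m)"
proof -
  have "complex_of_real (bessel_deriv_sum (Suc m) + bessel_deriv_sum m) =
      of_real ((2 * real m + l + 5/2) * (\<Sum>k\<le>Suc m. nsbf_step l m k * ((l + 1 + 2 * real k) * bessel_coeff l k)))"
    unfolding bessel_deriv_sum_def
    using sum_nsbf_weight_add[of l m "\<lambda>k. of_real ((l + 1 + 2 * real k) * bessel_coeff l k)"]
    by (simp only: of_real_add of_real_sum of_real_mult)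
  then show ?thesis unfolding sum_nsbf_step_bessel_deriv[OF l] by (simp only: of_real_eq_iff)
qed

text \<open>
  Compared with \<open>Ahat_Suc_add\<close>, the product rule for \<open>v \<rho>\<close> contributes the derivatives of the powers
  \<open>x\<^bsup>2m+2-2k\<^esup>\<close>; the identity \<open>(m + 1 - k) step = weight\<close> sums them up to \<open>Ahat m\<close>.
\<close>
lemma Chat_Suc_add:
  assumes x: "x \<in> {0<..b}"
  shows "Chat (Suc m) x + Chat m x =
    of_real (2 * real m + l + 5/2) * ((v' x * rho m x + V m x / v x) / of_real (x powr (2 * real m + l + 3)) -
      2 * Ahat m x / of_real x)"
proof -
  have x0: "x > 0" using x by simp
  let ?X = "x powr (2 * real m + l + 3)"
  let ?e = "\<lambda>k. x powr (2 * real m + 2 - 2 * real k)"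
  let ?d = "\<lambda>k. x powr (2 * real m + 1 - 2 * real k)"
  let ?p = "\<lambda>k. x powr (- l - 1 - 2 * real k)"
  let ?w = "\<lambda>k. of_real (nsbf_step l m k)"
  define S where "S = (\<Sum>k\<le>Suc m. of_real (nsbf_step l m k * ?e k) * W k x)"
  have "(\<Sum>k\<le>m. of_real (2 * nsbf_weight l m k * ?d k) * ((v x)\<^sup>2 * r k x)) =
      2 * of_real (?X / x) * v x * Ahat m x"
    unfolding Ahat_def sum_distrib_left
  proof (rule sum.cong)
    fix k
    have "?X * ?p k = ?e k"
      unfolding powr_add[symmetric] by (rule arg_cong[where f = "(powr) x"]) simp
    also have "\<dots> = x * ?d k"
      using powr_mult_base[of x "2 * real m + 1 - 2 * real k"] x0 by (simp add: algebra_simps)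
    finally have e: "?d k = ?X / x * ?p k"
      using x0 by (simp add: field_simps)
    show "of_real (2 * nsbf_weight l m k * ?d k) * ((v x)\<^sup>2 * r k x) =
        2 * of_real (?X / x) * v x * (of_real (nsbf_weight l m k) * (of_real (1 * ?p k) * (v x * r k x)))"
      unfolding e by (simp add: power2_eq_square mult_ac)
  qed simp
  then have V: "V m x = 2 * of_real (?X / x) * v x * Ahat m x + S"
    unfolding V_eq S_def by (simp only:)
  have "(\<Sum>k\<le>Suc m. ?w k * (of_real (1 * ?p k) * (v' x * r k x + W k x / v x))) =
      (v' x * rho m x + S / v x) / of_real ?X"
  proof -
    have "?w k * (of_real (1 * ?p k) * (v' x * r k x + W k x / v x)) =
        v' x * (?w k * (of_real (1 * ?e k) * r k x)) / of_real ?X +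
        of_real (nsbf_step l m k * ?e k) * W k x / v x / of_real ?X" for k
    proof -
      have e: "?p k = ?e k / ?X"
        unfolding powr_diff[symmetric] by (rule arg_cong[where f = "(powr) x"]) simp
      show ?thesis unfolding e using x0 by (simp add: add_divide_distrib algebra_simps)
    qed
    then show ?thesis
      unfolding rho_def S_def
      by (simp only: sum.distrib sum_divide_distrib[symmetric] sum_distrib_left[symmetric] add_divide_distrib[symmetric])
  qed
  then have "Chat (Suc m) x + Chat m x = of_real (2 * real m + l + 5/2) * ((v' x * rho m x + S / v x) / of_real ?X)"
    unfolding Chat_def sum_nsbf_weight_add by (simp only:)
  moreover have "V m x / v x / of_real ?X = S / v x / of_real ?X + 2 * Ahat m x / of_real x"
    unfolding V using x0 v_nonzero[OF x] by (simp add: add_divide_distrib)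
  ultimately show ?thesis by (simp only: add_divide_distrib) simp
qed

lemma Ahat_Suc_add:
  assumes x: "x \<in> {0<..b}"
  shows "Ahat (Suc m) x + Ahat m x =
    of_real ((2 * real m + l + 5/2) / x powr (2 * real m + l + 3)) * (v x * rho m x)"
proof -
  let ?t = "\<lambda>k. of_real (nsbf_step l m k) * (of_real (1 * x powr (- l - 1 - 2 * real k)) * (v x * r k x))"
  let ?X = "x powr (2 * real m + l + 3)"
  have "Ahat (Suc m) x + Ahat m x = of_real (2 * real m + l + 5/2) *
      (\<Sum>k\<le>Suc m. ?t k)"
    unfolding Ahat_def by (rule sum_nsbf_weight_add)
  also have "(\<Sum>k\<le>Suc m. ?t k) =
      of_real (1 / ?X) * (v x * rho m x)"
    unfolding rho_def sum_distrib_left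
  proof (rule sum.cong)
    fix k
    have "x powr (- l - 1 - 2 * real k) = 1 / ?X * x powr (2 * real m + 2 - 2 * real k)"
      by (simp flip: powr_diff) (rule arg_cong[where f = "(powr) x"], simp)
    then show "?t k =
        of_real (1 / ?X) *
        (v x * (of_real (nsbf_step l m k) * (of_real (1 * x powr (2 * real m + 2 - 2 * real k)) * r k x)))"
      by (simp only: of_real_mult mult_1) (simp only: mult_ac)
  qed simp
  finally show ?thesis by simp
qed

context
  fixes B :: "nat \<Rightarrow> real \<Rightarrow> complex"
  assumes v'_bounded: "powr_bounded b v' (- 1/2)"
    and B: "\<And>n x. x \<in> {0<..b} \<Longrightarrow> B n x = of_real (4 * real n + 2 * l + 3) * (Ahat n x - (- 1) ^ n)"
begin

lemma eta_integrand_eq: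
  assumes x: "x \<in> {0<..b}"
  shows "eta_integrand l v v' B (Suc m) x =
    (of_real x * v' x + of_real (2 * real m + 2 + l) * v x) * of_real (x powr (2 * real m + 1 + l)) *
    (of_real (4 * real m + 2 * l + 3) * (Ahat m x - (- 1) ^ m))"
proof -
  have "2 * real (Suc m) + l - 1 = 2 * real m + 1 + l" "2 * real (Suc m) + l = 2 * real m + 2 + l" by auto
  then show ?thesis unfolding eta_integrand_def by (simp only: B[OF x] diff_Suc_1)
qed

lemma Ahat_cont: "continuous_on {0<..b} (Ahat n)"
  using Ahat_deriv by (rule continuous_on_vector_derivative)

lemma eta_integrand_cont: "continuous_on {0<..b} (eta_integrand l v v' B (Suc m))"
proof (rule continuous_on_eq)
  show "continuous_on {0<..b} (\<lambda>x. (of_real x * v' x + of_real (2 * real m + 2 + l) * v x) *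
      of_real (x powr (2 * real m + 1 + l)) * (of_real (4 * real m + 2 * l + 3) * (Ahat m x - (- 1) ^ m)))"
    by (intro continuous_intros v_cont v'_cont Ahat_cont powr_cont)
qed (simp only: eta_integrand_eq)

lemma Ahat_shift_bounded: "powr_bounded b (\<lambda>x. Ahat m x - (- 1) ^ m) 0"
  by (intro powr_bounded_diff Ahat_bounded powr_bounded_const)

lemma eta_integrand_bounded: "powr_bounded b (eta_integrand l v v' B (Suc m)) (2 * real m + l + 3/2)"
proof (rule powr_bounded_cong)
  have 1: "powr_bounded b (\<lambda>x. of_real x) 1"
    by (rule powr_bounded_cong[OF _ powr_bounded_powr]) simp
  have "powr_bounded b (\<lambda>x. of_real x * v' x + of_real (2 * real m + 2 + l) * v x) (1/2)"
  proof (intro powr_bounded_add powr_bounded_cmult)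
    show "powr_bounded b (\<lambda>x. of_real x * v' x) (1/2)"
      using powr_bounded_mult[OF 1 v'_bounded] by simp
    show "powr_bounded b v (1/2)"
      by (rule powr_bounded_mono[OF v_bounded]) (use l in simp)
  qed
  from powr_bounded_mult[OF powr_bounded_mult[OF this powr_bounded_powr[of b "2 * real m + 1 + l"]]
      powr_bounded_cmult[OF Ahat_shift_bounded, of "of_real (4 * real m + 2 * l + 3)"]]
  show "powr_bounded b (\<lambda>x. (of_real x * v' x + of_real (2 * real m + 2 + l) * v x) * of_real (x powr (2 * real m + 1 + l)) *
    (of_real (4 * real m + 2 * l + 3) * (Ahat m x - (- 1) ^ m))) (2 * real m + l + 3/2)"
    by (simp add: algebra_simps)
qed (simp only: eta_integrand_eq)

lemma eta_exponent_nonneg: "0 \<le> 2 * real m + l + 3/2"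
  using l by simp

lemmas eta_integrand_integrable =
  absolutely_integrable_powr_bound[OF eta_integrand_cont eta_integrand_bounded eta_exponent_nonneg]

text \<open>
  Integration by parts of \<open>V' = 4 v x\<^bsup>2m+2+l\<^esup> Ahat'\<close>. The constant \<open>(-1)\<^sup>m\<close> may be subtracted from \<open>Ahat\<close>
  because only its derivative enters, and this turns \<open>Ahat\<close> into a multiple of \<open>\<beta>\<^sub>m\<close>.
\<close>
lemma eta_eq:
  assumes x: "x \<in> {0<..b}"
  shows "eta l v v' B (Suc m) x = - of_real ((4 * real m + 2 * l + 3) / 4) *
    (V m x - 4 * (v x * (of_real (1 * x powr (2 * real m + 2 + l)) * (Ahat m x - (- 1) ^ m))))"
proof -
  let ?a = "2 * real m + 2 + l"
  let ?F = "\<lambda>x. - of_real ((4 * real m + 2 * l + 3) / 4) *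
    (V m x - 4 * (v x * (of_real (1 * x powr ?a) * (Ahat m x - (- 1) ^ m))))"
  let ?F' = "\<lambda>x. - of_real ((4 * real m + 2 * l + 3) / 4) *
      (4 * v x * of_real (x powr ?a) * Ahat' m x -
        4 * (v x * (of_real (1 * x powr ?a) * (Ahat' m x - 0) + of_real (1 * (?a * x powr (?a - 1))) * (Ahat m x - (- 1) ^ m)) +
             v' x * (of_real (1 * x powr ?a) * (Ahat m x - (- 1) ^ m))))"
  have "prim (eta_integrand l v v' B (Suc m)) x = ?F x"
  proof (rule prim_eqI[OF eta_integrand_cont eta_integrand_bounded eta_exponent_nonneg _ _ x])
    fix x assume x: "x \<in> {0<..b}"
    then have x0: "x > 0" by simp
    have "(?F has_vector_derivative ?F' x) (at x within {0<..b})"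
      by (intro has_vector_derivative_mult_right has_vector_derivative_mult has_vector_derivative_diff
          has_vector_derivative_const has_vector_derivative_of_real_powr V_deriv v_deriv Ahat_deriv x x0)
    also have "?F' x = eta_integrand l v v' B (Suc m) x"
    proof -
      define X where "X = x powr (2 * real m + 1 + l)"
      have e: "?a - 1 = 2 * real m + 1 + l" by simp
      have "x * x powr (2 * real m + 1 + l) = x powr (1 + (2 * real m + 1 + l))"
        using powr_mult_base[of x "2 * real m + 1 + l"] x0 by simp
      also have "x powr (1 + (2 * real m + 1 + l)) = x powr ?a" by (rule arg_cong[where f = "(powr) x"]) simp
      finally have xa: "x powr ?a = x * X" by (simp add: X_def)
      define k a D where "k = complex_of_real ((4 * real m + 2 * l + 3) / 4)"
        and "a = complex_of_real ?a" and "D = Ahat m x - (- 1) ^ m"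
      have k: "complex_of_real (4 * real m + 2 * l + 3) = 4 * k" by (simp add: k_def)
      have "- k * (4 * v x * (of_real x * of_real X) * Ahat' m x -
          4 * (v x * ((of_real x * of_real X) * (Ahat' m x - 0) + (a * of_real X) * D) +
             v' x * ((of_real x * of_real X) * D))) = (of_real x * v' x + a * v x) * of_real X * (4 * k * D)"
        by (simp add: algebra_simps)
      then show ?thesis
        unfolding eta_integrand_eq[OF x] e xa X_def[symmetric] D_def[symmetric] k k_def[symmetric]
          mult_1 of_real_mult a_def[symmetric] by (simp only:)
    qed
    finally show "(?F has_vector_derivative eta_integrand l v v' B (Suc m) x) (at x within {0<..b})" .
  next
    have "powr_bounded b (\<lambda>x. v x * (of_real (1 * x powr ?a) * (Ahat m x - (- 1) ^ m))) (2 * real m + 2 * l + 3)"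
      using powr_bounded_mult[OF v_bounded powr_bounded_mult[OF powr_bounded_of_real_powr[of b 1 ?a] Ahat_shift_bounded[of m]]]
      by (simp add: algebra_simps)
    then have "powr_bounded b ?F (2 * real m + 2 * l + 3)"
      by (intro powr_bounded_cmult powr_bounded_diff V_bounded)
    then show "(?F \<longlongrightarrow> 0) (at_right 0)"
      by (rule powr_bounded_tendsto_0) (use l b in auto)
  qed
  then show ?thesis by (simp only: eta_def prim_def)
qed

lemma theta_integrand_eq:
  assumes x: "x \<in> {0<..b}"
  shows "theta_integrand l v v' B (Suc m) x = - of_real ((4 * real m + 2 * l + 3) / 4) * (V m x / (v x)\<^sup>2)"
proof -
  have e: "2 * real (Suc m) + l = 2 * real m + 2 + l" by simp
  have c: "of_real (4 * real m + 2 * l + 3) = 4 * complex_of_real ((4 * real m + 2 * l + 3) / 4)" by simp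
  show ?thesis
    unfolding theta_integrand_def eta_eq[OF x] e diff_Suc_1 B[OF x] c mult_1
    by (simp add: algebra_simps diff_divide_distrib add_divide_distrib)
qed

lemma theta_integrand_cont: "continuous_on {0<..b} (theta_integrand l v v' B (Suc m))"
proof -
  have "continuous_on {0<..b} (V m)" using V_deriv by (rule continuous_on_vector_derivative)
  then have "continuous_on {0<..b} (\<lambda>x. - of_real ((4 * real m + 2 * l + 3) / 4) * (V m x / (v x)\<^sup>2))"
    using v_nonzero by (intro continuous_intros v_cont) auto
  then show ?thesis by (rule continuous_on_eq) (simp only: theta_integrand_eq)
qed

lemma theta_integrand_bounded: "powr_bounded b (theta_integrand l v v' B (Suc m)) (2 * real m + 1)"
proof (rule powr_bounded_cong)
  have "powr_bounded b (\<lambda>x. V m x * (1 / (v x)\<^sup>2)) (2 * real m + 1)"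
    using powr_bounded_mult[OF V_bounded inverse_v2_bounded, of m] by (simp add: algebra_simps)
  then show "powr_bounded b (\<lambda>x. - of_real ((4 * real m + 2 * l + 3) / 4) * (V m x / (v x)\<^sup>2)) (2 * real m + 1)"
    by (intro powr_bounded_cmult) simp
qed (simp only: theta_integrand_eq)

lemma theta_exponent_nonneg: "0 \<le> 2 * real m + 1"
  by simp

lemmas theta_integrand_integrable =
  absolutely_integrable_powr_bound[OF theta_integrand_cont theta_integrand_bounded theta_exponent_nonneg]

lemma theta_eq:
  assumes x: "x \<in> {0<..b}"
  shows "theta l v v' B (Suc m) x = - of_real ((4 * real m + 2 * l + 3) / 4) * rho m x"
proof -
  have "prim (theta_integrand l v v' B (Suc m)) x = - of_real ((4 * real m + 2 * l + 3) / 4) * rho m x"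
  proof (rule prim_eqI[OF theta_integrand_cont theta_integrand_bounded theta_exponent_nonneg _ _ x])
    fix x assume x: "x \<in> {0<..b}"
    show "((\<lambda>x. - of_real ((4 * real m + 2 * l + 3) / 4) * rho m x) has_vector_derivative
        theta_integrand l v v' B (Suc m) x) (at x within {0<..b})"
      unfolding theta_integrand_eq[OF x] by (intro has_vector_derivative_mult_right rho_deriv x)
  next
    have "powr_bounded b (\<lambda>x. - of_real ((4 * real m + 2 * l + 3) / 4) * rho m x) (2 * real m + 2)"
      by (intro powr_bounded_cmult rho_bounded)
    then show "((\<lambda>x. - of_real ((4 * real m + 2 * l + 3) / 4) * rho m x) \<longlongrightarrow> 0) (at_right 0)"
      by (rule powr_bounded_tendsto_0) (use b in auto)
  qed
  then show ?thesis by (simp only: theta_def prim_def)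
qed

lemma B_0:
  assumes x: "x \<in> {0<..b}"
  shows "B 0 x = of_real (2 * l + 3) * (v x / of_real (x powr (l + 1)) - 1)"
proof -
  have "x powr (- l - 1) = 1 / x powr (l + 1)" by (simp add: powr_minus_divide[symmetric])
  then show ?thesis unfolding B[OF x] by (simp add: Ahat_def nsbf_weight_def)
qed

lemma B_Suc:
  assumes x: "x \<in> {0<..b}"
  shows "B (Suc m) x = - of_real ((4 * real m + 2 * l + 7) / (4 * real m + 2 * l + 3)) *
    (B m x + of_real (2 * (4 * real m + 2 * l + 5)) * v x * theta l v v' B (Suc m) x / of_real (x powr (2 * real m + l + 3)))"
proof -
  define c where "c = 4 * real m + 2 * l + 3"
  have c: "c > 0" using l by (simp add: c_def)
  define X where "X = x powr (2 * real m + l + 3)"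
  have X: "X > 0" using x by (simp add: X_def)
  have A: "Ahat (Suc m) x = of_real (((c + 2) / 2) / X) * (v x * rho m x) - Ahat m x"
  proof -
    have "2 * real m + l + 5/2 = (c + 2) / 2" by (simp add: c_def)
    then show ?thesis using Ahat_Suc_add[OF x, of m] unfolding X_def by (simp only: eq_diff_eq)
  qed
  have e: "4 * real (Suc m) + 2 * l + 3 = c + 4" "4 * real m + 2 * l + 7 = c + 4" "4 * real m + 2 * l + 5 = c + 2"
    by (auto simp: c_def)
  show ?thesis
    unfolding B[OF x] theta_eq[OF x] A e c_def[symmetric] X_def[symmetric]
    using c X by (simp add: field_simps)
qed

context
  fixes C :: "nat \<Rightarrow> real \<Rightarrow> complex" and h :: complex and x :: real
  assumes C: "\<And>n. C n x = of_real (4 * real n + 2 * l + 3) *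
      (Chat n x - of_real (bessel_deriv_sum n / x) - h * (- 1) ^ n)"
    and x: "x \<in> {0<..b}"
begin

lemma C_0: "C 0 x = of_real (2 * l + 3) * (v' x / of_real (x powr (l + 1)) - of_real ((l + 1) / x) - h)"
proof -
  have "x powr (- l - 1) = 1 / x powr (l + 1)" by (simp add: powr_minus_divide[symmetric])
  then show ?thesis unfolding C by (simp add: Chat_def bessel_deriv_sum_def bessel_coeff_def nsbf_weight_def)
qed

text \<open>
  The Bessel contributions to \<open>\<gamma>\<close> are those of \<open>Q/2\<close>, which cancel between neighbours, and
  \<open>bessel_deriv_sum\<close>, which turns \<open>Ahat m\<close> into a multiple of \<open>\<beta>\<^sub>m\<close>.
\<close>
lemma C_Suc:
  "C (Suc m) x = - of_real ((4 * real m + 2 * l + 7) / (4 * real m + 2 * l + 3)) *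
    (C m x + of_real (4 * real m + 2 * l + 5) *
      (2 * v' x * theta l v v' B (Suc m) x / of_real (x powr (2 * real m + l + 3)) +
       2 * eta l v v' B (Suc m) x / (v x * of_real (x powr (2 * real m + l + 3))) -
       B m x / of_real x))"
proof -
  have x0: "x > 0" using x by simp
  define c where "c = 4 * real m + 2 * l + 3"
  have c: "c > 0" using l by (simp add: c_def)
  define Y where "Y = x powr (2 * real m + 2 + l)"
  have Y: "Y > 0" using x by (simp add: Y_def)
  have X: "x powr (2 * real m + l + 3) = x * Y"
  proof -
    have "x * Y = x powr (1 + (2 * real m + 2 + l))"
      unfolding Y_def using powr_mult_base[of x "2 * real m + 2 + l"] x0 by simp
    also have "\<dots> = x powr (2 * real m + l + 3)" by (rule arg_cong[where f = "(powr) x"]) simp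
    finally show ?thesis ..
  qed
  have e: "4 * real (Suc m) + 2 * l + 3 = c + 4" "4 * real m + 2 * l + 7 = c + 4" "4 * real m + 2 * l + 5 = c + 2"
    "2 * real m + l + 5/2 = (c + 2) / 2"
    by (auto simp: c_def)
  define s where "s = (- 1 :: complex) ^ m"
  define A where "A = Ahat m x"
  define \<rho> where "\<rho> = rho m x"
  define U where "U = V m x"
  define d where "d = complex_of_real (bessel_deriv_sum m / x)"
  have d: "complex_of_real (bessel_deriv_sum (Suc m) / x) = - of_real (c + 2) * s / of_real x - d"
  proof -
    have "bessel_deriv_sum (Suc m) = (c + 2) / 2 * (- 2 * (-1) ^ m) - bessel_deriv_sum m"
      using bessel_deriv_sum_Suc_add[of m] unfolding e by (simp only: eq_diff_eq)
    then have "bessel_deriv_sum (Suc m) / x = ((c + 2) / 2 * (- 2 * (-1) ^ m)) / x - bessel_deriv_sum m / x"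
      by (simp only: diff_divide_distrib)
    then have "complex_of_real (bessel_deriv_sum (Suc m) / x) =
        of_real (((c + 2) / 2 * (- 2 * (-1) ^ m)) / x - bessel_deriv_sum m / x)" by (simp only:)
    then show ?thesis
      by (simp add: s_def d_def algebra_simps add_divide_distrib diff_divide_distrib)
  qed
  have Ch: "Chat (Suc m) x = of_real ((c + 2) / 2) * ((v' x * \<rho> + U / v x) / of_real (x * Y) - 2 * A / of_real x) - Chat m x"
    using Chat_Suc_add[OF x, of m] unfolding X e \<rho>_def U_def A_def by (simp only: eq_diff_eq)
  have "- of_real ((c + 4) / c) * (of_real c * (Chat m x - d - h * s) + of_real (c + 2) *
      (2 * v' x * (- of_real (c / 4) * \<rho>) / of_real (x * Y) +
       2 * (- of_real (c / 4) * (U - 4 * (v x * (of_real (1 * Y) * (A - s))))) / (v x * of_real (x * Y)) -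
       (of_real c * (A - s)) / of_real x)) =
     of_real (c + 4) * (of_real ((c + 2) / 2) * ((v' x * \<rho> + U / v x) / of_real (x * Y) - 2 * A / of_real x) - Chat m x -
      (- of_real (c + 2) * s / of_real x - d) - h * (- s))"
  proof -
    define p q where "p = v' x * \<rho> / of_real (x * Y)" and "q = U / v x / of_real (x * Y)"
    have p: "2 * v' x * (- of_real (c / 4) * \<rho>) / of_real (x * Y) = - of_real (c / 2) * p"
      by (simp add: p_def)
    have q: "2 * (- of_real (c / 4) * (U - 4 * (v x * (of_real (1 * Y) * (A - s))))) / (v x * of_real (x * Y)) =
        - of_real (c / 2) * q + of_real (2 * c) * ((A - s) / of_real x)"
      using v_nonzero[OF x] Y x0 by (simp add: q_def field_simps)
    have pq: "(v' x * \<rho> + U / v x) / of_real (x * Y) = p + q"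
      by (simp add: p_def q_def add_divide_distrib)
    define k where "k = complex_of_real ((c + 4) / c)"
    have k: "complex_of_real (c + 4) = k * of_real c" using c by (simp add: k_def)
    define z where "z = inverse (complex_of_real x)"
    define a where "a = complex_of_real (c / 2)"
    have a: "complex_of_real c = 2 * a" "complex_of_real (c + 2) = 2 * a + 2" "complex_of_real ((c + 2) / 2) = a + 1"
      "complex_of_real (c / 2) = a" "complex_of_real (2 * c) = 4 * a"
      by (simp_all add: a_def add_divide_distrib)
    show ?thesis
      unfolding p q pq k k_def[symmetric] a divide_inverse[of _ "of_real x"] z_def[symmetric]
      by (simp add: algebra_simps)
  qed
  then show ?thesis
    unfolding C B[OF x] theta_eq[OF x] eta_eq[OF x] Ch d X e Y_def[symmetric] c_def[symmetric] s_def[symmetric]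
      A_def[symmetric] \<rho>_def[symmetric] U_def[symmetric] d_def[symmetric]
    by (simp add: s_def[symmetric])
qed

end

end

end

section \<open>Taylor coefficients of the solution and of the kernels\<close>

lemma tendsto_quotient_of_asymp_equiv:
  fixes f g :: "real \<Rightarrow> complex"
  assumes fg: "f \<sim>[at_right 0] g" and g: "\<And>x. x > 0 \<Longrightarrow> g x \<noteq> 0"
  shows "((\<lambda>x. f x / g x) \<longlongrightarrow> 1) (at_right 0)"
proof (rule Lim_transform_eventually)
  show "((\<lambda>x. if f x = 0 \<and> g x = 0 then 1 else f x / g x) \<longlongrightarrow> 1) (at_right 0)"
    using fg unfolding asymp_equiv_def .
  show "\<forall>\<^sub>F x in at_right 0. (if f x = 0 \<and> g x = 0 then 1 else f x / g x) = f x / g x"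
    using eventually_at_right_less[of 0] by eventually_elim (use g in auto)
qed

lemma has_vector_derivative_quotient:
  fixes f g :: "real \<Rightarrow> complex"
  assumes f: "(f has_vector_derivative f') (at x within S)" and g: "(g has_vector_derivative g') (at x within S)"
    and "g x \<noteq> 0"
  shows "((\<lambda>x. f x / g x) has_vector_derivative (g x * f' - g' * f x) / (g x)\<^sup>2) (at x within S)"
proof -
  have "((\<lambda>x. f x / g x) has_derivative
      (\<lambda>h. - f x * (inverse (g x) * (h *\<^sub>R g') * inverse (g x)) + (h *\<^sub>R f') / g x)) (at x within S)"
    using f g assms(3) unfolding has_vector_derivative_def by (rule has_derivative_divide)
  also have "(\<lambda>h. - f x * (inverse (g x) * (h *\<^sub>R g') * inverse (g x)) + (h *\<^sub>R f') / g x) =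
      (\<lambda>h. h *\<^sub>R ((g x * f' - g' * f x) / (g x)\<^sup>2))"
    using assms(3) by (auto simp: fun_eq_iff scaleR_conv_of_real field_simps power2_eq_square)
  finally show ?thesis unfolding has_vector_derivative_def .
qed

context zero_energy_solution
begin

text \<open>
  The iteration applied to \<open>g = d\<^sub>l(\<omega>) u(\<omega>,x) / v(x)\<close>, which tends to \<open>1\<close> at \<open>0\<close> by the normalisation of \<open>u\<close>.
\<close>
lemma taylor_solution:
  assumes v: "bessel_solution b l q 0 v v'" and u: "regular_solutions b l q u u'"
  obtains \<delta> where "\<delta> > 0"
    "\<And>\<omega> x. 0 < \<omega> \<Longrightarrow> \<omega> < \<delta> \<Longrightarrow> x \<in> {0<..b} \<Longrightarrow>
      (\<lambda>k. of_real (\<omega> ^ (2 * k)) * (v x * r k x)) sums (d_coeff l (of_real \<omega>) * u (of_real \<omega>) x)"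
    "\<And>\<omega> x. 0 < \<omega> \<Longrightarrow> \<omega> < \<delta> \<Longrightarrow> x \<in> {0<..b} \<Longrightarrow>
      (\<lambda>k. of_real (\<omega> ^ (2 * k)) * (v' x * r k x + W k x / v x)) sums (d_coeff l (of_real \<omega>) * u' (of_real \<omega>) x)"
proof -
  obtain c C where c: "0 < c" "0 < C"
    "\<And>x. x \<in> {0<..b} \<Longrightarrow> c * x powr (l + 1) \<le> norm (v x)"
    "\<And>x. x \<in> {0<..b} \<Longrightarrow> norm (v x) \<le> C * x powr (l + 1)"
    using v_two_sided_bound by metis
  have main: "(\<lambda>k. of_real (\<omega> ^ (2 * k)) * (v x * r k x)) sums (d_coeff l (of_real \<omega>) * u (of_real \<omega>) x)"
    "(\<lambda>k. of_real (\<omega> ^ (2 * k)) * (v' x * r k x + W k x / v x)) sums (d_coeff l (of_real \<omega>) * u' (of_real \<omega>) x)"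
    if \<omega>: "0 < \<omega>" "\<omega> < c / (C * b)" and x: "x \<in> {0<..b}" for \<omega> x
  proof -
    define d where "d = d_coeff l (of_real \<omega>)"
    define U U' where "U = u (of_real \<omega>)" and "U' = u' (of_real \<omega>)"
    have "complex_of_real \<omega> \<notin> \<real>\<^sub>\<le>\<^sub>0" using \<omega> by simp
    with u have sol: "bessel_solution b l q ((of_real \<omega>)\<^sup>2) U U'"
      and asy: "U \<sim>[at_right 0] (\<lambda>x. of_real (sqrt pi / (2 powr (l + 1) * Gamma (l + 3/2))) *
                (of_real \<omega> * of_real x) powr of_real (l + 1))"
      unfolding regular_solutions_def U_def U'_def by auto
  let ?n = "\<lambda>x. of_real (sqrt pi / (2 powr (l + 1) * Gamma (l + 3/2))) * (of_real \<omega> * of_real x) powr of_real (l + 1)"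
    have G: "Gamma (l + 3/2) > 0" using l by (intro Gamma_real_pos) auto
    have dn: "d * (?n x) = of_real (x powr (l + 1))" if "x > 0" for x
    proof -
      have "(complex_of_real \<omega> * of_real x) powr of_real (l + 1) = of_real (\<omega> powr (l + 1) * x powr (l + 1))"
        using powr_of_real[of "\<omega> * x" "l + 1"] \<omega> that by (simp add: powr_mult)
      moreover have "d = of_real (2 powr (l + 1) * Gamma (l + 3/2) / sqrt pi / \<omega> powr (l + 1))"
        using powr_of_real[of \<omega> "l + 1"] \<omega> by (simp add: d_def d_coeff_def)
      moreover have "2 powr (l + 1) * Gamma (l + 3/2) / sqrt pi / \<omega> powr (l + 1) *
          (sqrt pi / (2 powr (l + 1) * Gamma (l + 3/2)) * (\<omega> powr (l + 1) * x powr (l + 1))) = x powr (l + 1)"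
        using G \<omega> by simp
      ultimately show ?thesis by (simp only: of_real_mult[symmetric])
    qed
    define g where "g = (\<lambda>x. d * (U x / v x))"
    define w where "w = (\<lambda>x. d * (v x * U' x - v' x * U x))"
    have g_deriv: "(g has_vector_derivative w x / (v x)\<^sup>2) (at x within {0<..b})" if x: "x \<in> {0<..b}" for x
    proof -
      have "(U has_vector_derivative U' x) (at x within {0<..b})"
        using sol x unfolding bessel_solution_def by blast
      from has_vector_derivative_mult_right[OF has_vector_derivative_quotient[OF this v_deriv[OF x] v_nonzero[OF x]], of d]
      show ?thesis unfolding g_def w_def by simp
    qed
    have w_deriv: "(w has_vector_derivative - of_real (\<omega>\<^sup>2) * (v x)\<^sup>2 * g x) (at x within {0<..b})"
      if x: "x \<in> {0<..b}" for x
    proof -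
      have "(w has_vector_derivative d * (- ((of_real \<omega>)\<^sup>2) * v x * U x)) (at x within {0<..b})"
        unfolding w_def by (intro has_vector_derivative_mult_right wronskian_derivative[OF v sol x])
      also have "d * (- ((of_real \<omega>)\<^sup>2) * v x * U x) = - of_real (\<omega>\<^sup>2) * (v x)\<^sup>2 * g x"
        using v_nonzero[OF x] by (simp add: g_def power2_eq_square)
      finally show ?thesis .
    qed
    have g_lim: "(g \<longlongrightarrow> 1) (at_right 0)"
    proof (rule Lim_transform_eventually)
      have n0: "d * ?n x \<noteq> 0" if "x > 0" for x
        unfolding dn[OF that] using that by simp
      have "((\<lambda>x. (U x / ?n x) / (v x / of_real (x powr (l + 1)))) \<longlongrightarrow> 1 / 1) (at_right 0)"
      proof (intro tendsto_divide v_asymp)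
        show "((\<lambda>x. U x / ?n x) \<longlongrightarrow> 1) (at_right 0)"
          by (rule tendsto_quotient_of_asymp_equiv[OF asy]) (use n0 in force)
      qed simp
      then show "((\<lambda>x. (U x / ?n x) / (v x / of_real (x powr (l + 1)))) \<longlongrightarrow> 1) (at_right 0)" by simp
      show "\<forall>\<^sub>F x in at_right 0. (U x / ?n x) / (v x / of_real (x powr (l + 1))) = g x"
        using eventually_at_right_less[of 0]
      proof eventually_elim
        case (elim x)
        have "(U x / ?n x) / (v x / (d * ?n x)) = d * (U x / v x)" using n0[OF elim] by simp
        then show ?case unfolding g_def dn[OF elim] .
      qed
    qed
    \<comment> \<open>The reason for the bound \<open>c / (C * b)\<close> on \<open>\<omega>\<close>: the geometric series of the remainders converges.\<close>
    have "\<omega> * (C / c) * b < 1" using \<omega>(2) c b by (simp add: field_simps)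
    moreover have "0 \<le> \<omega> * (C / c) * b" using \<omega>(1) c b by simp
    ultimately have "(\<omega> * (C / c) * b)\<^sup>2 < 1" by (simp add: power_less_one_iff)
    then have small: "\<omega>\<^sup>2 * (C / c)\<^sup>2 * b\<^sup>2 < 1" by (simp only: power_mult_distrib)
    have s1: "(\<lambda>k. of_real (\<omega> ^ (2 * k)) * r k x) sums g x"
      by (rule spectral_series_sums(1)[of g w \<omega> c C]) (use g_deriv w_deriv g_lim c small x in auto)
    have s2: "(\<lambda>k. of_real (\<omega> ^ (2 * k)) * W k x) sums w x"
      by (rule spectral_series_sums(2)[of g w \<omega> c C]) (use g_deriv w_deriv g_lim c small x in auto)
    have "(\<lambda>k. v x * (of_real (\<omega> ^ (2 * k)) * r k x)) sums (v x * g x)"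
      by (intro sums_mult s1)
    moreover have "v x * g x = d * U x" using v_nonzero[OF x] by (simp add: g_def)
    ultimately show "(\<lambda>k. of_real (\<omega> ^ (2 * k)) * (v x * r k x)) sums (d_coeff l (of_real \<omega>) * u (of_real \<omega>) x)"
      by (simp only: d_def U_def mult.left_commute)
    have "(\<lambda>k. v' x * (of_real (\<omega> ^ (2 * k)) * r k x) + of_real (\<omega> ^ (2 * k)) * W k x / v x) sums (v' x * g x + w x / v x)"
      by (intro sums_add sums_mult sums_divide s1 s2)
    moreover have "v' x * g x + w x / v x = d * U' x"
      using v_nonzero[OF x] by (simp add: g_def w_def field_simps)
    moreover have "v' x * (of_real (\<omega> ^ (2 * k)) * r k x) + of_real (\<omega> ^ (2 * k)) * W k x / v x =
        of_real (\<omega> ^ (2 * k)) * (v' x * r k x + W k x / v x)" for k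
      by (simp add: distrib_left)
    ultimately show "(\<lambda>k. of_real (\<omega> ^ (2 * k)) * (v' x * r k x + W k x / v x)) sums (d_coeff l (of_real \<omega>) * u' (of_real \<omega>) x)"
      by (simp only: d_def U'_def)
  qed
  show ?thesis by (rule that[OF _ main]) (use c b in auto)
qed

end

text \<open>
  Here \<open>f\<^sub>k\<close> is a Taylor coefficient of \<open>u\<close> or \<open>u'\<close>, and \<open>s\<^sub>k\<close> the factor by which the Bessel part of it
  differs from that of \<open>u\<close>.
\<close>
lemma nsbf_coeff_taylor:
  assumes l: "l \<ge> -1/2" and x: "x > 0" and K: "K x absolutely_integrable_on {-x..x}"
    and f: "\<And>k. f k = of_real (bessel_coeff l k * (x powr (l + 1) * x ^ (2 * k))) * s k +
      (-1) ^ k / fact (2 * k) * moment (K x) x (2 * k)"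
  shows "nsbf_coeff l K n x = of_real (4 * real n + 2 * l + 3) *
    ((\<Sum>k\<le>n. of_real (nsbf_weight l n k) * (of_real (1 * x powr (- l - 1 - 2 * real k)) * f k)) -
     (\<Sum>k\<le>n. of_real (nsbf_weight l n k * bessel_coeff l k) * s k))"
proof -
  have "of_real (nsbf_weight l n k / (x powr (l + 1) * x ^ (2 * k))) * ((-1) ^ k / fact (2 * k) * moment (K x) x (2 * k)) =
      of_real (nsbf_weight l n k) * (of_real (1 * x powr (- l - 1 - 2 * real k)) * f k) -
      of_real (nsbf_weight l n k * bessel_coeff l k) * s k" for k
  proof -
    define X where "X = x powr (l + 1) * x ^ (2 * k)"
    have X: "X > 0" using x by (simp add: X_def)
    have "x powr (- l - 1 - 2 * real k) * (x powr (l + 1) * x powr real (2 * k)) = x powr 0"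
      unfolding powr_add[symmetric] by (rule arg_cong[where f = "(powr) x"]) simp
    then have p: "x powr (- l - 1 - 2 * real k) = 1 / X"
      using x X unfolding X_def powr_realpow[OF x] by (simp add: field_simps)
    have m: "(-1) ^ k / fact (2 * k) * moment (K x) x (2 * k) = f k - of_real (bessel_coeff l k * X) * s k"
      unfolding f X_def by simp
    show ?thesis unfolding m p X_def[symmetric] using X by (simp add: field_simps)
  qed
  then show ?thesis
    unfolding nsbf_coeff_eq_moments[where K = K, OF l x K] by (simp only: sum_subtractf)
qed

theorem mainTheorem7:
  fixes b l \<mu> :: real
    and q :: "real \<Rightarrow> complex"
    and u u' :: "complex \<Rightarrow> real \<Rightarrow> complex"
    and u0 u0' :: "real \<Rightarrow> complex"
    and R :: "real \<Rightarrow> real \<Rightarrow> complex"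
    and \<beta> :: "nat \<Rightarrow> real \<Rightarrow> complex"
    and \<eta> \<theta> :: "nat \<Rightarrow> real \<Rightarrow> complex"
  assumes "b > 0" and "l \<ge> -1/2"
    and "0 \<le> \<mu>" and "\<mu> < 1/2"
    and "(\<lambda>x. of_real (x powr \<mu>) * q_tilde b l q x) absolutely_integrable_on {0<..b}"
    and "regular_solutions b l q u u'"
    and "is_R_kernel b l u R"
    and "bessel_solution b l q 0 u0 u0'"
    and "u0 \<sim>[at_right 0] (\<lambda>x. of_real (x powr (l + 1)))"
    and "\<forall>x\<in>{0<..b}. u0 x \<noteq> 0"
    and "\<beta> = nsbf_coeff l R"
    and "\<eta> = eta l u0 u0' \<beta>"
    and "\<theta> = theta l u0 u0' \<beta>"
  shows
    "(\<forall>x\<in>{0<..b}.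
        \<beta> 0 x = of_real (2 * l + 3) * (u0 x / of_real (x powr (l + 1)) - 1) \<and>
        (\<forall>n\<ge>1.
           eta_integrand l u0 u0' \<beta> n absolutely_integrable_on {0<..x} \<and>
           theta_integrand l u0 u0' \<beta> n absolutely_integrable_on {0<..x} \<and>
           \<beta> n x =
             - of_real ((4 * real n + 2 * l + 3) / (4 * real n + 2 * l - 1)) *
             (\<beta> (n - 1) x +
              of_real (2 * (4 * real n + 2 * l + 1)) * u0 x * \<theta> n x /
                of_real (x powr (2 * real n + l + 1))))) \<and>
     ((\<exists>p\<in>W1 3 b. \<forall>x\<in>{0<..b}. q x = p x) \<longrightarrow>
      (\<forall>R2 \<gamma>. is_R2_kernel b l q u' R2 \<and> \<gamma> = nsbf_coeff l R2 \<longrightarrow>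
        (\<forall>x\<in>{0<..b}.
           \<gamma> 0 x =
             of_real (2 * l + 3) *
             (u0' x / of_real (x powr (l + 1)) - of_real ((l + 1) / x) - Q_int q x / 2) \<and>
           (\<forall>n\<ge>1.
              \<gamma> n x =
                - of_real ((4 * real n + 2 * l + 3) / (4 * real n + 2 * l - 1)) *
                (\<gamma> (n - 1) x +
                 of_real (4 * real n + 2 * l + 1) *
                 (2 * u0' x * \<theta> n x / of_real (x powr (2 * real n + l + 1)) +
                  2 * \<eta> n x / (u0 x * of_real (x powr (2 * real n + l + 1))) -
                  \<beta> (n - 1) x / of_real x))))))"
proof -
  note b = assms(1) and l = assms(2) and u = assms(6) and R = assms(7) and u0 = assms(8) and nz = assms(10)
  have asym: "((\<lambda>x. u0 x / of_real (x powr (l + 1))) \<longlongrightarrow> 1) (at_right 0)"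
    by (rule tendsto_quotient_of_asymp_equiv[OF assms(9)]) simp
  interpret zero_energy_solution b l u0 u0'
  proof
    show "(u0 has_vector_derivative u0' x) (at x within {0<..b})" if "x \<in> {0<..b}" for x
      using u0 that unfolding bessel_solution_def by blast
    show "continuous_on {0<..b} u0'" by (rule bessel_solution_continuous(2)[OF u0])
  qed (use b l asym nz in auto)
  have u0'_bounded: "powr_bounded b u0' (-1/2)"
    by (rule bessel_solution_deriv_bounded[OF b l assms(3,4,5) u0 v_bounded])
  obtain \<delta> where \<delta>: "\<delta> > 0"
    "\<And>\<omega> x. 0 < \<omega> \<Longrightarrow> \<omega> < \<delta> \<Longrightarrow> x \<in> {0<..b} \<Longrightarrow>
      (\<lambda>k. of_real (\<omega> ^ (2 * k)) * (u0 x * r k x)) sums (d_coeff l (of_real \<omega>) * u (of_real \<omega>) x)"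
    "\<And>\<omega> x. 0 < \<omega> \<Longrightarrow> \<omega> < \<delta> \<Longrightarrow> x \<in> {0<..b} \<Longrightarrow>
      (\<lambda>k. of_real (\<omega> ^ (2 * k)) * (u0' x * r k x + W k x / u0 x)) sums (d_coeff l (of_real \<omega>) * u' (of_real \<omega>) x)"
    by (rule taylor_solution[OF u0 u]) blast
  have nonneg: "complex_of_real \<omega> \<notin> \<real>\<^sub>\<le>\<^sub>0" if "\<omega> > 0" for \<omega> using that by simp
  let ?B = "\<lambda>x k. complex_of_real (bessel_coeff l k * (x powr (l + 1) * x ^ (2 * k)))"
  let ?M = "\<lambda>K x k. (-1 :: complex) ^ k / fact (2 * k) * moment (K x) x (2 * k)"
  let ?p = "\<lambda>\<omega> k. complex_of_real (\<omega> ^ (2 * k))"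
  let ?d = "\<lambda>\<omega>. d_coeff l (of_real \<omega>)"
  have B: "\<beta> n x = of_real (4 * real n + 2 * l + 3) * (Ahat n x - (- 1) ^ n)" if x: "x \<in> {0<..b}" for n x
  proof -
    have x0: "x > 0" using x by simp
    have Rx: "R x absolutely_integrable_on {-x..x}" "\<And>t. t \<in> {-x..x} \<Longrightarrow> R x (- t) = R x t"
      "\<And>\<omega>. \<omega> \<notin> \<real>\<^sub>\<le>\<^sub>0 \<Longrightarrow> d_coeff l \<omega> * u \<omega> x = d_coeff l \<omega> * bessel_b l (\<omega> * of_real x) +
             (LINT t:{-x..x}|lebesgue. R x t * exp (\<i> * \<omega> * of_real t))"
      using R x unfolding is_R_kernel_def by (auto intro: absolutely_integrable_continuous_real)
    have "u0 x * r k x = ?B x k * 1 +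
        ?M R x k" for k
    proof (rule even_series_coeff_unique[OF \<delta>(1) \<delta>(2)[OF _ _ x]])
      fix \<omega> :: real assume \<omega>: "0 < \<omega>" "\<omega> < \<delta>"
      have "(\<lambda>k. ?p \<omega> k * ?B x k +
          ?p \<omega> k * (?M R x k)) sums
          (?d \<omega> * bessel_b l (of_real \<omega> * of_real x) +
           (LINT t:{-x..x}|lebesgue. R x t * exp (\<i> * of_real \<omega> * of_real t)))"
        by (intro sums_add d_coeff_bessel_b fourier_moment_sums l \<omega> x0 Rx)
      then show "(\<lambda>k. ?p \<omega> k * (?B x k * 1 +
          ?M R x k)) sums (?d \<omega> * u (of_real \<omega>) x)"
        unfolding Rx(3)[OF nonneg[OF \<omega>(1)]] by (simp only: distrib_left mult_1_right)
    qed
    from nsbf_coeff_taylor[where K = R, OF l x0 Rx(1) this]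
    have "\<beta> n x = of_real (4 * real n + 2 * l + 3) *
        (Ahat n x - (\<Sum>k\<le>n. of_real (nsbf_weight l n k * bessel_coeff l k) * 1))"
      unfolding assms(11) Ahat_def .
    also have "(\<Sum>k\<le>n. of_real (nsbf_weight l n k * bessel_coeff l k) * 1) =
        complex_of_real (\<Sum>k\<le>n. nsbf_weight l n k * bessel_coeff l k)" by simp
    also have "\<dots> = (- 1) ^ n" unfolding sum_nsbf_weight_bessel[OF l] by simp
    finally show ?thesis .
  qed
  have shift: "2 * real (Suc m) + l + 1 = 2 * real m + l + 3" "4 * real (Suc m) + 2 * l + 1 = 4 * real m + 2 * l + 5"
    "4 * real (Suc m) + 2 * l + 3 = 4 * real m + 2 * l + 7" "4 * real (Suc m) + 2 * l - 1 = 4 * real m + 2 * l + 3" for m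
    by auto
  show ?thesis
  proof (intro conjI ballI allI impI; (elim conjE)?)
    fix x assume x: "x \<in> {0<..b}"
    show "\<beta> 0 x = of_real (2 * l + 3) * (u0 x / of_real (x powr (l + 1)) - 1)"
      by (rule B_0[OF u0'_bounded B x])
    fix n :: nat assume "n \<ge> 1"
    then obtain m where n: "n = Suc m" by (cases n) auto
    show "eta_integrand l u0 u0' \<beta> n absolutely_integrable_on {0<..x}"
      unfolding n by (rule eta_integrand_integrable[OF u0'_bounded B x])
    show "theta_integrand l u0 u0' \<beta> n absolutely_integrable_on {0<..x}"
      unfolding n by (rule theta_integrand_integrable[OF u0'_bounded B x])
    show "\<beta> n x = - of_real ((4 * real n + 2 * l + 3) / (4 * real n + 2 * l - 1)) *
             (\<beta> (n - 1) x +
              of_real (2 * (4 * real n + 2 * l + 1)) * u0 x * \<theta> n x /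
                of_real (x powr (2 * real n + l + 1)))"
      unfolding n assms(13) shift diff_Suc_1 by (rule B_Suc[OF u0'_bounded B x])
  next
    fix R2 \<gamma> x assume R2: "is_R2_kernel b l q u' R2" and \<gamma>: "\<gamma> = nsbf_coeff l R2" and x: "x \<in> {0<..b}"
    have x0: "x > 0" using x by simp
    have Rx: "R2 x absolutely_integrable_on {-x..x}" "\<And>t. t \<in> {-x..x} \<Longrightarrow> R2 x (- t) = R2 x t"
      "\<And>\<omega>. \<omega> \<notin> \<real>\<^sub>\<le>\<^sub>0 \<Longrightarrow> d_coeff l \<omega> * u' \<omega> x = d_coeff l \<omega> * (\<omega> * deriv (bessel_b l) (\<omega> * of_real x) +
               Q_int q x / 2 * bessel_b l (\<omega> * of_real x)) +
             (LINT t:{-x..x}|lebesgue. R2 x t * exp (\<i> * \<omega> * of_real t))"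
      using R2 x unfolding is_R2_kernel_def by auto
    define h where "h = Q_int q x / 2"
    have "u0' x * r k x + W k x / u0 x = ?B x k *
        (of_real ((l + 1 + 2 * real k) / x) + h) + ?M R2 x k" for k
    proof (rule even_series_coeff_unique[OF \<delta>(1) \<delta>(3)[OF _ _ x]])
      fix \<omega> :: real assume \<omega>: "0 < \<omega>" "\<omega> < \<delta>"
      have "(\<lambda>k. (?p \<omega> k *
            of_real ((l + 1 + 2 * real k) / x * (bessel_coeff l k * (x powr (l + 1) * x ^ (2 * k)))) +
          h * (?p \<omega> k * ?B x k)) +
          ?p \<omega> k * (?M R2 x k)) sums
          ((?d \<omega> * (of_real \<omega> * deriv (bessel_b l) (of_real \<omega> * of_real x)) +
            h * (?d \<omega> * bessel_b l (of_real \<omega> * of_real x))) +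
           (LINT t:{-x..x}|lebesgue. R2 x t * exp (\<i> * of_real \<omega> * of_real t)))"
        by (intro sums_add sums_mult d_coeff_bessel_b d_coeff_deriv_bessel_b fourier_moment_sums l \<omega> x0 Rx)
      then show "(\<lambda>k. ?p \<omega> k * (?B x k *
          (of_real ((l + 1 + 2 * real k) / x) + h) +
          ?M R2 x k)) sums (?d \<omega> * u' (of_real \<omega>) x)"
        unfolding Rx(3)[OF nonneg[OF \<omega>(1)]] h_def[symmetric]
        by (simp only: distrib_left of_real_mult mult_ac)
    qed
    from nsbf_coeff_taylor[where K = R2, OF l x0 Rx(1) this]
    have "\<gamma> n x = of_real (4 * real n + 2 * l + 3) *
        (Chat n x - (\<Sum>k\<le>n. of_real (nsbf_weight l n k * bessel_coeff l k) * (of_real ((l + 1 + 2 * real k) / x) + h)))" for n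
      unfolding \<gamma> Chat_def .
    moreover have "(\<Sum>k\<le>n. of_real (nsbf_weight l n k * bessel_coeff l k) * (of_real ((l + 1 + 2 * real k) / x) + h)) =
        of_real (bessel_deriv_sum n / x) + h * (- 1) ^ n" for n
    proof -
      have "(\<Sum>k\<le>n. of_real (nsbf_weight l n k * bessel_coeff l k) * (of_real ((l + 1 + 2 * real k) / x) + h)) =
          of_real (bessel_deriv_sum n / x) + h * of_real (\<Sum>k\<le>n. nsbf_weight l n k * bessel_coeff l k)"
        unfolding bessel_deriv_sum_def sum_divide_distrib of_real_sum sum_distrib_left sum.distrib[symmetric]
        by (rule sum.cong) (simp_all add: algebra_simps)
      then show ?thesis unfolding sum_nsbf_weight_bessel[OF l] by simp
    qed
    ultimately have C: "\<gamma> n x = of_real (4 * real n + 2 * l + 3) *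
        (Chat n x - of_real (bessel_deriv_sum n / x) - h * (- 1) ^ n)" for n
      by (simp only: diff_diff_eq)
    show "\<gamma> 0 x = of_real (2 * l + 3) *
             (u0' x / of_real (x powr (l + 1)) - of_real ((l + 1) / x) - Q_int q x / 2)"
      unfolding h_def[symmetric] by (rule C_0[where B = \<beta> and C = \<gamma> and h = h, OF u0'_bounded B C x])
    fix n :: nat assume "n \<ge> 1"
    then obtain m where n: "n = Suc m" by (cases n) auto
    show "\<gamma> n x = - of_real ((4 * real n + 2 * l + 3) / (4 * real n + 2 * l - 1)) *
                (\<gamma> (n - 1) x +
                 of_real (4 * real n + 2 * l + 1) *
                 (2 * u0' x * \<theta> n x / of_real (x powr (2 * real n + l + 1)) +
                  2 * \<eta> n x / (u0 x * of_real (x powr (2 * real n + l + 1))) -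
                  \<beta> (n - 1) x / of_real x))"
      unfolding n assms(12,13) shift diff_Suc_1 by (rule C_Suc[where B = \<beta> and C = \<gamma> and h = h, OF u0'_bounded B C x])
  qed
qed

end
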